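(* Let $F(x)=\psi(x)+f(x)$ with $f(x)=\frac1n\sum_{i=1}^n f_i(x)$, $x\in\mathbb{R}^d$, where $\psi$ is proper convex, each $f_i$ is differentiable, possibly nonconvex and $L$-smooth, $f$ is $\sigma$-nonconvex for some $\sigma\in(0,L]$, and $\mathbb{E}_{i\in_R[n]}\|\nabla f(x)-\nabla f_i(x)\|^2\le\mathcal V$ for every $x$ with $\psi(x)<+\infty$. Let $x^\varnothing$ be a starting vector, let $\eta=\frac{C}{L}$ where $C\in(0,1]$ is any absolute constant, and let $\Delta_F$ be an upper bound on $F(x^\varnothing)-\min_x\{F(x)\}$. If $\varepsilon>0$ and $L\ge\sigma\ge\Omega\big(\frac{\varepsilon L}{\mathcal V^{1/2}}\big)$, then (for suitable absolute constants in the $\Theta(\cdot)$ parameter choices) the algorithm $\mathtt{Natasha1.5^{prune}}(F,x^\varnothing,\varepsilon)$ computes an output $x^{\mathsf{out}}$ with $$\mathbb{E}\big[\|\mathcal{G}_{F,\eta}(x^{\mathsf{out}})\|\big]\le\varepsilon$$ in gradient complexity $$T=O\Big(\frac{\mathcal V}{\varepsilon^2}\log^3\frac{L}{\sigma}+\frac{(L^2\sigma)^{1/3}\,\Delta_F\,\mathcal V^{2/3}}{\varepsilon^{10/3}}\Big).$$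
   Context: $\|\cdot\|$ is the Euclidean norm, $[n]=\{1,\dots,n\}$, and $i\in_R[n]$ means $i$ is uniform on $[n]$. The constants hidden in $O,\Omega,\Theta$ are absolute (they may depend on $C$). Logarithms $\log(L/\sigma)$ inside $O,\Theta,\Omega$ are read as $\max\{1,\log(L/\sigma)\}$, and parameters required to be integers are rounded. A function $f$ is $L$-smooth if $\|\nabla f(x)-\nabla f(y)\|\le L\|x-y\|$ for all $x,y$. A differentiable $f$ is $\sigma$-nonconvex if $f(y)\ge f(x)+\langle\nabla f(x),y-x\rangle-\frac\sigma2\|x-y\|^2$ for all $x,y$. Gradient mapping: for $F=\psi+f$ and $\eta>0$, $\mathcal G_{F,\eta}(x)=\frac1\eta(x-x')$ where $x'=\arg\min_y\{\psi(y)+\langle\nabla f(x),y\rangle+\frac1{2\eta}\|y-x\|^2\}$. Gradient complexity is the number of computations of $\nabla f_i(x)$ (for an index $i$ and a point $x$). Algorithm $\mathtt{Natasha1.5^{full}}(F,x^\varnothing,B,p,T',\alpha)$, with $B\in[n]$, $p\in[B]$, $T'\ge1$, $\alpha>0$. Set $\widehat x\leftarrow x^\varnothing$, $m\leftarrow B/p$, $X\leftarrow[\,]$. For $k=1,\dots,T'$: set $\widetilde{\mathbf x}\leftarrow\widehat x$ and $\mu\leftarrow\frac1B\sum_{i\in S}\nabla f_i(\widetilde{\mathbf x})$, with $S$ a uniformly random subset of $[n]$ of size $B$; then for $s=0,\dots,p-1$: set $x_0\leftarrow\widehat x$ and append $\widehat x$ to $X$; for $t=0,\dots,m-1$ draw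 $i\in_R[n]$, set $\widetilde\nabla\leftarrow\nabla f_i(x_t)-\nabla f_i(\widetilde{\mathbf x})+\mu+2\sigma(x_t-\widehat x)$ and $x_{t+1}=\arg\min_{y}\{\psi(y)+\frac1{2\alpha}\|y-x_t\|^2+\langle\widetilde\nabla,y\rangle\}$; then set $\widehat x$ to be a uniformly random element of $\{x_0,\dots,x_{m-1}\}$. At the end, let $\widehat y$ be a uniformly random vector in $X$ and $y^+\leftarrow\widehat x$, and return $(\widehat y,y^+)$. Algorithm $\mathtt{Natasha1.5^{prune}}(F,x^\varnothing,\varepsilon)$. Set $B\leftarrow\Theta(\mathcal V/\varepsilon^2)$, $p\leftarrow\big(\frac{\sigma^2}{48L^2}B\big)^{1/3}$, $\alpha\leftarrow\Theta\big(\frac{\sigma}{p^2L^2}\big)$. Run $(\widehat y,y^+)\leftarrow\mathtt{Natasha1.5^{full}}(F,x^\varnothing,B,p,T_0/B,\alpha)$ with $T_0=\Theta\big(\frac{(L^2\sigma)^{1/3}\Delta_F\mathcal V^{2/3}}{\varepsilon^{10/3}}\big)$ (the number of epochs $T_0/B$ is rounded up to an integer at least $1$). Define the $\sigma$-strongly convex function $G(x)=F(x)+\sigma\|x-\widehat y\|^2$, and return $x^{\mathsf{out}}\leftarrow\mathtt{SGD3^{sc}}(G,\widehat y,\sigma,O(L),T_{\mathsf{sgd}})$ with $T_{\mathsf{sgd}}=\Theta\big(\frac{\mathcal V}{\varepsilon^2}\log^3\frac L\sigma\big)$. The subroutine $\mathtt{SGD3^{sc}}$ is a known stochastic gradient method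 for convex problems with the following guarantee. Let $H(x)=\psi(x)+\frac1n\sum_i h_i(x)$ with $\psi$ proper convex, each $h_i$ differentiable, $h=\frac1n\sum_i h_i$ convex and $L'$-smooth, $H$ $\sigma'$-strongly convex with minimizer $x^*$, and $\mathbb E_i\|\nabla h(x)-\nabla h_i(x)\|^2\le\mathcal V$ on the domain of $\psi$. For every absolute constant $C'\in(0,1]$ and $T\ge\frac{L'}{\sigma'}\log\frac{L'}{\sigma'}$, $\mathtt{SGD3^{sc}}(H,x_0,\sigma',L',T)$ computes $T$ stochastic gradients and outputs $\bar x$ with $\mathbb E\|\mathcal G_{H,\eta'}(\bar x)\|\le O\big(\frac{\sqrt{\mathcal V}\log^{3/2}(L'/\sigma')}{\sqrt T}\big)+\big(1-\frac{\sigma'}{L'}\big)^{\Omega(T/\log(L'/\sigma'))}\sigma'\|x_0-x^*\|$, where $\eta'=C'/L'$. The number $n$ is regarded as large (online setting), so that $B\in[n]$. *)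

theory Defs
  imports "HOL-Probability.Probability"
begin

section \<open>The Euclidean spaces, for all dimensions at once\<close>

text \<open>
  The constants of the theorem must not depend on the dimension, so the dimension is quantified
  inside the statement and cannot be a type. The \<open>d\<close>-dimensional Euclidean space is therefore
  the subspace \<open>Rd d\<close> of vectors supported on the first \<open>d\<close> coordinates in the inner product
  space of finitely supported real sequences. All functions on it are total on the
  larger type, but only their values on \<open>Rd d\<close> are ever used.
\<close>

typedef fvec = "{f :: nat \<Rightarrow> real. finite {i. f i \<noteq> 0}}"
  morphisms coord Abs_fvec
  by (rule exI[of _ "\<lambda>_. 0"]) simp

lemma fvec_eqI: "(\<And>i. coord x i = coord y i) \<Longrightarrow> x = y"
  by (simp add: coord_inject[symmetric] fun_eq_iff)

lemma finite_coord: "finite {i. coord x i \<noteq> 0}"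
  using coord by auto

lemma finite_coord_combination: "finite {i. a * coord x i + b * coord y i \<noteq> 0}"
  by (rule finite_subset[OF _ finite_UnI[OF finite_coord[of x] finite_coord[of y]]]) auto

instantiation fvec :: real_vector
begin

definition zero_fvec :: fvec where
  "0 = Abs_fvec (\<lambda>_. 0)"

definition plus_fvec :: "fvec \<Rightarrow> fvec \<Rightarrow> fvec" where
  "x + y = Abs_fvec (\<lambda>i. coord x i + coord y i)"

definition uminus_fvec :: "fvec \<Rightarrow> fvec" where
  "- x = Abs_fvec (\<lambda>i. - coord x i)"

definition minus_fvec :: "fvec \<Rightarrow> fvec \<Rightarrow> fvec" where
  "x - y = Abs_fvec (\<lambda>i. coord x i - coord y i)"

definition scaleR_fvec :: "real \<Rightarrow> fvec \<Rightarrow> fvec" where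
  "c *\<^sub>R x = Abs_fvec (\<lambda>i. c * coord x i)"

lemma coord_simps [simp]:
  "coord 0 i = 0" "coord (x + y) i = coord x i + coord y i" "coord (- x) i = - coord x i"
  "coord (x - y) i = coord x i - coord y i" "coord (c *\<^sub>R x) i = c * coord x i"
  using finite_coord_combination[of 1 x 1 y] finite_coord_combination[of "-1" x 0 x]
    finite_coord_combination[of 1 x "-1" y] finite_coord_combination[of c x 0 x]
  by (simp_all add: zero_fvec_def plus_fvec_def uminus_fvec_def minus_fvec_def scaleR_fvec_def
      Abs_fvec_inverse)

instance
  by standard (rule fvec_eqI, simp add: algebra_simps)+

end

instantiation fvec :: real_inner
begin

definition inner_fvec :: "fvec \<Rightarrow> fvec \<Rightarrow> real" where
  "inner_fvec x y = (\<Sum>i | coord x i \<noteq> 0. coord x i * coord y i)"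

definition norm_fvec :: "fvec \<Rightarrow> real" where
  "norm_fvec x = sqrt (inner x x)"

definition dist_fvec :: "fvec \<Rightarrow> fvec \<Rightarrow> real" where
  "dist_fvec x y = norm (x - y)"

definition sgn_fvec :: "fvec \<Rightarrow> fvec" where
  "sgn_fvec x = inverse (norm x) *\<^sub>R x"

definition uniformity_fvec :: "(fvec \<times> fvec) filter" where
  [code del]: "uniformity_fvec = (INF e\<in>{0<..}. principal {(x, y). dist x y < e})"

definition open_fvec :: "fvec set \<Rightarrow> bool" where
  [code del]: "open_fvec U \<longleftrightarrow> (\<forall>x\<in>U. eventually (\<lambda>(x', y). x' = x \<longrightarrow> y \<in> U) uniformity)"

lemma inner_fvec_superset:
  assumes "finite A" "{i. coord x i \<noteq> 0} \<subseteq> A"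
  shows "inner x y = (\<Sum>i\<in>A. coord x i * coord y i)"
  unfolding inner_fvec_def using assms by (intro sum.mono_neutral_left) auto

instance
proof
  fix x y z :: fvec and a :: real
  show "dist x y = norm (x - y)" "sgn x = inverse (norm x) *\<^sub>R x" "norm x = sqrt (inner x x)"
    by (rule dist_fvec_def sgn_fvec_def norm_fvec_def)+
  show "(uniformity :: (fvec \<times> fvec) filter) = (INF e\<in>{0<..}. principal {(x, y). dist x y < e})"
    by (rule uniformity_fvec_def)
  show "open U \<longleftrightarrow> (\<forall>x\<in>U. eventually (\<lambda>(x', y). x' = x \<longrightarrow> y \<in> U) uniformity)" for U :: "fvec set"
    by (rule open_fvec_def)
  let ?A = "{i. coord x i \<noteq> 0} \<union> {i. coord y i \<noteq> 0}"
  have A: "finite ?A"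
    by (intro finite_UnI finite_coord)
  note inner_A = inner_fvec_superset[OF A]
  have sum_A: "inner (x + y) z = (\<Sum>i\<in>?A. coord (x + y) i * coord z i)"
    by (rule inner_A) auto
  have scale_A: "inner (a *\<^sub>R x) y = (\<Sum>i\<in>?A. coord (a *\<^sub>R x) i * coord y i)"
    by (rule inner_A) auto
  have x_A: "inner x w = (\<Sum>i\<in>?A. coord x i * coord w i)" for w
    by (rule inner_A) auto
  have y_A: "inner y w = (\<Sum>i\<in>?A. coord y i * coord w i)" for w
    by (rule inner_A) auto
  show "inner x y = inner y x"
    unfolding x_A y_A by (simp add: mult.commute)
  show "inner (x + y) z = inner x z + inner y z"
    unfolding sum_A x_A y_A by (simp add: distrib_right sum.distrib)
  show "inner (a *\<^sub>R x) y = a * inner x y"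
    unfolding scale_A x_A by (simp add: sum_distrib_left mult.assoc)
  show "0 \<le> inner x x"
    unfolding inner_fvec_def by (rule sum_nonneg) simp
  have "inner x x = 0 \<longleftrightarrow> (\<forall>i. coord x i = 0)"
    unfolding inner_fvec_def by (subst sum_nonneg_eq_0_iff) (auto simp: finite_coord)
  also have "\<dots> \<longleftrightarrow> x = 0"
    by (auto intro: fvec_eqI)
  finally show "inner x x = 0 \<longleftrightarrow> x = 0" .
qed

end

definition Rd :: "nat \<Rightarrow> fvec set" where
  "Rd d = {x. \<forall>i\<ge>d. coord x i = 0}"

text \<open>The analogue of \<^const>\<open>gderiv\<close> for functions on \<open>Rd d\<close>.\<close>

definition grad :: "nat \<Rightarrow> (fvec \<Rightarrow> real) \<Rightarrow> fvec \<Rightarrow> fvec" where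
  "grad d f x = (THE g. g \<in> Rd d \<and> (f has_derivative (\<lambda>h. inner g h)) (at x within Rd d))"


section \<open>Function classes and composite finite-sum problems\<close>

definition smooth :: "nat \<Rightarrow> real \<Rightarrow> (fvec \<Rightarrow> real) \<Rightarrow> bool" where
  "smooth d L f \<longleftrightarrow> f differentiable_on Rd d \<and>
     (\<forall>x\<in>Rd d. \<forall>y\<in>Rd d. norm (grad d f x - grad d f y) \<le> L * norm (x - y))"

definition nonconvex :: "nat \<Rightarrow> real \<Rightarrow> (fvec \<Rightarrow> real) \<Rightarrow> bool" where
  "nonconvex d \<sigma> f \<longleftrightarrow> f differentiable_on Rd d \<and>
     (\<forall>x\<in>Rd d. \<forall>y\<in>Rd d. f y \<ge> f x + inner (grad d f x) (y - x) - \<sigma> / 2 * (norm (x - y))\<^sup>2)"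

text \<open>For \<open>\<sigma> = 0\<close> this is convexity; the only product of the form \<open>0 * \<infinity>\<close> is excluded by
  taking \<open>t\<close> in the open unit interval.\<close>

definition strongly_convex :: "nat \<Rightarrow> real \<Rightarrow> (fvec \<Rightarrow> ereal) \<Rightarrow> bool" where
  "strongly_convex d \<sigma> H \<longleftrightarrow> (\<forall>x\<in>Rd d. \<forall>y\<in>Rd d. \<forall>t. 0 < t \<and> t < 1 \<longrightarrow>
     H ((1 - t) *\<^sub>R x + t *\<^sub>R y) + ereal (\<sigma> / 2 * t * (1 - t) * (norm (x - y))\<^sup>2)
       \<le> ereal (1 - t) * H x + ereal t * H y)"

definition proper_convex :: "nat \<Rightarrow> (fvec \<Rightarrow> ereal) \<Rightarrow> bool" where
  "proper_convex d \<psi> \<longleftrightarrow> (\<forall>x\<in>Rd d. \<psi> x \<noteq> -\<infinity>) \<and> (\<exists>x\<in>Rd d. \<psi> x \<noteq> \<infinity>) \<and> strongly_convex d 0 \<psi>"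

text \<open>The problem \<open>\<psi>(x) + 1/n (f\<^sub>1(x) + \<dots> + f\<^sub>n(x))\<close> on \<open>Rd d\<close>.\<close>

record problem =
  dimen :: nat
  ncomp :: nat
  psi :: "fvec \<Rightarrow> ereal"
  component :: "nat \<Rightarrow> fvec \<Rightarrow> real"

definition space_of :: "problem \<Rightarrow> fvec set" where
  "space_of F = Rd (dimen F)"

definition smooth_part :: "problem \<Rightarrow> fvec \<Rightarrow> real" where
  "smooth_part F x = (1 / real (ncomp F)) * (\<Sum>i\<in>{1..ncomp F}. component F i x)"

definition objective :: "problem \<Rightarrow> fvec \<Rightarrow> ereal" where
  "objective F x = psi F x + ereal (smooth_part F x)"

definition comp_grad :: "problem \<Rightarrow> nat \<Rightarrow> fvec \<Rightarrow> fvec" where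
  "comp_grad F i x = grad (dimen F) (component F i) x"

definition variance_le :: "problem \<Rightarrow> real \<Rightarrow> bool" where
  "variance_le F V \<longleftrightarrow> (\<forall>x\<in>space_of F. psi F x < \<infinity> \<longrightarrow>
     measure_pmf.expectation (pmf_of_set {1..ncomp F})
       (\<lambda>i. (norm (grad (dimen F) (smooth_part F) x - comp_grad F i x))\<^sup>2) \<le> V)"

definition prox_objective :: "problem \<Rightarrow> real \<Rightarrow> fvec \<Rightarrow> fvec \<Rightarrow> fvec \<Rightarrow> ereal" where
  "prox_objective F \<eta> v x y = psi F y + ereal (inner v y + 1 / (2 * \<eta>) * (norm (y - x))\<^sup>2)"

definition prox_step :: "problem \<Rightarrow> real \<Rightarrow> fvec \<Rightarrow> fvec \<Rightarrow> fvec" where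
  "prox_step F \<eta> v x = arg_min (prox_objective F \<eta> v x) (\<lambda>y. y \<in> space_of F)"

text \<open>
  The third conjunct says that the proximal minima exist (they are then unique, by strong
  convexity). It holds for every lower semicontinuous proper convex \<open>\<psi>\<close>, but not for, say,
  the indicator function of an open interval, for which gradient mapping and algorithms are
  not defined.
\<close>

definition composite_problem :: "problem \<Rightarrow> bool" where
  "composite_problem F \<longleftrightarrow>
     1 \<le> ncomp F \<and>
     proper_convex (dimen F) (psi F) \<and>
     (\<forall>\<eta>>0. \<forall>v\<in>space_of F. \<forall>x\<in>space_of F.
        \<exists>y. is_arg_min (prox_objective F \<eta> v x) (\<lambda>y. y \<in> space_of F) y) \<and>
     (\<forall>i\<in>{1..ncomp F}. component F i differentiable_on space_of F)"

definition grad_mapping :: "problem \<Rightarrow> real \<Rightarrow> fvec \<Rightarrow> fvec" where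
  "grad_mapping F \<eta> x =
     (1 / \<eta>) *\<^sub>R (x - prox_step F \<eta> (grad (dimen F) (smooth_part F) x) x)"


section \<open>Randomised computations that count gradient evaluations\<close>

text \<open>
  A computation is a distribution of pairs of a result and the number of component gradients
  evaluated. Algorithms access component gradients through \<open>eval_grad\<close> only.
\<close>

type_synonym 'r counted = "('r \<times> nat) pmf"

definition ret :: "'r \<Rightarrow> 'r counted" where
  "ret r = return_pmf (r, 0)"

definition draw :: "'r pmf \<Rightarrow> 'r counted" where
  "draw p = map_pmf (\<lambda>r. (r, 0)) p"

definition eval_grad :: "problem \<Rightarrow> nat \<Rightarrow> fvec \<Rightarrow> fvec counted" where
  "eval_grad F i x = return_pmf (comp_grad F i x, 1)"

definition bind_counted :: "'r counted \<Rightarrow> ('r \<Rightarrow> 's counted) \<Rightarrow> 's counted"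
    (infixl \<open>\<bind>\<^sub>c\<close> 54) where
  "m \<bind>\<^sub>c k = bind_pmf m (\<lambda>(r, c). map_pmf (\<lambda>(s, c'). (s, c + c')) (k r))"


section \<open>Natasha1.5\<close>

primrec sum_grads :: "problem \<Rightarrow> fvec \<Rightarrow> nat list \<Rightarrow> fvec counted" where
  "sum_grads F x [] = ret 0"
| "sum_grads F x (i # is) =
     eval_grad F i x \<bind>\<^sub>c (\<lambda>g. sum_grads F x is \<bind>\<^sub>c (\<lambda>s. ret (g + s)))"

text \<open>\<open>inner_loop F \<sigma> \<alpha> xt \<mu> xh m x\<close> returns the iterates \<open>[x\<^sub>0, \<dots>, x\<^bsub>m-1\<^esub>]\<close> with \<open>x\<^sub>0 = x\<close>,
  where \<open>xt\<close> is the snapshot with minibatch gradient \<open>\<mu>\<close> and \<open>xh\<close> the regularisation centre.\<close>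

primrec inner_loop ::
    "problem \<Rightarrow> real \<Rightarrow> real \<Rightarrow> fvec \<Rightarrow> fvec \<Rightarrow> fvec \<Rightarrow> nat \<Rightarrow> fvec \<Rightarrow> fvec list counted" where
  "inner_loop F \<sigma> \<alpha> xt \<mu> xh 0 x = ret []"
| "inner_loop F \<sigma> \<alpha> xt \<mu> xh (Suc m) x =
     draw (pmf_of_set {1..ncomp F}) \<bind>\<^sub>c (\<lambda>i.
     eval_grad F i x \<bind>\<^sub>c (\<lambda>g.
     eval_grad F i xt \<bind>\<^sub>c (\<lambda>gt.
     inner_loop F \<sigma> \<alpha> xt \<mu> xh m
       (prox_step F \<alpha> (g - gt + \<mu> + (2 * \<sigma>) *\<^sub>R (x - xh)) x) \<bind>\<^sub>c (\<lambda>xs.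
     ret (x # xs)))))"

text \<open>\<open>X\<close> is the list of recorded points; the state is the pair of current centre and \<open>X\<close>.\<close>

primrec sub_epochs ::
    "problem \<Rightarrow> real \<Rightarrow> real \<Rightarrow> fvec \<Rightarrow> fvec \<Rightarrow> nat \<Rightarrow> nat \<Rightarrow> fvec \<Rightarrow> fvec list
       \<Rightarrow> (fvec \<times> fvec list) counted" where
  "sub_epochs F \<sigma> \<alpha> xt \<mu> m 0 xh X = ret (xh, X)"
| "sub_epochs F \<sigma> \<alpha> xt \<mu> m (Suc p) xh X =
     inner_loop F \<sigma> \<alpha> xt \<mu> xh m xh \<bind>\<^sub>c (\<lambda>xs.
     draw (pmf_of_set {..<m}) \<bind>\<^sub>c (\<lambda>j.
     sub_epochs F \<sigma> \<alpha> xt \<mu> m p (xs ! j) (X @ [xh])))"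

primrec epochs ::
    "problem \<Rightarrow> real \<Rightarrow> nat \<Rightarrow> nat \<Rightarrow> real \<Rightarrow> nat \<Rightarrow> fvec \<Rightarrow> fvec list
       \<Rightarrow> (fvec \<times> fvec list) counted" where
  "epochs F \<sigma> B p \<alpha> 0 xh X = ret (xh, X)"
| "epochs F \<sigma> B p \<alpha> (Suc T) xh X =
     draw (pmf_of_set {S. S \<subseteq> {1..ncomp F} \<and> card S = B}) \<bind>\<^sub>c (\<lambda>S.
     sum_grads F xh (sorted_list_of_set S) \<bind>\<^sub>c (\<lambda>s.
     sub_epochs F \<sigma> \<alpha> xh ((1 / real B) *\<^sub>R s) (B div p) p xh X \<bind>\<^sub>c (\<lambda>(xh', X').
     epochs F \<sigma> B p \<alpha> T xh' X')))"

definition natasha15_full ::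
    "problem \<Rightarrow> real \<Rightarrow> fvec \<Rightarrow> nat \<Rightarrow> nat \<Rightarrow> nat \<Rightarrow> real \<Rightarrow> (fvec \<times> fvec) counted" where
  "natasha15_full F \<sigma> x0 B p T \<alpha> =
     epochs F \<sigma> B p \<alpha> T x0 [] \<bind>\<^sub>c (\<lambda>(xh, X).
     draw (pmf_of_set {..<length X}) \<bind>\<^sub>c (\<lambda>j.
     ret (X ! j, xh)))"


section \<open>The convex subroutine\<close>

definition log_plus :: "real \<Rightarrow> real" where
  "log_plus r = max 1 (ln r)"

text \<open>A subroutine receives \<open>H\<close>, \<open>x\<^sub>0\<close>, \<open>\<sigma>'\<close>, \<open>L'\<close> and \<open>T\<close>.\<close>

type_synonym subroutine = "problem \<Rightarrow> fvec \<Rightarrow> real \<Rightarrow> real \<Rightarrow> nat \<Rightarrow> fvec counted"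

text \<open>\<open>A\<close> and \<open>a\<close> are the constants hidden in \<open>O\<close> and \<open>\<Omega>\<close>; they may depend on \<open>C'\<close>.\<close>

definition sgd3sc_guarantee :: "subroutine \<Rightarrow> bool" where
  "sgd3sc_guarantee sgd \<longleftrightarrow>
    (\<forall>C'. 0 < C' \<and> C' \<le> 1 \<longrightarrow> (\<exists>A>0. \<exists>a>0. \<forall>H x0 \<sigma>' L' T V xmin.
      composite_problem H \<and>
      convex_on (space_of H) (smooth_part H) \<and>
      smooth (dimen H) L' (smooth_part H) \<and>
      0 < \<sigma>' \<and> \<sigma>' \<le> L' \<and>
      strongly_convex (dimen H) \<sigma>' (objective H) \<and>
      is_arg_min (objective H) (\<lambda>x. x \<in> space_of H) xmin \<and>
      variance_le H V \<and>
      x0 \<in> space_of H \<and> psi H x0 < \<infinity> \<and>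
      L' / \<sigma>' * log_plus (L' / \<sigma>') \<le> real T
      \<longrightarrow>
      (\<forall>(x, c) \<in> set_pmf (sgd H x0 \<sigma>' L' T). x \<in> space_of H \<and> c = T) \<and>
      integrable (sgd H x0 \<sigma>' L' T) (\<lambda>(x, c). norm (grad_mapping H (C' / L') x)) \<and>
      measure_pmf.expectation (sgd H x0 \<sigma>' L' T) (\<lambda>(x, c). norm (grad_mapping H (C' / L') x))
        \<le> A * (sqrt V * log_plus (L' / \<sigma>') powr (3/2) / sqrt (real T))
          + (1 - \<sigma>' / L') powr (a * (real T / log_plus (L' / \<sigma>'))) * \<sigma>' * norm (x0 - xmin)))"


section \<open>Natasha1.5 with pruning\<close>

text \<open>\<open>x \<mapsto> F(x) + \<sigma> \<parallel>x - y\<parallel>\<^sup>2\<close>, with the quadratic added to every component, so that a gradient of a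
  component of the new problem costs one gradient of the same component of \<open>F\<close>.\<close>

definition regularised :: "problem \<Rightarrow> real \<Rightarrow> fvec \<Rightarrow> problem" where
  "regularised F \<sigma> y = F\<lparr>component := (\<lambda>i x. component F i x + \<sigma> * (norm (x - y))\<^sup>2)\<rparr>"

text \<open>The arguments \<open>cB\<close>, \<open>c\<alpha>\<close>, \<open>cT\<close>, \<open>cL\<close>, \<open>cS\<close> are the constants in the \<open>\<Theta>\<close> and \<open>O\<close> of the
  parameter choices for \<open>B\<close>, \<open>\<alpha>\<close>, \<open>T\<^sub>0\<close>, \<open>L'\<close> and the number of steps of the subroutine.\<close>

definition batch_size :: "real \<Rightarrow> real \<Rightarrow> real \<Rightarrow> nat" where
  "batch_size cB V \<epsilon> = nat \<lceil>cB * (V / \<epsilon>\<^sup>2)\<rceil>"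

definition sub_epoch_number :: "real \<Rightarrow> real \<Rightarrow> nat \<Rightarrow> nat" where
  "sub_epoch_number L \<sigma> B = nat \<lfloor>root 3 (\<sigma>\<^sup>2 / (48 * L\<^sup>2) * real B)\<rfloor>"

definition iteration_bound :: "real \<Rightarrow> real \<Rightarrow> real \<Rightarrow> real \<Rightarrow> real \<Rightarrow> real" where
  "iteration_bound L \<sigma> \<Delta> V \<epsilon> =
     root 3 (L\<^sup>2 * \<sigma>) * \<Delta> * V powr (2/3) / \<epsilon> powr (10/3)"

definition sgd_bound :: "real \<Rightarrow> real \<Rightarrow> real \<Rightarrow> real \<Rightarrow> real" where
  "sgd_bound L \<sigma> V \<epsilon> = V / \<epsilon>\<^sup>2 * log_plus (L / \<sigma>) ^ 3"

definition natasha15_prune ::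
    "subroutine \<Rightarrow> real \<Rightarrow> real \<Rightarrow> real \<Rightarrow> real \<Rightarrow> real
       \<Rightarrow> problem \<Rightarrow> real \<Rightarrow> real \<Rightarrow> real \<Rightarrow> real \<Rightarrow> fvec \<Rightarrow> real \<Rightarrow> fvec counted" where
  "natasha15_prune sgd cB c\<alpha> cT cL cS F L \<sigma> V \<Delta> x0 \<epsilon> =
    (let B = batch_size cB V \<epsilon>;
         p = sub_epoch_number L \<sigma> B;
         \<alpha> = c\<alpha> * (\<sigma> / ((real p)\<^sup>2 * L\<^sup>2));
         T0 = cT * iteration_bound L \<sigma> \<Delta> V \<epsilon>;
         T' = max 1 (nat \<lceil>T0 / real B\<rceil>);
         Tsgd = nat \<lceil>cS * sgd_bound L \<sigma> V \<epsilon>\<rceil>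
     in natasha15_full F \<sigma> x0 B p T' \<alpha> \<bind>\<^sub>c (\<lambda>(yh, yp).
        sgd (regularised F \<sigma> yh) yh \<sigma> (cL * L) Tsgd))"

end

theory Submission
  imports Defs
begin

text \<open>
  A sub-epoch with centre \<open>c\<close> approximately minimises the \<open>\<sigma>\<close>-strongly convex function
  \<open>F + \<sigma> \<parallel>\<cdot> - c\<parallel>\<^sup>2\<close>, with minimiser \<open>c\<^sup>*\<close>. Strong convexity turns its progress into
  \<open>E F(c') + \<sigma> E \<parallel>c' - c\<parallel>\<^sup>2 + \<sigma>/4 \<parallel>c - c\<^sup>*\<parallel>\<^sup>2 \<le> F(c) + \<alpha> L\<^sup>2 E \<parallel>c' - x\<parallel>\<^sup>2 + \<parallel>e\<parallel>\<^sup>2 / \<sigma>\<close>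
  for the next centre \<open>c'\<close>, where \<open>x\<close> is the snapshot and \<open>e\<close> the error of its minibatch gradient.
  As the new centre is drawn from the iterates \<open>x\<^sub>0, \<dots>, x\<^bsub>m-1\<^esub>\<close>, the variance of the estimator
  is measured at \<open>c'\<close> itself, and over the \<open>p\<close> sub-epochs of an epoch it is paid for by the terms
  \<open>\<sigma> \<parallel>c' - c\<parallel>\<^sup>2\<close> because \<open>\<alpha> L\<^sup>2 p\<^sup>2 \<le> \<sigma>/6\<close>. Telescoping gives
  \<open>\<sigma>\<^sup>2 E \<parallel>y - y\<^sup>*\<parallel>\<^sup>2 \<le> 4 \<sigma> \<Delta> / (T p) + 4 V / B\<close> for a random recorded centre \<open>y\<close>. Finally the
  gradient mapping of \<open>F\<close> differs from that of \<open>F + \<sigma> \<parallel>\<cdot> - y\<parallel>\<^sup>2\<close> by at most \<open>2 \<sigma> \<parallel>x - y\<parallel>\<close>, which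
  the error bound for strongly convex functions controls at the output of the subroutine.
\<close>

section \<open>Gradients on the coordinate subspaces\<close>

text \<open>The parameters settle two opposing demands. Drift from the snapshot over p sub-epochs
  can be paid for only if \<alpha> is of order \<sigma> / (p^2 L^2), while a sub-epoch of m steps
  forgets its start only if \<alpha> m \<sigma> is at least a constant. With m = B / p both hold up
  to p^3 of order \<sigma>^2 B / L^2; an epoch then costs at most 3 B gradients and yields p
  recorded centres. The batch needs size of order V / \<epsilon>^2, because its error stays fixed
  during an epoch and leaves the floor 4 V / B, which more epochs do not lower. The lower bound on
  \<sigma> makes p at least 1 and gives the subroutine enough steps for the condition number 3 L /
  \<sigma>. On the formal side, \<open>psi\<close> takes the value \<infinity>, so real inequalities
  live on its effective domain. The first phase has finite support, whereas the distribution
  returned by the subroutine is arbitrary; the two are therefore joined through the nonnegative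
  integral, and the last estimate is made linear in the squared distance so that its expectation can
  be inserted.\<close>

lemma subspace_Rd: "subspace (Rd d)"
  by (auto simp: subspace_def Rd_def)

lemma Rd_arith [simp]:
  "x \<in> Rd d \<Longrightarrow> y \<in> Rd d \<Longrightarrow> x + y \<in> Rd d"
  "x \<in> Rd d \<Longrightarrow> y \<in> Rd d \<Longrightarrow> x - y \<in> Rd d"
  "x \<in> Rd d \<Longrightarrow> c *\<^sub>R x \<in> Rd d"
  "0 \<in> Rd d"
  by (auto simp: Rd_def)

lemma inner_Rd: "x \<in> Rd d \<Longrightarrow> inner x y = (\<Sum>i<d. coord x i * coord y i)"
  by (intro inner_fvec_superset) (auto simp: Rd_def not_le[symmetric])

definition unit_vec :: "nat \<Rightarrow> fvec" where
  "unit_vec i = Abs_fvec (\<lambda>j. if j = i then 1 else 0)"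

lemma coord_unit_vec: "coord (unit_vec i) j = (if j = i then 1 else 0)"
proof -
  have "finite {j. (if j = i then 1 else 0 :: real) \<noteq> 0}"
    by (rule finite_subset[of _ "{i}"]) auto
  then show ?thesis
    by (simp add: unit_vec_def Abs_fvec_inverse)
qed

lemma coord_sum: "coord (\<Sum>i\<in>A. f i) j = (\<Sum>i\<in>A. coord (f i) j)"
  by (induction A rule: infinite_finite_induct) auto

lemma Rd_expand: "x \<in> Rd d \<Longrightarrow> x = (\<Sum>i<d. coord x i *\<^sub>R unit_vec i)"
  by (rule fvec_eqI) (auto simp: coord_sum coord_unit_vec Rd_def not_less if_distrib cong: if_cong)

text \<open>The whole type is not complete, since limits of finitely supported sequences may have
  infinite support. On \<open>Rd d\<close> norm convergence reduces to finitely many coordinates.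
  Banach's fixed point theorem will be applied on this set.\<close>

lemma complete_Rd: "Topological_Spaces.complete (Rd d)"
proof (rule completeI)
  fix X :: "nat \<Rightarrow> fvec"
  assume X: "\<forall>n. X n \<in> Rd d" "Cauchy X"
  have coord_le: "\<bar>coord x i\<bar> \<le> norm x" if "x \<in> Rd d" for x i
  proof (cases "i < d")
    case True
    have "(coord x i)\<^sup>2 \<le> (\<Sum>j<d. coord x j * coord x j)"
      using True member_le_sum[of i "{..<d}" "\<lambda>j. coord x j * coord x j"]
      by (auto simp: power2_eq_square)
    also have "\<dots> = (norm x)\<^sup>2"
      using that by (simp add: inner_Rd power2_norm_eq_inner)
    finally show ?thesis
      by (simp add: abs_le_square_iff[symmetric])
  qed (use that in \<open>auto simp: Rd_def\<close>)
  have "Cauchy (\<lambda>n. coord (X n) i)" for i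
    unfolding Cauchy_def
  proof (intro allI impI)
    fix e :: real assume "0 < e"
    then obtain M where M: "\<And>m n. m \<ge> M \<Longrightarrow> n \<ge> M \<Longrightarrow> dist (X m) (X n) < e"
      using X unfolding Cauchy_def by blast
    have "dist (coord (X m) i) (coord (X n) i) < e" if "m \<ge> M" "n \<ge> M" for m n
      using M[OF that] coord_le[of "X m - X n" i] X by (simp add: dist_norm)
    then show "\<exists>M. \<forall>m\<ge>M. \<forall>n\<ge>M. dist (coord (X m) i) (coord (X n) i) < e"
      by blast
  qed
  then have "\<exists>l. (\<lambda>n. coord (X n) i) \<longlonglongrightarrow> l" for i
    by (simp add: Cauchy_convergent_iff convergent_def)
  then obtain l where l: "\<And>i. (\<lambda>n. coord (X n) i) \<longlonglongrightarrow> l i"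
    by metis
  define z where "z = (\<Sum>i<d. l i *\<^sub>R unit_vec i)"
  have z: "coord z i = (if i < d then l i else 0)" for i
    unfolding z_def by (auto simp: coord_sum coord_unit_vec if_distrib cong: if_cong)
  then have zR: "z \<in> Rd d"
    by (auto simp: Rd_def)
  have "(\<lambda>n. \<Sum>i<d. coord (X n - z) i * coord (X n - z) i) \<longlonglongrightarrow> (\<Sum>i<d. 0 * 0)"
    by (intro tendsto_sum tendsto_mult; simp add: z LIM_zero l)
  moreover have "(\<Sum>i<d. coord (X n - z) i * coord (X n - z) i) = (norm (X n - z))\<^sup>2" for n
    using X zR inner_Rd[of "X n - z" d "X n - z"] by (simp only: power2_norm_eq_inner Rd_arith)
  ultimately have "(\<lambda>n. (norm (X n - z))\<^sup>2) \<longlonglongrightarrow> 0"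
    by simp
  then have "(\<lambda>n. sqrt ((norm (X n - z))\<^sup>2)) \<longlonglongrightarrow> sqrt 0"
    by (intro tendsto_real_sqrt)
  then have "X \<longlonglongrightarrow> z"
    by (simp add: tendsto_dist_iff[of X] dist_norm)
  then show "\<exists>l\<in>Rd d. X \<longlonglongrightarrow> l"
    using zR by blast
qed

text \<open>The line never leaves the subspace, so a derivative within \<open>Rd d\<close> becomes
  an ordinary derivative in one real variable, to which uniqueness and monotonicity results
  apply.\<close>

lemma has_derivative_line:
  assumes x: "x \<in> Rd d" and h: "h \<in> Rd d"
    and f: "(f has_derivative f') (at (x + t *\<^sub>R h) within Rd d)"
  shows "((\<lambda>t. f (x + t *\<^sub>R h)) has_real_derivative f' h) (at t)"
proof -
  have "((\<lambda>t. x + t *\<^sub>R h) has_derivative (\<lambda>s. s *\<^sub>R h)) (at t)"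
    by (auto intro!: derivative_eq_intros)
  moreover have "(f has_derivative f') (at (x + t *\<^sub>R h) within range (\<lambda>t. x + t *\<^sub>R h))"
    by (rule has_derivative_subset[OF f]) (use x h in auto)
  ultimately have "((\<lambda>t. f (x + t *\<^sub>R h)) has_derivative (\<lambda>s. f' (s *\<^sub>R h))) (at t)"
    by (rule has_derivative_in_compose)
  moreover have "f' (s *\<^sub>R h) = f' h * s" for s
    using linear_scale[OF has_derivative_linear[OF f]] by simp
  ultimately show ?thesis
    by (simp add: has_field_derivative_def mult_commute_abs)
qed

text \<open>Differentiation along \<open>g - g'\<close> separates two candidates. This direction is
  admissible because both lie in \<open>Rd d\<close>; a derivative within the subspace determines a
  vector only up to its orthogonal complement.\<close>

lemma gradient_unique:
  assumes x: "x \<in> Rd d" and g: "g \<in> Rd d" "g' \<in> Rd d"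
    and f: "(f has_derivative (\<lambda>h. inner g h)) (at x within Rd d)"
      "(f has_derivative (\<lambda>h. inner g' h)) (at x within Rd d)"
  shows "g = g'"
proof -
  let ?h = "g - g'"
  have "inner g ?h = inner g' ?h"
    using has_derivative_line[OF x _, of ?h f _ 0] f g
    by (intro DERIV_unique[of "\<lambda>t. f (x + t *\<^sub>R ?h)" _ 0]) auto
  then have "inner ?h ?h = 0"
    by (simp add: inner_diff_left)
  then show ?thesis by simp
qed

lemma grad_eqI:
  assumes "x \<in> Rd d" "g \<in> Rd d" "(f has_derivative (\<lambda>h. inner g h)) (at x within Rd d)"
  shows "grad d f x = g"
  unfolding grad_def using assms by (intro the_equality) (auto intro: gradient_unique)

lemma grad_works:
  assumes f: "f differentiable_on Rd d" and x: "x \<in> Rd d"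
  shows "grad d f x \<in> Rd d \<and> (f has_derivative (\<lambda>h. inner (grad d f x) h)) (at x within Rd d)"
proof -
  from f x obtain f' where f': "(f has_derivative f') (at x within Rd d)"
    unfolding differentiable_on_def differentiable_def by blast
  then have lin: "linear f'"
    by (rule has_derivative_linear)
  define g where "g = (\<Sum>i<d. f' (unit_vec i) *\<^sub>R unit_vec i)"
  have coord_g: "coord g i = (if i < d then f' (unit_vec i) else 0)" for i
    unfolding g_def by (auto simp: coord_sum coord_unit_vec if_distrib cong: if_cong)
  then have g: "g \<in> Rd d" by (auto simp: Rd_def)
  have "inner g h = f' h" if h: "h \<in> Rd d" for h
  proof -
    have "f' h = f' (\<Sum>i<d. coord h i *\<^sub>R unit_vec i)"
      using Rd_expand[OF h] by simp
    also have "\<dots> = (\<Sum>i<d. coord h i * f' (unit_vec i))"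
      using lin by (simp add: linear_sum linear_scale)
    finally show ?thesis
      by (simp add: inner_Rd[OF g] coord_g mult.commute)
  qed
  \<comment> \<open>The two linear maps are known to agree on \<open>Rd d\<close> only, and
    difference quotients within \<open>Rd d\<close> see nothing else.\<close>
  then have "(f has_derivative (\<lambda>h. inner g h)) (at x within Rd d)"
    using f' x unfolding has_derivative_within'
    by (auto simp: bounded_linear_inner_right)
  then show ?thesis
    using grad_eqI[OF x g] g by simp
qed

lemma smooth_upper_bound:
  assumes f: "smooth d L f" and x: "x \<in> Rd d" and y: "y \<in> Rd d"
  shows "f y \<le> f x + inner (grad d f x) (y - x) + L / 2 * (norm (y - x))\<^sup>2"
proof -
  let ?h = "y - x"
  \<comment> \<open>Along the segment, f minus the part of the upper bound that varies with t. Its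
    derivative is nonpositive by the Lipschitz bound on the gradient, and
    \<open>?g 1 \<le> ?g 0\<close> is the claim.\<close>
  let ?g = "\<lambda>t. f (x + t *\<^sub>R ?h) - t * inner (grad d f x) ?h - L / 2 * t\<^sup>2 * (norm ?h)\<^sup>2"
  have diff: "f differentiable_on Rd d"
    and lip: "norm (grad d f u - grad d f v) \<le> L * norm (u - v)" if "u \<in> Rd d" "v \<in> Rd d" for u v
    using f that by (auto simp: smooth_def)
  have "\<exists>l. (?g has_real_derivative l) (at t) \<and> l \<le> 0" if "0 \<le> t" for t
  proof (intro exI conjI)
    let ?z = "x + t *\<^sub>R ?h"
    have z: "?z \<in> Rd d" using x y by simp
    show "(?g has_real_derivative
        inner (grad d f ?z) ?h - inner (grad d f x) ?h - L * t * (norm ?h)\<^sup>2) (at t)"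
      using has_derivative_line[of x d ?h f "\<lambda>h. inner (grad d f ?z) h" t] x y
        grad_works[OF diff[OF x x] z]
      by (auto intro!: derivative_eq_intros simp: algebra_simps)
    have "inner (grad d f ?z - grad d f x) ?h \<le> norm (grad d f ?z - grad d f x) * norm ?h"
      by (rule norm_cauchy_schwarz)
    also have "\<dots> \<le> (L * norm (?z - x)) * norm ?h"
      using lip[OF z x] by (intro mult_right_mono) auto
    also have "\<dots> = L * t * (norm ?h)\<^sup>2"
      using that by (simp add: power2_eq_square)
    finally show "inner (grad d f ?z) ?h - inner (grad d f x) ?h - L * t * (norm ?h)\<^sup>2 \<le> 0"
      by (simp add: inner_diff_left)
  qed
  then have "?g 1 \<le> ?g 0"
    by (intro DERIV_nonpos_imp_nonincreasing[of 0 1 ?g]) auto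
  then show ?thesis by simp
qed

lemma add_square_gradient:
  assumes f: "f differentiable_on Rd d" and c: "c \<in> Rd d" and x: "x \<in> Rd d"
  shows "grad d (\<lambda>x. f x + a * (norm (x - c))\<^sup>2) x = grad d f x + (2 * a) *\<^sub>R (x - c)"
    and "((\<lambda>x. f x + a * (norm (x - c))\<^sup>2) has_derivative
      (\<lambda>h. inner (grad d f x + (2 * a) *\<^sub>R (x - c)) h)) (at x within Rd d)"
proof -
  show *: "((\<lambda>x. f x + a * (norm (x - c))\<^sup>2) has_derivative
      (\<lambda>h. inner (grad d f x + (2 * a) *\<^sub>R (x - c)) h)) (at x within Rd d)"
    unfolding power2_norm_eq_inner using grad_works[OF f x]
    by (auto intro!: derivative_eq_intros simp: inner_add_left inner_commute algebra_simps)
  show "grad d (\<lambda>x. f x + a * (norm (x - c))\<^sup>2) x = grad d f x + (2 * a) *\<^sub>R (x - c)"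
    by (rule grad_eqI[OF x _ *]) (use grad_works[OF f x] x c in auto)
qed

section \<open>Inequalities in inner product spaces\<close>

lemma norm_add_sq: "(norm (x + y))\<^sup>2 = (norm x)\<^sup>2 + 2 * inner x y + (norm y)\<^sup>2"
  for x y :: "'a::real_inner"
  by (simp add: power2_norm_eq_inner inner_add_left inner_add_right inner_commute)

lemma norm_diff_sq: "(norm (x - y))\<^sup>2 = (norm x)\<^sup>2 - 2 * inner x y + (norm y)\<^sup>2"
  for x y :: "'a::real_inner"
  by (simp add: power2_norm_eq_inner inner_diff_left inner_diff_right inner_commute)

lemma inner_three_point:
  "2 * inner (z - x) (u - z) = (norm (x - u))\<^sup>2 - (norm (z - u))\<^sup>2 - (norm (z - x))\<^sup>2"
  for x u z :: "'a::real_inner"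
  by (simp add: power2_norm_eq_inner inner_diff_left inner_diff_right inner_commute)

text \<open>The weights suit two uses: s = \<sigma> costs \<sigma> / 4, half of the strong convexity
  coefficient, and s = 1 / \<alpha> costs 1 / (4 \<alpha>), half of the proximal
  coefficient.\<close>

lemma young_inner:
  fixes a b :: "'a::real_inner"
  assumes "0 < s"
  shows "- inner a b \<le> (norm a)\<^sup>2 / s + s / 4 * (norm b)\<^sup>2"
proof -
  have "0 \<le> (norm (a + (s / 2) *\<^sub>R b))\<^sup>2"
    by simp
  also have "\<dots> = s * ((norm a)\<^sup>2 / s + inner a b + s / 4 * (norm b)\<^sup>2)"
    unfolding norm_add_sq using assms by (simp add: power_mult_distrib field_simps power2_eq_square)
  finally show ?thesis
    using assms by (simp add: zero_le_mult_iff)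
qed

lemma norm_add_sq_le:
  fixes x y :: "'a::real_inner"
  assumes "0 < s"
  shows "(norm (x + y))\<^sup>2 \<le> (1 + s) * (norm x)\<^sup>2 + (1 + 1 / s) * (norm y)\<^sup>2"
proof -
  have "0 \<le> (norm (s *\<^sub>R x - y))\<^sup>2"
    by simp
  also have "\<dots> = s * (s * (norm x)\<^sup>2 - 2 * inner x y + (norm y)\<^sup>2 / s)"
    unfolding norm_diff_sq using assms
    by (simp add: power_mult_distrib field_simps power2_eq_square)
  finally have "2 * inner x y \<le> s * (norm x)\<^sup>2 + (norm y)\<^sup>2 / s"
    using assms by (simp add: zero_le_mult_iff)
  then show ?thesis
    unfolding norm_add_sq by (simp add: algebra_simps)
qed

section \<open>Variances of sample means\<close>

text \<open>Second moments are smallest about the mean. For gradient differences between an iterate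
  and the snapshot this is variance reduction: the noise is bounded by the distance to the
  snapshot.\<close>

lemma mean_deviation_le:
  assumes n: "0 < n" and g: "(1 / real n) *\<^sub>R (\<Sum>i\<in>{1..n}. a i) = b"
    and a: "\<And>i. i \<in> {1..n} \<Longrightarrow> (norm (a i))\<^sup>2 \<le> K"
  shows "(\<Sum>i\<in>{1..n}. a i - b) = (0::'a::real_inner)"
    and "(\<Sum>i\<in>{1..n}. (norm (a i - b))\<^sup>2) / real n \<le> K"
proof -
  have s: "(\<Sum>i\<in>{1..n}. a i) = real n *\<^sub>R b"
    using n unfolding g[symmetric] by simp
  then show "(\<Sum>i\<in>{1..n}. a i - b) = 0"
    using n by (simp add: sum_subtractf sum_constant_scaleR)
  have "(\<Sum>i\<in>{1..n}. (norm (a i - b))\<^sup>2)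
      = (\<Sum>i\<in>{1..n}. (norm (a i))\<^sup>2) - 2 * inner (\<Sum>i\<in>{1..n}. a i) b + real n * (norm b)\<^sup>2"
    by (simp add: norm_diff_sq sum.distrib sum_subtractf inner_sum_left sum_distrib_left)
  also have "\<dots> = (\<Sum>i\<in>{1..n}. (norm (a i))\<^sup>2) - real n * (norm b)\<^sup>2"
    unfolding s by (simp add: power2_norm_eq_inner)
  also have "\<dots> \<le> (\<Sum>i\<in>{1..n}. (norm (a i))\<^sup>2)"
    by simp
  also have "\<dots> \<le> (\<Sum>i\<in>{1..n}. K)"
    using a by (rule sum_mono)
  finally show "(\<Sum>i\<in>{1..n}. (norm (a i - b))\<^sup>2) / real n \<le> K"
    using n by (simp add: field_simps)
qed

text \<open>Removing T is a bijection onto the subsets of \<open>A - T\<close> of size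
  \<open>k - card T\<close>. With T = \<open>{i, j}\<close> it counts the batches that contain two
  given indices, equal or distinct.\<close>

lemma card_supersets:
  assumes A: "finite A" and T: "T \<subseteq> A" and k: "card T \<le> k"
  shows "card {S. S \<subseteq> A \<and> card S = k \<and> T \<subseteq> S} = (card A - card T) choose (k - card T)"
proof -
  have fin: "finite T"
    using A T finite_subset by blast
  have "bij_betw (\<lambda>S. S \<union> T) {S. S \<subseteq> A - T \<and> card S = k - card T}
      {S. S \<subseteq> A \<and> card S = k \<and> T \<subseteq> S}"
  proof (rule bij_betw_byWitness[where f' = "\<lambda>S. S - T"])
    show "(\<lambda>S. S \<union> T) ` {S. S \<subseteq> A - T \<and> card S = k - card T} \<subseteq> {S. S \<subseteq> A \<and> card S = k \<and> T \<subseteq> S}"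
    proof
      fix U assume "U \<in> (\<lambda>S. S \<union> T) ` {S. S \<subseteq> A - T \<and> card S = k - card T}"
      then obtain S where S: "U = S \<union> T" "S \<subseteq> A - T" "card S = k - card T"
        by blast
      then have "card U = card S + card T"
        using A fin by (simp add: S, subst card_Un_disjoint) (auto intro: finite_subset)
      then show "U \<in> {S. S \<subseteq> A \<and> card S = k \<and> T \<subseteq> S}"
        using S T k by auto
    qed
    show "(\<lambda>S. S - T) ` {S. S \<subseteq> A \<and> card S = k \<and> T \<subseteq> S} \<subseteq> {S. S \<subseteq> A - T \<and> card S = k - card T}"
      using fin by (auto simp: card_Diff_subset)
  qed auto
  from bij_betw_same_card[OF this] show ?thesis
    using A fin T by (simp add: n_subsets card_Diff_subset)
qed

text \<open>Sampling without replacement only decreases the variance of the sample mean: the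
  correlations between distinct samples are negative.\<close>

lemma sample_variance:
  fixes a :: "'i \<Rightarrow> 'a::real_inner"
  assumes A: "finite A" and k: "0 < k" "k \<le> card A" and a: "(\<Sum>i\<in>A. a i) = 0"
  shows "(\<Sum>S | S \<subseteq> A \<and> card S = k. (norm (\<Sum>i\<in>S. a i))\<^sup>2) / real (card A choose k)
    \<le> real k / real (card A) * (\<Sum>i\<in>A. (norm (a i))\<^sup>2)"
proof -
  let ?P = "{S. S \<subseteq> A \<and> card S = k}"
  let ?n1 = "real (card A - 1 choose (k - 1))"
  \<comment> \<open>For k = 1 no sample contains two distinct indices, but truncated subtraction
    would make the binomial coefficient 1.\<close>
  let ?n2 = "if k = 1 then 0 else real (card A - 2 choose (k - 2))"
  have P: "finite ?P"
    using A by simp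
  have count: "(\<Sum>S\<in>?P. if i \<in> S \<and> j \<in> S then 1 else 0) = (if i = j then ?n1 else ?n2)"
    if ij: "i \<in> A" "j \<in> A" for i j
  proof -
    have eq: "(\<Sum>S\<in>?P. if i \<in> S \<and> j \<in> S then 1 else 0)
        = real (card {S. S \<subseteq> A \<and> card S = k \<and> {i, j} \<subseteq> S})"
      using P by (subst sum.inter_filter[symmetric]) (auto intro!: arg_cong[of _ _ card])
    show ?thesis
    proof (cases "i = j")
      case True
      then show ?thesis
        unfolding eq using card_supersets[OF A, of "{i, j}" k] ij k by simp
    next
      case ne: False
      show ?thesis
      proof (cases "k = 1")
        case True
        have empty: "{S. S \<subseteq> A \<and> card S = k \<and> {i, j} \<subseteq> S} = {}"
          using ne True by (auto simp: card_1_singleton_iff)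
        show ?thesis
          unfolding eq empty using ne True by simp
      next
        case False
        then show ?thesis
          unfolding eq using card_supersets[OF A, of "{i, j}" k] ij k ne by (simp add: numeral_2_eq_2)
      qed
    qed
  qed
  have "(\<Sum>S\<in>?P. (norm (\<Sum>i\<in>S. a i))\<^sup>2)
      = (\<Sum>S\<in>?P. \<Sum>i\<in>A. \<Sum>j\<in>A. (if i \<in> S \<and> j \<in> S then 1 else 0) * inner (a i) (a j))"
  proof (rule sum.cong[OF refl])
    fix S assume "S \<in> ?P"
    then have S: "S \<subseteq> A" by simp
    have "(\<Sum>i\<in>S. a i) = (\<Sum>i\<in>A. (if i \<in> S then 1 else 0) *\<^sub>R a i)"
      using S A by (intro sum.mono_neutral_cong_left) auto
    then show "(norm (\<Sum>i\<in>S. a i))\<^sup>2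
        = (\<Sum>i\<in>A. \<Sum>j\<in>A. (if i \<in> S \<and> j \<in> S then 1 else 0) * inner (a i) (a j))"
      by (auto simp: power2_norm_eq_inner inner_sum_left inner_sum_right inner_commute
          intro!: sum.cong)
  qed
  also have "\<dots> = (\<Sum>i\<in>A. \<Sum>S\<in>?P. \<Sum>j\<in>A. (if i \<in> S \<and> j \<in> S then 1 else 0) * inner (a i) (a j))"
    by (rule sum.swap)
  also have "\<dots> = (\<Sum>i\<in>A. \<Sum>j\<in>A. \<Sum>S\<in>?P. (if i \<in> S \<and> j \<in> S then 1 else 0) * inner (a i) (a j))"
    by (intro sum.cong refl sum.swap)
  also have "\<dots> = (\<Sum>i\<in>A. \<Sum>j\<in>A. (if i = j then ?n1 else ?n2) * inner (a i) (a j))"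
    by (intro sum.cong refl) (simp only: sum_distrib_right[symmetric] count)
  also have "\<dots> = (\<Sum>i\<in>A. \<Sum>j\<in>A. ?n2 * inner (a i) (a j) +
      (if i = j then (?n1 - ?n2) * inner (a i) (a i) else 0))"
    by (intro sum.cong refl) (simp add: algebra_simps)
  also have "\<dots> = ?n2 * inner (\<Sum>i\<in>A. a i) (\<Sum>j\<in>A. a j) + (?n1 - ?n2) * (\<Sum>i\<in>A. inner (a i) (a i))"
    unfolding sum.distrib using A
    by (simp add: inner_sum_left inner_sum_right sum_distrib_left inner_commute)
  \<comment> \<open>The first term vanishes because the vectors sum to zero, and \<open>?n2\<close>
    is nonnegative.\<close>
  also have "\<dots> \<le> ?n1 * (\<Sum>i\<in>A. (norm (a i))\<^sup>2)"
    unfolding a by (auto simp: power2_norm_eq_inner sum_nonneg intro!: mult_right_mono)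
  finally have le: "(\<Sum>S\<in>?P. (norm (\<Sum>i\<in>S. a i))\<^sup>2) \<le> ?n1 * (\<Sum>i\<in>A. (norm (a i))\<^sup>2)" .
  have "real k * real (card A choose k) = real (card A) * ?n1"
    using times_binomial_minus1_eq[OF k(1), of "card A"] by (metis of_nat_mult)
  then have "?n1 / real (card A choose k) = real k / real (card A)"
    using k by (simp add: field_simps)
  moreover have "(\<Sum>S\<in>?P. (norm (\<Sum>i\<in>S. a i))\<^sup>2) / real (card A choose k)
      \<le> ?n1 / real (card A choose k) * (\<Sum>i\<in>A. (norm (a i))\<^sup>2)"
    using divide_right_mono[OF le, of "real (card A choose k)"] by simp
  ultimately show ?thesis
    by simp
qed

section \<open>Counted computations\<close>

text \<open>The counter is forgotten here; costs are bounded on the support instead of in mean. With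
  finite support integrability is automatic, so the rules for binding and comparing these
  expectations carry only finiteness conditions.\<close>

definition cexp :: "'r counted \<Rightarrow> ('r \<Rightarrow> real) \<Rightarrow> real" where
  "cexp m g = measure_pmf.expectation m (\<lambda>z. g (fst z))"

lemma set_bind_counted:
  "set_pmf (m \<bind>\<^sub>c k) = (\<Union>(r, c)\<in>set_pmf m. (\<lambda>(s, c'). (s, c + c')) ` set_pmf (k r))"
  by (simp add: bind_counted_def case_prod_beta)

lemma in_set_bind_counted:
  "z \<in> set_pmf (m \<bind>\<^sub>c k) \<longleftrightarrow>
    (\<exists>r c c'. (r, c) \<in> set_pmf m \<and> (fst z, c') \<in> set_pmf (k r) \<and> snd z = c + c')"
  by (cases z) (force simp: set_bind_counted)

lemma set_ret [simp]: "set_pmf (ret r) = {(r, 0)}"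
  by (simp add: ret_def)

lemma set_eval_grad [simp]: "set_pmf (eval_grad F i x) = {(comp_grad F i x, 1)}"
  by (simp add: eval_grad_def)

lemma set_draw: "set_pmf (draw p) = (\<lambda>r. (r, 0)) ` set_pmf p"
  by (simp add: draw_def)

lemma finite_bind_counted:
  assumes "finite (set_pmf m)" "\<And>r c. (r, c) \<in> set_pmf m \<Longrightarrow> finite (set_pmf (k r))"
  shows "finite (set_pmf (m \<bind>\<^sub>c k))"
  using assms by (auto simp: set_bind_counted)

lemma cexp_bind:
  assumes m: "finite (set_pmf m)" and k: "\<And>r c. (r, c) \<in> set_pmf m \<Longrightarrow> finite (set_pmf (k r))"
  shows "cexp (m \<bind>\<^sub>c k) g = cexp m (\<lambda>r. cexp (k r) g)"
proof -
  have "cexp (m \<bind>\<^sub>c k) g = (\<Sum>z\<in>set_pmf m. pmf m z *\<^sub>R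
      measure_pmf.expectation (map_pmf (\<lambda>(s, c'). (s, snd z + c')) (k (fst z))) (\<lambda>z. g (fst z)))"
    unfolding cexp_def bind_counted_def
    by (subst pmf_expectation_bind[OF m]) (use k in \<open>auto simp: case_prod_beta\<close>)
  also have "\<dots> = (\<Sum>z\<in>set_pmf m. pmf m z *\<^sub>R cexp (k (fst z)) g)"
    by (simp add: cexp_def case_prod_beta)
  also have "\<dots> = cexp m (\<lambda>r. cexp (k r) g)"
    unfolding cexp_def using m by (subst integral_measure_pmf[OF m]) auto
  finally show ?thesis .
qed

lemma cexp_mono:
  assumes "finite (set_pmf m)" "\<And>r c. (r, c) \<in> set_pmf m \<Longrightarrow> g r \<le> h r"
  shows "cexp m g \<le> cexp m h"
  unfolding cexp_def using assms
  by (intro integral_mono_AE integrable_measure_pmf_finite) (auto simp: AE_measure_pmf_iff)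

lemma cexp_ret [simp]: "cexp (ret r) g = g r"
  by (simp add: cexp_def ret_def)

lemma cexp_draw_of_set:
  "finite A \<Longrightarrow> A \<noteq> {} \<Longrightarrow> cexp (draw (pmf_of_set A)) g = (\<Sum>a\<in>A. g a) / real (card A)"
  by (simp add: cexp_def draw_def integral_pmf_of_set)

lemma cexp_add:
  "finite (set_pmf m) \<Longrightarrow> cexp m (\<lambda>r. g r + h r) = cexp m g + cexp m h"
  unfolding cexp_def by (intro Bochner_Integration.integral_add integrable_measure_pmf_finite)

lemma cexp_cmult: "cexp m (\<lambda>r. c * g r) = c * cexp m g"
  unfolding cexp_def by simp

lemma cexp_const [simp]: "cexp m (\<lambda>r. c) = c"
  unfolding cexp_def by simp

lemma cexp_bind_ret:
  "finite (set_pmf m) \<Longrightarrow> cexp (m \<bind>\<^sub>c (\<lambda>r. ret (k r))) g = cexp m (\<lambda>r. g (k r))"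
  by (subst cexp_bind) auto

lemma cexp_bind_eval_grad:
  "finite (set_pmf (k (comp_grad F i x))) \<Longrightarrow>
    cexp (eval_grad F i x \<bind>\<^sub>c k) g = cexp (k (comp_grad F i x)) g"
  by (subst cexp_bind) (auto simp: cexp_def eval_grad_def)

lemma sum_grads_eq:
  "sum_grads F x is = return_pmf (\<Sum>i\<leftarrow>is. comp_grad F i x, length is)"
  by (induction "is") (simp_all add: ret_def eval_grad_def bind_counted_def bind_return_pmf)

lemma cexp_cong:
  assumes "finite (set_pmf m)" "\<And>r c. (r, c) \<in> set_pmf m \<Longrightarrow> g r = h r"
  shows "cexp m g = cexp m h"
  using assms by (intro antisym cexp_mono) auto

lemma cexp_return_pmf [simp]: "cexp (return_pmf (a, c)) g = g a"
  by (simp add: cexp_def)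

lemma finite_draw_of_set:
  "finite A \<Longrightarrow> A \<noteq> {} \<Longrightarrow> finite (set_pmf (draw (pmf_of_set A)))"
  by (simp add: set_draw)

text \<open>For the final call of the subroutine, whose distribution may have infinite support. The
  nonnegative integral of a bind can be unfolded without integrability, and the resulting finite
  bound then yields integrability and the estimate together.\<close>

lemma expectation_bind_counted_le:
  fixes m :: "'r counted" and k :: "'r \<Rightarrow> 's counted" and g :: "'s \<Rightarrow> real"
  assumes m: "finite (set_pmf m)" and g: "\<And>s. 0 \<le> g s" and h: "\<And>r. 0 \<le> h r"
    and int: "\<And>r c. (r, c) \<in> set_pmf m \<Longrightarrow> integrable (k r) (\<lambda>(s, c). g s)"
    and le: "\<And>r c. (r, c) \<in> set_pmf m \<Longrightarrow> measure_pmf.expectation (k r) (\<lambda>(s, c). g s) \<le> h r"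
  shows "integrable (m \<bind>\<^sub>c k) (\<lambda>(s, c). g s)"
    and "measure_pmf.expectation (m \<bind>\<^sub>c k) (\<lambda>(s, c). g s) \<le> cexp m h"
proof -
  have bound: "(\<integral>\<^sup>+z. ennreal (case z of (s, c) \<Rightarrow> g s) \<partial>(m \<bind>\<^sub>c k)) \<le> ennreal (cexp m h)"
  proof -
    have "(\<integral>\<^sup>+z. ennreal (case z of (s, c) \<Rightarrow> g s) \<partial>(m \<bind>\<^sub>c k))
        = (\<integral>\<^sup>+z. (\<integral>\<^sup>+w. ennreal (case w of (s, c) \<Rightarrow> g s) \<partial>(k (fst z))) \<partial>m)"
      by (simp add: bind_counted_def nn_integral_bind_pmf case_prod_beta)
    also have "\<dots> \<le> (\<integral>\<^sup>+z. ennreal (h (fst z)) \<partial>m)"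
    proof (rule nn_integral_mono_AE)
      show "AE z in m. (\<integral>\<^sup>+w. ennreal (case w of (s, c) \<Rightarrow> g s) \<partial>(k (fst z))) \<le> ennreal (h (fst z))"
        unfolding AE_measure_pmf_iff
      proof
        fix z assume z: "z \<in> set_pmf m"
        then have "(fst z, snd z) \<in> set_pmf m"
          by simp
        from int[OF this] le[OF this]
        show "(\<integral>\<^sup>+w. ennreal (case w of (s, c) \<Rightarrow> g s) \<partial>(k (fst z))) \<le> ennreal (h (fst z))"
          using g by (subst nn_integral_eq_integral) (auto intro: ennreal_leI)
      qed
    qed
    also have "\<dots> = ennreal (cexp m h)"
      unfolding cexp_def using m h
      by (intro nn_integral_eq_integral integrable_measure_pmf_finite) auto
    finally show ?thesis .
  qed
  show "integrable (m \<bind>\<^sub>c k) (\<lambda>(s, c). g s)"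
    using bound g by (intro integrableI_nonneg) (auto simp: le_less_trans)
  have "0 \<le> cexp m h"
    unfolding cexp_def by (intro Bochner_Integration.integral_nonneg h)
  then show "measure_pmf.expectation (m \<bind>\<^sub>c k) (\<lambda>(s, c). g s) \<le> cexp m h"
    using bound g by (intro integral_real_bounded) auto
qed

section \<open>Proximal steps and regularised objectives\<close>

locale nonconvex_composite =
  fixes F :: problem and L \<sigma> :: real
  assumes composite: "composite_problem F"
    and component_smooth: "\<And>i. i \<in> {1..ncomp F} \<Longrightarrow> smooth (dimen F) L (component F i)"
    and smooth_part_nonconvex: "nonconvex (dimen F) \<sigma> (smooth_part F)"
    and sigma_pos: "0 < \<sigma>"
    and sigma_le: "\<sigma> \<le> L"
begin

section \<open>Effective domain and gradients of the finite sum\<close>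

lemma L_pos: "0 < L"
  using sigma_pos sigma_le by simp

lemma ncomp_pos: "0 < ncomp F"
  using composite by (simp add: composite_problem_def)

definition effdom :: "fvec set" where
  "effdom = {x \<in> space_of F. psi F x < \<infinity>}"

text \<open>Off \<open>effdom\<close> this is the default value 0, so inequalities about it are
  proved at points known to lie in \<open>effdom\<close>.\<close>

definition psi_real :: "fvec \<Rightarrow> real" where
  "psi_real x = real_of_ereal (psi F x)"

definition full_grad :: "fvec \<Rightarrow> fvec" where
  "full_grad = grad (dimen F) (smooth_part F)"

definition reg_grad :: "fvec \<Rightarrow> fvec \<Rightarrow> fvec" where
  "reg_grad c x = full_grad x + (2 * \<sigma>) *\<^sub>R (x - c)"

lemma space_arith [simp]:
  "x \<in> space_of F \<Longrightarrow> y \<in> space_of F \<Longrightarrow> x + y \<in> space_of F"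
  "x \<in> space_of F \<Longrightarrow> y \<in> space_of F \<Longrightarrow> x - y \<in> space_of F"
  "x \<in> space_of F \<Longrightarrow> c *\<^sub>R x \<in> space_of F"
  "0 \<in> space_of F"
  by (auto simp: space_of_def)

lemma space_sum: "(\<And>i. i \<in> A \<Longrightarrow> g i \<in> space_of F) \<Longrightarrow> (\<Sum>i\<in>A. g i) \<in> space_of F"
  by (induction A rule: infinite_finite_induct) auto

lemma effdom_space [simp, intro]: "x \<in> effdom \<Longrightarrow> x \<in> space_of F"
  by (simp add: effdom_def)

lemma psi_eq: "x \<in> effdom \<Longrightarrow> psi F x = ereal (psi_real x)"
  using composite unfolding effdom_def psi_real_def composite_problem_def proper_convex_def
  by (cases "psi F x") (auto simp: space_of_def)

lemma effdom_nonempty: "\<exists>x. x \<in> effdom"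
  using composite unfolding effdom_def composite_problem_def proper_convex_def
  by (auto simp: space_of_def)

lemma psi_convex:
  assumes "x \<in> effdom" "y \<in> effdom" "0 < t" "t < 1"
  shows "(1 - t) *\<^sub>R x + t *\<^sub>R y \<in> effdom \<and>
    psi_real ((1 - t) *\<^sub>R x + t *\<^sub>R y) \<le> (1 - t) * psi_real x + t * psi_real y"
proof -
  let ?z = "(1 - t) *\<^sub>R x + t *\<^sub>R y"
  have "strongly_convex (dimen F) 0 (psi F)"
    using composite by (simp add: composite_problem_def proper_convex_def)
  then have "psi F ?z + ereal 0 \<le> ereal (1 - t) * psi F x + ereal t * psi F y"
    using assms unfolding strongly_convex_def by (fastforce simp: effdom_def space_of_def)
  then have le: "psi F ?z \<le> ereal ((1 - t) * psi_real x + t * psi_real y)"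
    using assms by (simp add: psi_eq)
  moreover have "?z \<in> space_of F"
    using assms(1,2) by (intro space_arith effdom_space)
  ultimately have z: "?z \<in> effdom"
    unfolding effdom_def using le_less_trans[OF le, of \<infinity>] by simp
  then show ?thesis
    using le unfolding psi_eq[OF z] by simp
qed

lemma component_diff: "i \<in> {1..ncomp F} \<Longrightarrow> component F i differentiable_on Rd (dimen F)"
  using composite by (simp add: composite_problem_def space_of_def)

lemma comp_grad_space [simp]:
  "i \<in> {1..ncomp F} \<Longrightarrow> x \<in> space_of F \<Longrightarrow> comp_grad F i x \<in> space_of F"
  using grad_works[OF component_diff] by (simp add: comp_grad_def space_of_def)

lemma comp_grad_lipschitz:
  "i \<in> {1..ncomp F} \<Longrightarrow> x \<in> space_of F \<Longrightarrow> y \<in> space_of F \<Longrightarrow>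
    norm (comp_grad F i x - comp_grad F i y) \<le> L * norm (x - y)"
  using component_smooth by (auto simp: comp_grad_def space_of_def smooth_def)

lemma full_grad_eq:
  assumes x: "x \<in> space_of F"
  shows "full_grad x = (1 / real (ncomp F)) *\<^sub>R (\<Sum>i\<in>{1..ncomp F}. comp_grad F i x)"
  unfolding full_grad_def
proof (rule grad_eqI)
  show "(smooth_part F has_derivative
      (\<lambda>h. inner ((1 / real (ncomp F)) *\<^sub>R (\<Sum>i\<in>{1..ncomp F}. comp_grad F i x)) h))
      (at x within Rd (dimen F))"
    unfolding smooth_part_def[abs_def] using grad_works[OF component_diff] x
    by (auto intro!: derivative_eq_intros sum.cong
        simp: comp_grad_def space_of_def inner_sum_left sum_divide_distrib)
  have "(1 / real (ncomp F)) *\<^sub>R (\<Sum>i\<in>{1..ncomp F}. comp_grad F i x) \<in> space_of F"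
    using x by (intro space_arith(3) space_sum comp_grad_space)
  then show "(1 / real (ncomp F)) *\<^sub>R (\<Sum>i\<in>{1..ncomp F}. comp_grad F i x) \<in> Rd (dimen F)"
    by (simp add: space_of_def)
qed (use x in \<open>simp add: space_of_def\<close>)

lemma smooth_part_diff: "smooth_part F differentiable_on Rd (dimen F)"
  using smooth_part_nonconvex by (simp add: nonconvex_def)

lemma full_grad_space [simp]: "x \<in> space_of F \<Longrightarrow> full_grad x \<in> space_of F"
  using grad_works[OF smooth_part_diff] by (simp add: full_grad_def space_of_def)

lemma reg_grad_space [simp]: "x \<in> space_of F \<Longrightarrow> c \<in> space_of F \<Longrightarrow> reg_grad c x \<in> space_of F"
  by (simp add: reg_grad_def)

lemma full_grad_lipschitz:
  assumes x: "x \<in> space_of F" and y: "y \<in> space_of F"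
  shows "norm (full_grad x - full_grad y) \<le> L * norm (x - y)"
proof -
  have "full_grad x - full_grad y =
      (1 / real (ncomp F)) *\<^sub>R (\<Sum>i\<in>{1..ncomp F}. comp_grad F i x - comp_grad F i y)"
    using x y by (simp add: full_grad_eq sum_subtractf scaleR_diff_right)
  then have "norm (full_grad x - full_grad y)
      = 1 / real (ncomp F) * norm (\<Sum>i\<in>{1..ncomp F}. comp_grad F i x - comp_grad F i y)"
    by simp
  also have "\<dots> \<le> 1 / real (ncomp F) * (\<Sum>i\<in>{1..ncomp F}. L * norm (x - y))"
    using x y comp_grad_lipschitz by (intro mult_left_mono sum_norm_le) auto
  also have "\<dots> = L * norm (x - y)"
    using ncomp_pos by simp
  finally show ?thesis .
qed

lemma smooth_part_smooth: "smooth (dimen F) L (smooth_part F)"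
  using smooth_part_diff full_grad_lipschitz by (simp add: smooth_def full_grad_def space_of_def)

lemma smooth_part_upper:
  "x \<in> space_of F \<Longrightarrow> y \<in> space_of F \<Longrightarrow>
    smooth_part F y \<le> smooth_part F x + inner (full_grad x) (y - x) + L / 2 * (norm (y - x))\<^sup>2"
  using smooth_upper_bound[OF smooth_part_smooth] by (simp add: space_of_def full_grad_def)

lemma smooth_part_lower:
  "x \<in> space_of F \<Longrightarrow> y \<in> space_of F \<Longrightarrow>
    smooth_part F y \<ge> smooth_part F x + inner (full_grad x) (y - x) - \<sigma> / 2 * (norm (y - x))\<^sup>2"
  using smooth_part_nonconvex by (simp add: space_of_def full_grad_def nonconvex_def norm_minus_commute)

section \<open>The regularised smooth part\<close>

text \<open>The quadratic has curvature 2 \<sigma>: it outweighs the nonconvexity \<sigma> and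
  leaves strong convexity \<sigma>, while the smoothness constant grows to at most L + 2 \<sigma>
  \<le> 3 L.\<close>

definition reg :: "fvec \<Rightarrow> fvec \<Rightarrow> real" where
  "reg c x = smooth_part F x + \<sigma> * (norm (x - c))\<^sup>2"

lemma reg_upper:
  assumes "x \<in> space_of F" "y \<in> space_of F"
  shows "reg c y \<le> reg c x + inner (reg_grad c x) (y - x) + 3 * L / 2 * (norm (y - x))\<^sup>2"
proof -
  have "(norm (y - c))\<^sup>2 = (norm (x - c))\<^sup>2 + 2 * inner (x - c) (y - x) + (norm (y - x))\<^sup>2"
    using norm_add_sq[of "x - c" "y - x"] by simp
  then have "\<sigma> * (norm (y - c))\<^sup>2 =
      \<sigma> * (norm (x - c))\<^sup>2 + 2 * \<sigma> * inner (x - c) (y - x) + \<sigma> * (norm (y - x))\<^sup>2"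
    by (simp only: distrib_left mult_ac)
  moreover have "\<sigma> * (norm (y - x))\<^sup>2 \<le> L * (norm (y - x))\<^sup>2"
    using sigma_le by (intro mult_right_mono) auto
  ultimately show ?thesis
    using smooth_part_upper[OF assms] by (simp add: reg_def reg_grad_def inner_add_left)
qed

lemma reg_lower:
  assumes "x \<in> space_of F" "y \<in> space_of F"
  shows "reg c y \<ge> reg c x + inner (reg_grad c x) (y - x) + \<sigma> / 2 * (norm (y - x))\<^sup>2"
proof -
  have "(norm (y - c))\<^sup>2 = (norm (x - c))\<^sup>2 + 2 * inner (x - c) (y - x) + (norm (y - x))\<^sup>2"
    using norm_add_sq[of "x - c" "y - x"] by simp
  then have "\<sigma> * (norm (y - c))\<^sup>2 =
      \<sigma> * (norm (x - c))\<^sup>2 + 2 * \<sigma> * inner (x - c) (y - x) + \<sigma> * (norm (y - x))\<^sup>2"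
    by (simp only: distrib_left mult_ac)
  then show ?thesis
    using smooth_part_lower[OF assms] by (simp add: reg_def reg_grad_def inner_add_left)
qed

lemma reg_grad_lipschitz:
  assumes "x \<in> space_of F" "y \<in> space_of F"
  shows "norm (reg_grad c x - reg_grad c y) \<le> 3 * L * norm (x - y)"
proof -
  have "reg_grad c x - reg_grad c y = (full_grad x - full_grad y) + (2 * \<sigma>) *\<^sub>R (x - y)"
    by (simp add: reg_grad_def algebra_simps)
  then have "norm (reg_grad c x - reg_grad c y) \<le>
      norm (full_grad x - full_grad y) + norm ((2 * \<sigma>) *\<^sub>R (x - y))"
    using norm_triangle_ineq by metis
  moreover have "norm ((2 * \<sigma>) *\<^sub>R (x - y)) \<le> 2 * L * norm (x - y)"
    using sigma_pos sigma_le by (auto intro!: mult_right_mono)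
  ultimately show ?thesis
    using full_grad_lipschitz[OF assms] by simp
qed

lemma reg_grad_monotone:
  assumes "x \<in> space_of F" "y \<in> space_of F"
  shows "inner (reg_grad c x - reg_grad c y) (x - y) \<ge> \<sigma> * (norm (x - y))\<^sup>2"
proof -
  have "inner (reg_grad c x) (y - x) = - inner (reg_grad c x) (x - y)"
    by (simp add: inner_diff_right)
  then show ?thesis
    using reg_lower[OF assms, of c] reg_lower[OF assms(2,1), of c]
    by (simp add: inner_diff_left norm_minus_commute)
qed

section \<open>Proximal steps\<close>

lemma prox_minimal:
  assumes "0 < \<eta>" "v \<in> space_of F" "x \<in> space_of F"
  shows "prox_step F \<eta> v x \<in> effdom"
    and "\<And>y. y \<in> space_of F \<Longrightarrow> prox_objective F \<eta> v x (prox_step F \<eta> v x) \<le> prox_objective F \<eta> v x y"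
proof -
  let ?z = "prox_step F \<eta> v x"
  have z: "is_arg_min (prox_objective F \<eta> v x) (\<lambda>y. y \<in> space_of F) ?z"
  proof -
    have "\<exists>z. is_arg_min (prox_objective F \<eta> v x) (\<lambda>y. y \<in> space_of F) z"
      using composite assms unfolding composite_problem_def by simp
    then show ?thesis
      unfolding prox_step_def arg_min_def by (rule someI_ex)
  qed
  then show *: "prox_objective F \<eta> v x ?z \<le> prox_objective F \<eta> v x y" if "y \<in> space_of F" for y
    using that by (auto simp: is_arg_min_def not_less)
  obtain u where u: "u \<in> effdom"
    using effdom_nonempty by blast
  have "prox_objective F \<eta> v x ?z < \<infinity>"
    using *[OF effdom_space[OF u]] psi_eq[OF u] by (auto simp: prox_objective_def)
  moreover have "?z \<in> space_of F"
    using z by (simp add: is_arg_min_def)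
  ultimately show "?z \<in> effdom"
    unfolding effdom_def by (cases "psi F ?z") (simp_all add: prox_objective_def)
qed

text \<open>The optimality condition that \<open>-(v + (z - x) / \<eta>)\<close> is a subgradient of
  \<open>psi\<close> at z, without subdifferentials: the minimiser z is compared with the point at
  parameter t on the segment to u, and t tends to 0.\<close>

lemma prox_ineq:
  assumes \<eta>: "0 < \<eta>" and v: "v \<in> space_of F" and x: "x \<in> space_of F" and u: "u \<in> effdom"
    and z_def: "z = prox_step F \<eta> v x"
  shows "psi_real z + inner v (z - u) \<le> psi_real u + (1 / \<eta>) * inner (z - x) (u - z)"
proof -
  have z: "z \<in> effdom"
    unfolding z_def by (rule prox_minimal[OF \<eta> v x])
  let ?g = "psi_real z + inner v (z - u) - psi_real u - (1 / \<eta>) * inner (z - x) (u - z)"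
  have "?g \<le> t * (1 / (2 * \<eta>) * (norm (u - z))\<^sup>2)" if t: "0 < t" "t < 1" for t
  proof -
    let ?y = "(1 - t) *\<^sub>R z + t *\<^sub>R u"
    have y: "?y \<in> effdom" and le: "psi_real ?y \<le> (1 - t) * psi_real z + t * psi_real u"
      using psi_convex[OF z u t] by auto
    have "psi_real z + (inner v z + 1 / (2 * \<eta>) * (norm (z - x))\<^sup>2)
        \<le> psi_real ?y + (inner v ?y + 1 / (2 * \<eta>) * (norm (?y - x))\<^sup>2)"
      using prox_minimal(2)[OF \<eta> v x effdom_space[OF y]] y z
      by (simp add: prox_objective_def z_def[symmetric] psi_eq)
    moreover have "(norm (?y - x))\<^sup>2
        = (norm (z - x))\<^sup>2 + 2 * (t * inner (z - x) (u - z)) + t\<^sup>2 * (norm (u - z))\<^sup>2"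
    proof -
      have "?y - x = (z - x) + t *\<^sub>R (u - z)"
        by (simp add: algebra_simps)
      then show ?thesis
        by (simp only: norm_add_sq) (simp add: power_mult_distrib)
    qed
    moreover have "inner v ?y = inner v z - t * inner v (z - u)"
      by (simp add: inner_add_right inner_diff_right algebra_simps)
    ultimately have "psi_real z + inner v z + 1 / (2 * \<eta>) * (norm (z - x))\<^sup>2 \<le>
        (1 - t) * psi_real z + t * psi_real u + inner v z - t * inner v (z - u)
        + 1 / (2 * \<eta>) * ((norm (z - x))\<^sup>2 + 2 * (t * inner (z - x) (u - z)) + t\<^sup>2 * (norm (u - z))\<^sup>2)"
      using le by simp
    \<comment> \<open>The terms of order zero in t cancel, so one factor t can be divided out before
      the limit.\<close>
    then have "t * ?g \<le> t * (t * (1 / (2 * \<eta>) * (norm (u - z))\<^sup>2))"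
      using \<eta> by (simp add: field_simps power2_eq_square)
    then show ?thesis
      using t by (simp only: mult_le_cancel_left_pos)
  qed
  then have "eventually (\<lambda>t. ?g \<le> t * (1 / (2 * \<eta>) * (norm (u - z))\<^sup>2)) (at_right 0)"
    by (intro eventually_at_rightI[of 0 1]) auto
  moreover have "((\<lambda>t. t * (1 / (2 * \<eta>) * (norm (u - z))\<^sup>2)) \<longlongrightarrow> 0 * (1 / (2 * \<eta>) * (norm (u - z))\<^sup>2)) (at_right 0)"
    by (intro tendsto_intros)
  ultimately have "?g \<le> 0 * (1 / (2 * \<eta>) * (norm (u - z))\<^sup>2)"
    by (intro tendsto_lowerbound[of _ _ "at_right (0::real)"]) auto
  then show ?thesis by simp
qed

text \<open>Each of the two optimality conditions is tested at the other proximal point; in their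
  sum the values of \<open>psi\<close> cancel.\<close>

lemma prox_firmly_nonexpansive:
  assumes \<eta>: "0 < \<eta>" and v: "v \<in> space_of F" "v' \<in> space_of F"
    and x: "x \<in> space_of F" "x' \<in> space_of F"
    and z: "z = prox_step F \<eta> v x" "z' = prox_step F \<eta> v' x'"
  shows "(norm (z - z'))\<^sup>2 \<le> inner ((x - \<eta> *\<^sub>R v) - (x' - \<eta> *\<^sub>R v')) (z - z')"
proof -
  have "z \<in> effdom" "z' \<in> effdom"
    using prox_minimal(1) assms by auto
  from prox_ineq[OF \<eta> v(1) x(1) this(2) z(1)] prox_ineq[OF \<eta> v(2) x(2) this(1) z(2)]
  have "inner v (z - z') + inner v' (z' - z) \<le>
      (1 / \<eta>) * (inner (z - x) (z' - z) + inner (z' - x') (z - z'))"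
    by (simp add: algebra_simps)
  then have "\<eta> * (inner v (z - z') + inner v' (z' - z)) \<le>
      inner (z - x) (z' - z) + inner (z' - x') (z - z')"
    using \<eta> by (simp add: field_simps)
  then show ?thesis
    by (simp add: power2_norm_eq_inner inner_diff_left inner_diff_right algebra_simps)
qed

lemma prox_nonexpansive:
  assumes "0 < \<eta>" "v \<in> space_of F" "v' \<in> space_of F" "x \<in> space_of F" "x' \<in> space_of F"
  shows "norm (prox_step F \<eta> v x - prox_step F \<eta> v' x') \<le> norm ((x - \<eta> *\<^sub>R v) - (x' - \<eta> *\<^sub>R v'))"
proof -
  let ?d = "prox_step F \<eta> v x - prox_step F \<eta> v' x'"
  have "norm ?d * norm ?d \<le> inner ((x - \<eta> *\<^sub>R v) - (x' - \<eta> *\<^sub>R v')) ?d"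
    using prox_firmly_nonexpansive[OF assms refl refl] by (simp add: power2_eq_square)
  also have "\<dots> \<le> norm ((x - \<eta> *\<^sub>R v) - (x' - \<eta> *\<^sub>R v')) * norm ?d"
    by (rule norm_cauchy_schwarz)
  finally show ?thesis
    by (cases "norm ?d = 0") (auto simp: mult_le_cancel_right)
qed

text \<open>Since \<open>psi\<close> need not be lower semicontinuous, the minimiser is obtained from the
  hypothesis that proximal steps exist, as the fixed point of a contractive proximal step.\<close>

lemma reg_stationary_exists:
  assumes c: "c \<in> space_of F"
  shows "\<exists>z\<in>effdom. \<forall>u\<in>effdom. psi_real z + inner (reg_grad c z) (z - u) \<le> psi_real u"
proof -
  \<comment> \<open>Monotonicity \<sigma> and Lipschitz constant 3 L give the squared contraction
    factor 1 - 2 \<eta> \<sigma> + 9 L^2 \<eta>^2. This step length minimises it, with value 1 -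
    \<eta> \<sigma>.\<close>
  define \<eta> where "\<eta> = \<sigma> / (9 * L\<^sup>2)"
  have \<eta>: "0 < \<eta>" "9 * L\<^sup>2 * \<eta> = \<sigma>"
    using sigma_pos L_pos by (simp_all add: \<eta>_def)
  define T where "T x = prox_step F \<eta> (reg_grad c x) x" for x
  have "\<sigma> * \<sigma> \<le> L * L"
    using sigma_pos sigma_le by (intro mult_mono) auto
  moreover have "9 * (\<eta> * \<sigma>) * L\<^sup>2 = \<sigma> * \<sigma>"
    using \<eta>(2) by (metis mult.assoc mult.commute)
  ultimately have "9 * (\<eta> * \<sigma>) * L\<^sup>2 \<le> 1 * L\<^sup>2"
    by (simp only: power2_eq_square mult_1)
  then have "9 * (\<eta> * \<sigma>) \<le> 1"
    by (rule mult_right_le_imp_le) (use L_pos in simp)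
  then have "\<eta> * \<sigma> < 1"
    by linarith
  have T_space: "T x \<in> effdom" if "x \<in> space_of F" for x
    unfolding T_def using \<eta>(1) that c by (intro prox_minimal(1) reg_grad_space)
  have T_lip: "dist (T x) (T y) \<le> sqrt (1 - \<eta> * \<sigma>) * dist x y"
    if xy: "x \<in> space_of F" "y \<in> space_of F" for x y
  proof -
    let ?g = "reg_grad c x - reg_grad c y"
    have "norm (T x - T y) \<le> norm ((x - \<eta> *\<^sub>R reg_grad c x) - (y - \<eta> *\<^sub>R reg_grad c y))"
      unfolding T_def using \<eta>(1) xy c by (intro prox_nonexpansive reg_grad_space)
    also have "(x - \<eta> *\<^sub>R reg_grad c x) - (y - \<eta> *\<^sub>R reg_grad c y) = (x - y) - \<eta> *\<^sub>R ?g"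
      by (simp add: algebra_simps)
    finally have "(norm (T x - T y))\<^sup>2 \<le> (norm ((x - y) - \<eta> *\<^sub>R ?g))\<^sup>2"
      by (intro power_mono) auto
    also have "\<dots> = (norm (x - y))\<^sup>2 - 2 * \<eta> * inner ?g (x - y) + \<eta>\<^sup>2 * (norm ?g)\<^sup>2"
      by (simp add: norm_diff_sq[of "x - y"] inner_commute power_mult_distrib)
    also have "\<dots> \<le> (norm (x - y))\<^sup>2 - 2 * \<eta> * (\<sigma> * (norm (x - y))\<^sup>2) + \<eta>\<^sup>2 * (3 * L * norm (x - y))\<^sup>2"
      using \<eta> reg_grad_monotone[OF xy] reg_grad_lipschitz[OF xy]
      by (intro add_mono diff_mono mult_left_mono power_mono) auto
    also have "\<dots> = (norm (x - y))\<^sup>2 - 2 * \<eta> * (\<sigma> * (norm (x - y))\<^sup>2) + \<eta> * (9 * L\<^sup>2 * \<eta>) * (norm (x - y))\<^sup>2"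
      by (simp add: power_mult_distrib power2_eq_square)
    also have "\<dots> = (1 - \<eta> * \<sigma>) * (norm (x - y))\<^sup>2"
      unfolding \<eta>(2) by (simp add: algebra_simps)
    finally have "sqrt ((norm (T x - T y))\<^sup>2) \<le> sqrt ((1 - \<eta> * \<sigma>) * (norm (x - y))\<^sup>2)"
      by (rule real_sqrt_le_mono)
    then show ?thesis
      by (simp add: real_sqrt_mult dist_norm)
  qed
  have "\<exists>!x\<in>space_of F. T x = x"
  proof (rule Banach_fix)
    show "Topological_Spaces.complete (space_of F)"
      unfolding space_of_def by (rule complete_Rd)
    show "space_of F \<noteq> {}"
      using c by auto
    show "0 \<le> sqrt (1 - \<eta> * \<sigma>)" "sqrt (1 - \<eta> * \<sigma>) < 1"
      using \<open>\<eta> * \<sigma> < 1\<close> \<eta> sigma_pos by auto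
    show "T ` space_of F \<subseteq> space_of F"
      using T_space by blast
    show "\<And>x y. x \<in> space_of F \<Longrightarrow> y \<in> space_of F \<Longrightarrow> dist (T x) (T y) \<le> sqrt (1 - \<eta> * \<sigma>) * dist x y"
      by (rule T_lip)
  qed
  then obtain z where z: "z \<in> space_of F" "T z = z"
    by blast
  \<comment> \<open>At a fixed point the displacement term of \<open>prox_ineq\<close> is zero,
    which leaves stationarity.\<close>
  have "psi_real z + inner (reg_grad c z) (z - u) \<le> psi_real u" if u: "u \<in> effdom" for u
    using prox_ineq[OF \<eta>(1) _ z(1) u, of "reg_grad c z" z] z c by (auto simp: T_def)
  then show ?thesis
    using T_space[OF z(1)] z by (intro bexI[of _ z]) auto
qed

text \<open>The defining property is the variational inequality: minimality with quadratic growth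
  follows from it by strong convexity, and the error bound for gradient mappings uses the inequality
  itself.\<close>

definition centre_min :: "fvec \<Rightarrow> fvec" where
  "centre_min c = (SOME z. z \<in> effdom \<and>
     (\<forall>u\<in>effdom. psi_real z + inner (reg_grad c z) (z - u) \<le> psi_real u))"

lemma
  assumes "c \<in> space_of F"
  shows centre_min_effdom: "centre_min c \<in> effdom"
    and centre_min_stationary: "\<And>u. u \<in> effdom \<Longrightarrow>
      psi_real (centre_min c) + inner (reg_grad c (centre_min c)) (centre_min c - u) \<le> psi_real u"
proof -
  have "\<exists>z. z \<in> effdom \<and>
      (\<forall>u\<in>effdom. psi_real z + inner (reg_grad c z) (z - u) \<le> psi_real u)"
    using reg_stationary_exists[OF assms] by blast
  from someI_ex[OF this]
  show "centre_min c \<in> effdom" "\<And>u. u \<in> effdom \<Longrightarrow>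
      psi_real (centre_min c) + inner (reg_grad c (centre_min c)) (centre_min c - u) \<le> psi_real u"
    unfolding centre_min_def by blast+
qed

definition reg_obj :: "fvec \<Rightarrow> fvec \<Rightarrow> real" where
  "reg_obj c x = psi_real x + reg c x"

text \<open>Stationarity cancels the linear term of the strong convexity bound at the minimiser. The
  remaining quadratic growth converts differences of objective values into distances.\<close>

lemma centre_min_optimal:
  assumes c: "c \<in> space_of F" and u: "u \<in> effdom"
  shows "reg_obj c (centre_min c) + \<sigma> / 2 * (norm (u - centre_min c))\<^sup>2 \<le> reg_obj c u"
proof -
  let ?z = "centre_min c"
  have "inner (reg_grad c ?z) (?z - u) = - inner (reg_grad c ?z) (u - ?z)"
    by (simp add: inner_diff_right)
  then show ?thesis
    using centre_min_stationary[OF c u] reg_lower[of ?z u c] centre_min_effdom[OF c] u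
    by (simp add: reg_obj_def)
qed

section \<open>The inner loop\<close>

definition obj :: "fvec \<Rightarrow> real" where
  "obj x = psi_real x + smooth_part F x"

lemma reg_obj_eq: "reg_obj c x = obj x + \<sigma> * (norm (x - c))\<^sup>2"
  by (simp add: reg_obj_def obj_def reg_def)

text \<open>The estimator error is split into e, the batch error that is constant during an epoch,
  and \<zeta>, which will have mean zero over the sampled index. The product of \<zeta> with
  \<open>x - u\<close> is kept exact because \<open>x - u\<close> does not depend on that index; the
  correlation with \<open>z - x\<close> does, and is bounded by Young's inequality.\<close>

lemma prox_step_progress:
  assumes \<alpha>: "0 < \<alpha>" "\<alpha> * (6 * L) \<le> 1"
    and c: "c \<in> space_of F" and x: "x \<in> space_of F" and u: "u \<in> effdom" and v: "v \<in> space_of F"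
    and \<zeta>: "\<zeta> = v - e - reg_grad c x"
    and z: "z = prox_step F \<alpha> v x"
  shows "reg_obj c z - reg_obj c u + (1 / (2 * \<alpha>) - \<sigma> / 4) * (norm (z - u))\<^sup>2
    \<le> \<alpha> * (norm \<zeta>)\<^sup>2 - inner \<zeta> (x - u) + (norm e)\<^sup>2 / \<sigma>
      + (1 / (2 * \<alpha>) - \<sigma> / 2) * (norm (x - u))\<^sup>2"
proof -
  have zd: "z \<in> effdom"
    unfolding z using \<alpha> v x by (intro prox_minimal(1))
  let ?N = "(norm (z - x))\<^sup>2"
  have "psi_real z + inner v (z - u) \<le> psi_real u +
      (1 / (2 * \<alpha>)) * (2 * inner (z - x) (u - z))"
    using prox_ineq[OF \<alpha>(1) v x u z] by simp
  then have psi: "psi_real z + inner v (z - u) \<le> psi_real u +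
      (1 / (2 * \<alpha>)) * ((norm (x - u))\<^sup>2 - (norm (z - u))\<^sup>2 - ?N)"
    by (simp only: inner_three_point)
  have up: "reg c z \<le> reg c x + inner (reg_grad c x) (z - x) + 3 * L / 2 * ?N"
    using reg_upper[OF x effdom_space[OF zd]] .
  have low: "reg c x + inner (reg_grad c x) (u - x) + \<sigma> / 2 * (norm (x - u))\<^sup>2 \<le> reg c u"
    using reg_lower[OF x effdom_space[OF u]] by (simp add: norm_minus_commute)
  have split: "inner v (z - u) = inner e (z - u) + inner \<zeta> (x - u) + inner \<zeta> (z - x)
      + inner (reg_grad c x) (z - x) - inner (reg_grad c x) (u - x)"
    unfolding \<zeta> by (simp add: inner_diff_left inner_diff_right algebra_simps)
  have "- inner e (z - u) \<le> (norm e)\<^sup>2 / \<sigma> + \<sigma> / 4 * (norm (z - u))\<^sup>2"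
    using young_inner[OF sigma_pos] .
  moreover have "- inner \<zeta> (z - x) \<le> \<alpha> * (norm \<zeta>)\<^sup>2 + 1 / (4 * \<alpha>) * ?N"
    using young_inner[of "1 / \<alpha>" \<zeta> "z - x"] \<alpha> by (simp add: mult.commute)
  \<comment> \<open>The proximal term offers 1 / (2 \<alpha>) times the squared step: half pays for
    the noise, half for the smoothness error. The latter is the condition 6 L \<alpha> \<le>
    1.\<close>
  moreover have "3 * L / 2 * ?N \<le> 1 / (4 * \<alpha>) * ?N"
    using \<alpha> L_pos by (intro mult_right_mono) (simp_all add: field_simps)
  moreover have "1 / (2 * \<alpha>) * ?N = 2 * (1 / (4 * \<alpha>) * ?N)"
    by simp
  ultimately show ?thesis
    using psi up low unfolding split reg_obj_def
    by (simp only: left_diff_distrib right_diff_distrib)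
qed

definition estimator :: "fvec \<Rightarrow> fvec \<Rightarrow> fvec \<Rightarrow> fvec \<Rightarrow> nat \<Rightarrow> fvec" where
  "estimator xt \<mu> xh x i = comp_grad F i x - comp_grad F i xt + \<mu> + (2 * \<sigma>) *\<^sub>R (x - xh)"

lemma estimator_space [simp]:
  assumes "i \<in> {1..ncomp F}" "xt \<in> space_of F" "\<mu> \<in> space_of F" "xh \<in> space_of F" "x \<in> space_of F"
  shows "estimator xt \<mu> xh x i \<in> space_of F"
  unfolding estimator_def using assms by (intro space_arith comp_grad_space)

lemma expected_progress:
  assumes \<alpha>: "0 < \<alpha>" "\<alpha> * (6 * L) \<le> 1"
    and xt: "xt \<in> space_of F" and \<mu>: "\<mu> \<in> space_of F" and xh: "xh \<in> space_of F"
    and x: "x \<in> space_of F" and u: "u \<in> effdom"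
    and e: "e = \<mu> - full_grad xt"
    and z: "\<And>i. z i = prox_step F \<alpha> (estimator xt \<mu> xh x i) x"
  shows "(\<Sum>i\<in>{1..ncomp F}. reg_obj xh (z i) - reg_obj xh u
        + (1 / (2 * \<alpha>) - \<sigma> / 4) * (norm (z i - u))\<^sup>2) / real (ncomp F)
    \<le> \<alpha> * L\<^sup>2 * (norm (x - xt))\<^sup>2 + (norm e)\<^sup>2 / \<sigma> + (1 / (2 * \<alpha>) - \<sigma> / 4) * (norm (x - u))\<^sup>2"
proof -
  let ?n = "real (ncomp F)"
  have n: "0 < ?n"
    using ncomp_pos by simp
  define \<zeta> where "\<zeta> i = (comp_grad F i x - comp_grad F i xt) - (full_grad x - full_grad xt)" for i
  have g: "(1 / ?n) *\<^sub>R (\<Sum>i\<in>{1..ncomp F}. comp_grad F i x - comp_grad F i xt) = full_grad x - full_grad xt"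
    using x xt by (simp add: full_grad_eq sum_subtractf scaleR_diff_right)
  have K: "(norm (comp_grad F i x - comp_grad F i xt))\<^sup>2 \<le> L\<^sup>2 * (norm (x - xt))\<^sup>2"
    if "i \<in> {1..ncomp F}" for i
    using power_mono[OF comp_grad_lipschitz[OF that x xt], of 2] by (simp add: power_mult_distrib)
  have \<zeta>_sum: "(\<Sum>i\<in>{1..ncomp F}. \<zeta> i) = 0"
    and \<zeta>_var: "(\<Sum>i\<in>{1..ncomp F}. (norm (\<zeta> i))\<^sup>2) / ?n \<le> L\<^sup>2 * (norm (x - xt))\<^sup>2"
    unfolding \<zeta>_def using mean_deviation_le[OF ncomp_pos g K] by auto
  let ?R = "(norm e)\<^sup>2 / \<sigma> + (1 / (2 * \<alpha>) - \<sigma> / 2) * (norm (x - u))\<^sup>2"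
  have "(\<Sum>i\<in>{1..ncomp F}. reg_obj xh (z i) - reg_obj xh u
        + (1 / (2 * \<alpha>) - \<sigma> / 4) * (norm (z i - u))\<^sup>2)
      \<le> (\<Sum>i\<in>{1..ncomp F}. \<alpha> * (norm (\<zeta> i))\<^sup>2 - inner (\<zeta> i) (x - u) + ?R)"
  proof (rule sum_mono)
    fix i assume i: "i \<in> {1..ncomp F}"
    have "\<zeta> i = estimator xt \<mu> xh x i - e - reg_grad xh x"
      by (simp add: \<zeta>_def estimator_def e reg_grad_def)
    from prox_step_progress[OF \<alpha> xh x u estimator_space[OF i xt \<mu> xh x] this z]
    show "reg_obj xh (z i) - reg_obj xh u + (1 / (2 * \<alpha>) - \<sigma> / 4) * (norm (z i - u))\<^sup>2
      \<le> \<alpha> * (norm (\<zeta> i))\<^sup>2 - inner (\<zeta> i) (x - u) + ?R"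
      by simp
  qed
  also have "\<dots> = \<alpha> * (\<Sum>i\<in>{1..ncomp F}. (norm (\<zeta> i))\<^sup>2) - inner (\<Sum>i\<in>{1..ncomp F}. \<zeta> i) (x - u) + ?n * ?R"
    by (simp add: sum.distrib sum_subtractf sum_distrib_left inner_sum_left)
  also have "\<dots> = \<alpha> * (\<Sum>i\<in>{1..ncomp F}. (norm (\<zeta> i))\<^sup>2) + ?n * ?R"
    unfolding \<zeta>_sum by simp
  finally have "(\<Sum>i\<in>{1..ncomp F}. reg_obj xh (z i) - reg_obj xh u
        + (1 / (2 * \<alpha>) - \<sigma> / 4) * (norm (z i - u))\<^sup>2) / ?n
      \<le> (\<alpha> * (\<Sum>i\<in>{1..ncomp F}. (norm (\<zeta> i))\<^sup>2) + ?n * ?R) / ?n"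
    using n by (intro divide_right_mono) auto
  also have "\<dots> = \<alpha> * ((\<Sum>i\<in>{1..ncomp F}. (norm (\<zeta> i))\<^sup>2) / ?n) + ?R"
    using n by (simp add: add_divide_distrib)
  also have "\<dots> \<le> \<alpha> * (L\<^sup>2 * (norm (x - xt))\<^sup>2) + ?R"
    using \<zeta>_var \<alpha> by (intro add_right_mono mult_left_mono) auto
  \<comment> \<open>Weakening \<sigma> / 2 to \<sigma> / 4 gives equal distance weights before and
    after the step, so the steps telescope as a plain sum with no contraction factor.\<close>
  also have "?R \<le> (norm e)\<^sup>2 / \<sigma> + (1 / (2 * \<alpha>) - \<sigma> / 4) * (norm (x - u))\<^sup>2"
    using sigma_pos by (intro add_left_mono mult_right_mono) auto
  finally show ?thesis
    by simp
qed

lemma finite_inner_loop: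
  "finite (set_pmf (inner_loop F \<sigma> \<alpha> xt \<mu> xh m x))"
  using ncomp_pos by (induction m arbitrary: x) (auto intro!: finite_bind_counted simp: set_draw)

lemma cexp_inner_loop_Suc:
  "cexp (inner_loop F \<sigma> \<alpha> xt \<mu> xh (Suc m) x) g =
    (\<Sum>i\<in>{1..ncomp F}. cexp (inner_loop F \<sigma> \<alpha> xt \<mu> xh m
      (prox_step F \<alpha> (estimator xt \<mu> xh x i) x)) (\<lambda>xs. g (x # xs))) / real (ncomp F)"
proof -
  note fin = finite_bind_counted finite_inner_loop
  have "cexp (inner_loop F \<sigma> \<alpha> xt \<mu> xh (Suc m) x) g =
    cexp (draw (pmf_of_set {1..ncomp F})) (\<lambda>i. cexp (inner_loop F \<sigma> \<alpha> xt \<mu> xh m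
      (prox_step F \<alpha> (estimator xt \<mu> xh x i) x)) (\<lambda>xs. g (x # xs)))"
    using ncomp_pos unfolding inner_loop.simps estimator_def
    by (subst cexp_bind; (subst cexp_bind_eval_grad)?; (subst cexp_bind_eval_grad)?;
        (subst cexp_bind_ret)?; auto intro!: fin simp: set_draw)
  then show ?thesis
    using ncomp_pos by (simp add: cexp_draw_of_set)
qed

lemma inner_loop_outcome:
  assumes "0 < \<alpha>" "xt \<in> space_of F" "\<mu> \<in> space_of F" "xh \<in> space_of F" "x \<in> effdom"
    and "(xs, c) \<in> set_pmf (inner_loop F \<sigma> \<alpha> xt \<mu> xh m x)"
  shows "length xs = m \<and> set xs \<subseteq> effdom \<and> c = 2 * m"
  using assms(5,6)
proof (induction m arbitrary: x xs c)
  case (Suc m)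
  from Suc.prems(2) ncomp_pos obtain i ys c' where i: "i \<in> {1..ncomp F}"
    and ys: "(ys, c') \<in> set_pmf (inner_loop F \<sigma> \<alpha> xt \<mu> xh m
      (prox_step F \<alpha> (estimator xt \<mu> xh x i) x))" "xs = x # ys" "c = c' + 2"
    by (auto simp: in_set_bind_counted set_draw estimator_def)
  have "prox_step F \<alpha> (estimator xt \<mu> xh x i) x \<in> effdom"
    using assms(1-4) Suc.prems(1) i by (intro prox_minimal(1) estimator_space) auto
  from Suc.IH[OF this ys(1)] show ?case
    using ys Suc.prems(1) by simp
qed simp

text \<open>The excess objective is part of the potential because the recorded iterates start with x
  itself: the summand for an iterate is paid by its own potential, and the distance part is passed
  on to the next step.\<close>

definition inner_potential :: "real \<Rightarrow> fvec \<Rightarrow> fvec \<Rightarrow> real" where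
  "inner_potential \<alpha> c x = reg_obj c x - reg_obj c (centre_min c)
     + (1 / (2 * \<alpha>) - \<sigma> / 4) * (norm (x - centre_min c))\<^sup>2"

lemma inner_loop_descent:
  assumes \<alpha>: "0 < \<alpha>" "\<alpha> * (6 * L) \<le> 1"
    and xt: "xt \<in> space_of F" and \<mu>: "\<mu> \<in> space_of F" and xh: "xh \<in> space_of F"
    and e: "e = \<mu> - full_grad xt"
    and x: "x \<in> effdom"
  shows "cexp (inner_loop F \<sigma> \<alpha> xt \<mu> xh m x) (\<lambda>xs. \<Sum>y\<leftarrow>xs. reg_obj xh y - reg_obj xh (centre_min xh)
      - \<alpha> * L\<^sup>2 * (norm (y - xt))\<^sup>2 - (norm e)\<^sup>2 / \<sigma>) \<le> inner_potential \<alpha> xh x"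
  using x
proof (induction m arbitrary: x)
  case 0
  \<comment> \<open>The potential left over at the end has to be nonnegative, which requires
    \<sigma> / 4 \<le> 1 / (2 \<alpha>).\<close>
  have "\<alpha> * \<sigma> \<le> \<alpha> * L" "0 < \<alpha> * L"
    using \<alpha>(1) sigma_le L_pos by auto
  then have "\<alpha> * \<sigma> \<le> 2"
    using \<alpha>(2) by linarith
  then have "0 \<le> 1 / (2 * \<alpha>) - \<sigma> / 4"
    using \<alpha>(1) by (simp add: field_simps)
  moreover have "0 \<le> \<sigma> / 2 * (norm (x - centre_min xh))\<^sup>2"
    using sigma_pos by simp
  ultimately show ?case
    using centre_min_optimal[OF xh 0] by (simp add: inner_potential_def)
next
  case (Suc m)
  let ?u = "centre_min xh" and ?n = "real (ncomp F)"
  let ?q = "\<lambda>y. reg_obj xh y - reg_obj xh (centre_min xh)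
      - \<alpha> * L\<^sup>2 * (norm (y - xt))\<^sup>2 - (norm e)\<^sup>2 / \<sigma>"
  let ?z = "\<lambda>i. prox_step F \<alpha> (estimator xt \<mu> xh x i) x"
  have n: "0 < ?n"
    using ncomp_pos by simp
  have "cexp (inner_loop F \<sigma> \<alpha> xt \<mu> xh (Suc m) x) (\<lambda>xs. \<Sum>y\<leftarrow>xs. ?q y)
      = (\<Sum>i\<in>{1..ncomp F}. ?q x + cexp (inner_loop F \<sigma> \<alpha> xt \<mu> xh m (?z i)) (\<lambda>xs. \<Sum>y\<leftarrow>xs. ?q y)) / ?n"
    unfolding cexp_inner_loop_Suc by (simp add: cexp_add[OF finite_inner_loop])
  also have "\<dots> \<le> (\<Sum>i\<in>{1..ncomp F}. ?q x + inner_potential \<alpha> xh (?z i)) / ?n"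
    using \<alpha> xt \<mu> xh Suc.prems
    by (intro divide_right_mono sum_mono add_left_mono Suc.IH prox_minimal(1) estimator_space) auto
  also have "\<dots> = ?q x + (\<Sum>i\<in>{1..ncomp F}. inner_potential \<alpha> xh (?z i)) / ?n"
    using n by (simp add: sum.distrib add_divide_distrib)
  also have "(\<Sum>i\<in>{1..ncomp F}. inner_potential \<alpha> xh (?z i)) / ?n
      \<le> \<alpha> * L\<^sup>2 * (norm (x - xt))\<^sup>2 + (norm e)\<^sup>2 / \<sigma> + (1 / (2 * \<alpha>) - \<sigma> / 4) * (norm (x - ?u))\<^sup>2"
    unfolding inner_potential_def
    using expected_progress[OF \<alpha> xt \<mu> xh effdom_space[OF Suc.prems] centre_min_effdom[OF xh] e refl] .
  finally show ?case
    by (simp add: inner_potential_def)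
qed

end

section \<open>Sub-epochs and epochs\<close>

text \<open>The potential that absorbs the drift from the snapshot over the remaining \<open>k\<close> of \<open>p\<close>
  sub-epochs; it solves \<open>a\<^bsub>k+1\<^esub> = (1 + 1/p) (a\<^sub>k + b)\<close> with \<open>a\<^sub>0 = 0\<close>.\<close>

definition drift_weight :: "real \<Rightarrow> nat \<Rightarrow> nat \<Rightarrow> real" where
  "drift_weight b p k = b * (real p + 1) * ((1 + 1 / real p) ^ k - 1)"

lemma drift_weight_0 [simp]: "drift_weight b p 0 = 0"
  by (simp add: drift_weight_def)

lemma drift_weight_nonneg: "0 \<le> b \<Longrightarrow> 0 \<le> drift_weight b p k"
  by (simp add: drift_weight_def)

lemma drift_weight_Suc:
  "0 < p \<Longrightarrow> drift_weight b p (Suc k) = (1 + 1 / real p) * (drift_weight b p k + b)"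
  by (simp add: drift_weight_def field_simps)

text \<open>As long as k < p, the growth factor stays below (1 + 1/p)^p \<le> e \<le> 3. The weights
  are thus of order b p, and the extra factor 1 + p comes from Young's inequality in
  \<open>drift_step\<close>.\<close>

lemma drift_weight_le:
  assumes "0 \<le> b" "k < p"
  shows "(drift_weight b p k + b) * (1 + real p) \<le> 4 * b * (real p)\<^sup>2"
proof -
  have "(1 + 1 / real p) ^ Suc k \<le> (1 + 1 / real p) ^ p"
    using assms by (intro power_increasing) auto
  also have "\<dots> \<le> exp 1"
    using assms by (intro exp_ge_one_plus_x_over_n_power_n) auto
  also have "\<dots> \<le> 3"
    by (rule exp_le)
  finally have le: "(1 + 1 / real p) ^ Suc k \<le> 3" .
  have "(drift_weight b p k + b) * (1 + real p) = real p * drift_weight b p (Suc k)"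
    using assms by (subst drift_weight_Suc) (auto simp: field_simps)
  also have "\<dots> \<le> real p * (b * (real p + 1) * (3 - 1))"
    unfolding drift_weight_def using assms le by (intro mult_left_mono) auto
  also have "\<dots> \<le> real p * (b * (real p + real p) * (3 - 1))"
    using assms by (intro mult_left_mono mult_right_mono) auto
  also have "\<dots> = 4 * b * (real p)\<^sup>2"
    by (simp add: power2_eq_square)
  finally show ?thesis .
qed

lemma sum_add_const: "(\<Sum>i\<in>A. f i + c) = sum f A + real (card A) * c"
  by (simp add: sum.distrib)

context nonconvex_composite
begin

text \<open>A measure of nonstationarity: \<sigma> times its square root enters the bound on the
  gradient mapping of F near the centre x.\<close>

definition gap :: "fvec \<Rightarrow> real" where
  "gap x = (norm (x - centre_min x))\<^sup>2"

text \<open>Drawing the next centre uniformly turns the sum over iterates into an average, so the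
  initial potential is divided by m. What is left of it is small against the excess
  \<open>obj xh - reg_obj xh (centre_min xh)\<close>, most of which counts as progress.\<close>

lemma sub_epoch_progress:
  assumes \<alpha>: "0 < \<alpha>" "\<alpha> * (6 * L) \<le> 1" "4 \<le> \<alpha> * real m * \<sigma>" and m: "4 \<le> m"
    and xt: "xt \<in> space_of F" and \<mu>: "\<mu> \<in> space_of F" and xh: "xh \<in> effdom"
    and e: "e = \<mu> - full_grad xt"
  shows "cexp (inner_loop F \<sigma> \<alpha> xt \<mu> xh m xh) (\<lambda>xs. (\<Sum>j<m. obj (xs ! j)
      + \<sigma> * (norm (xs ! j - xh))\<^sup>2 - \<alpha> * L\<^sup>2 * (norm (xs ! j - xt))\<^sup>2) / real m)
    \<le> obj xh - \<sigma> / 4 * gap xh + (norm e)\<^sup>2 / \<sigma>"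
proof -
  let ?u = "centre_min xh" and ?m = "real m"
  let ?q = "\<lambda>y. reg_obj xh y - reg_obj xh ?u - \<alpha> * L\<^sup>2 * (norm (y - xt))\<^sup>2 - (norm e)\<^sup>2 / \<sigma>"
  let ?\<delta> = "obj xh - reg_obj xh ?u"
  let ?C = "reg_obj xh ?u + (norm e)\<^sup>2 / \<sigma>"
  have m0: "0 < ?m"
    using m by simp
  have xhs: "xh \<in> space_of F"
    using xh by simp
  have "cexp (inner_loop F \<sigma> \<alpha> xt \<mu> xh m xh) (\<lambda>xs. (\<Sum>j<m. obj (xs ! j)
      + \<sigma> * (norm (xs ! j - xh))\<^sup>2 - \<alpha> * L\<^sup>2 * (norm (xs ! j - xt))\<^sup>2) / ?m)
    = cexp (inner_loop F \<sigma> \<alpha> xt \<mu> xh m xh) (\<lambda>xs. (1 / ?m) * (\<Sum>y\<leftarrow>xs. ?q y) + ?C)"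
  proof (rule cexp_cong[OF finite_inner_loop])
    fix xs c assume "(xs, c) \<in> set_pmf (inner_loop F \<sigma> \<alpha> xt \<mu> xh m xh)"
    from inner_loop_outcome[OF \<alpha>(1) xt \<mu> xhs xh this] have "length xs = m"
      by simp
    then have "(\<Sum>y\<leftarrow>xs. ?q y) = (\<Sum>j<m. ?q (xs ! j))"
      by (simp add: sum_list_sum_nth atLeast0LessThan)
    also have "\<dots> = (\<Sum>j<m. (obj (xs ! j) + \<sigma> * (norm (xs ! j - xh))\<^sup>2
        - \<alpha> * L\<^sup>2 * (norm (xs ! j - xt))\<^sup>2) - ?C)"
      by (intro sum.cong refl) (simp add: reg_obj_eq[of xh "xs ! _"])
    also have "\<dots> = (\<Sum>j<m. obj (xs ! j) + \<sigma> * (norm (xs ! j - xh))\<^sup>2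
        - \<alpha> * L\<^sup>2 * (norm (xs ! j - xt))\<^sup>2) - ?m * ?C"
      by (simp only: sum_subtractf sum_constant card_lessThan)
    finally show "(\<Sum>j<m. obj (xs ! j) + \<sigma> * (norm (xs ! j - xh))\<^sup>2
        - \<alpha> * L\<^sup>2 * (norm (xs ! j - xt))\<^sup>2) / ?m = (1 / ?m) * (\<Sum>y\<leftarrow>xs. ?q y) + ?C"
      using m0 by (simp only: diff_divide_distrib) (simp add: diff_divide_distrib)
  qed
  also have "\<dots> = (1 / ?m) * cexp (inner_loop F \<sigma> \<alpha> xt \<mu> xh m xh) (\<lambda>xs. \<Sum>y\<leftarrow>xs. ?q y) + ?C"
    by (simp only: cexp_add[OF finite_inner_loop] cexp_cmult cexp_const)
  also have "\<dots> \<le> (1 / ?m) * inner_potential \<alpha> xh xh + ?C"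
    using inner_loop_descent[OF \<alpha>(1,2) xt \<mu> xhs e xh] m0
    by (intro add_right_mono mult_left_mono) auto
  also have "inner_potential \<alpha> xh xh \<le> ?\<delta> + 1 / (2 * \<alpha>) * gap xh"
    unfolding inner_potential_def gap_def reg_obj_eq[of xh xh] using sigma_pos
    by (simp add: left_diff_distrib)
  \<comment> \<open>The two lower bounds on the length of the sub-epoch: m \<ge> 4 for the excess,
    \<alpha> m \<sigma> \<ge> 4 for the distance.\<close>
  also have "(1 / ?m) * (?\<delta> + 1 / (2 * \<alpha>) * gap xh) \<le> 1 / 4 * ?\<delta> + \<sigma> / 8 * gap xh"
  proof -
    have "\<sigma> / 2 * gap xh \<le> ?\<delta>"
      using centre_min_optimal[OF xhs xh] reg_obj_eq[of xh xh] by (simp add: gap_def)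
    moreover have "0 \<le> \<sigma> / 2 * gap xh"
      using sigma_pos by (simp add: gap_def)
    ultimately have "(1 / ?m) * ?\<delta> \<le> 1 / 4 * ?\<delta>"
      using m by (intro mult_right_mono) (auto simp: field_simps)
    moreover have "(1 / ?m) * (1 / (2 * \<alpha>)) * gap xh \<le> \<sigma> / 8 * gap xh"
      using \<alpha>(1,3) m0 by (intro mult_right_mono) (auto simp: field_simps gap_def)
    moreover have "(1 / ?m) * (?\<delta> + 1 / (2 * \<alpha>) * gap xh)
        = (1 / ?m) * ?\<delta> + (1 / ?m) * (1 / (2 * \<alpha>)) * gap xh"
      by (simp only: distrib_left mult.assoc)
    ultimately show ?thesis
      by linarith
  qed
  finally have "cexp (inner_loop F \<sigma> \<alpha> xt \<mu> xh m xh) (\<lambda>xs. (\<Sum>j<m. obj (xs ! j)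
      + \<sigma> * (norm (xs ! j - xh))\<^sup>2 - \<alpha> * L\<^sup>2 * (norm (xs ! j - xt))\<^sup>2) / ?m)
    \<le> 1 / 4 * ?\<delta> + \<sigma> / 8 * gap xh + ?C"
    using m0 by (simp add: divide_right_mono)
  \<comment> \<open>\<open>?C\<close> contains \<open>obj xh - ?\<delta>\<close>, so the balance is
    -3/4 of \<open>?\<delta>\<close> plus \<sigma> / 8 times the gap. Quadratic growth bounds it by
    -3/8 + 1/8 = -1/4 times \<sigma> times the gap.\<close>
  moreover have "\<sigma> / 2 * gap xh \<le> ?\<delta>"
    using centre_min_optimal[OF xhs xh] reg_obj_eq[of xh xh] by (simp add: gap_def)
  ultimately show ?thesis
    by argo
qed

lemma finite_sub_epochs:
  assumes "0 < m"
  shows "finite (set_pmf (sub_epochs F \<sigma> \<alpha> xt \<mu> m k xh X))"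
  using assms by (induction k arbitrary: xh X)
    (auto intro!: finite_bind_counted finite_inner_loop finite_draw_of_set simp: lessThan_empty_iff)

lemma cexp_sub_epochs_Suc:
  assumes m: "0 < m"
  shows "cexp (sub_epochs F \<sigma> \<alpha> xt \<mu> m (Suc k) xh X) g =
    cexp (inner_loop F \<sigma> \<alpha> xt \<mu> xh m xh) (\<lambda>xs.
      (\<Sum>j<m. cexp (sub_epochs F \<sigma> \<alpha> xt \<mu> m k (xs ! j) (X @ [xh])) g) / real m)"
proof -
  have d: "finite (set_pmf (draw (pmf_of_set {..<m})))"
    using m by (intro finite_draw_of_set) (auto simp: lessThan_empty_iff)
  show ?thesis
    unfolding sub_epochs.simps
    using m by (simp add: cexp_bind finite_bind_counted finite_inner_loop finite_sub_epochs d
        cexp_draw_of_set lessThan_empty_iff)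
qed

lemma sub_epochs_outcome:
  assumes "0 < m" "0 < \<alpha>" "xt \<in> space_of F" "\<mu> \<in> space_of F" "xh \<in> effdom" "set X \<subseteq> effdom"
    and "((xh', X'), c) \<in> set_pmf (sub_epochs F \<sigma> \<alpha> xt \<mu> m k xh X)"
  shows "xh' \<in> effdom \<and> set X' \<subseteq> effdom \<and> length X' = length X + k \<and> c = k * (2 * m)"
  using assms(5-7)
proof (induction k arbitrary: xh X c)
  case (Suc k)
  have ne: "{..<m} \<noteq> {}"
    using assms(1) by auto
  from Suc.prems(3) obtain xs c1 j c2 where xs: "(xs, c1) \<in> set_pmf (inner_loop F \<sigma> \<alpha> xt \<mu> xh m xh)"
    and j: "j < m"
    and r: "((xh', X'), c2) \<in> set_pmf (sub_epochs F \<sigma> \<alpha> xt \<mu> m k (xs ! j) (X @ [xh]))"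
    and c: "c = c1 + c2"
    by (auto simp: in_set_bind_counted set_draw set_pmf_of_set[OF ne finite_lessThan])
  have *: "length xs = m" "set xs \<subseteq> effdom" "c1 = 2 * m"
    using inner_loop_outcome[OF assms(2-4) _ _ xs] Suc.prems(1) by auto
  then have "xs ! j \<in> effdom"
    using j nth_mem by blast
  from Suc.IH[OF this _ r] show ?case
    using Suc.prems(1,2) c * by simp
qed simp

text \<open>Young's inequality with parameter p between the new centre, the old centre and the
  snapshot. The old distance is inflated only by 1 + 1/p, harmless over p rounds; the move is
  inflated by 1 + p, which the regularisation term affords.\<close>

lemma drift_step:
  fixes y xt xh :: fvec
  assumes p: "0 < p" "k < p" and b: "0 \<le> b" "4 * b * (real p)\<^sup>2 \<le> \<sigma>"
  shows "drift_weight b p k * (norm (y - xt))\<^sup>2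
    \<le> \<sigma> * (norm (y - xh))\<^sup>2 - b * (norm (y - xt))\<^sup>2 + drift_weight b p (Suc k) * (norm (xh - xt))\<^sup>2"
proof -
  let ?a = "drift_weight b p k + b"
  have a: "0 \<le> ?a"
    using drift_weight_nonneg[OF b(1), of p k] b by simp
  have "(norm (y - xt))\<^sup>2 \<le> (1 + real p) * (norm (y - xh))\<^sup>2 + (1 + 1 / real p) * (norm (xh - xt))\<^sup>2"
    using norm_add_sq_le[of "real p" "y - xh" "xh - xt"] p by simp
  then have "?a * (norm (y - xt))\<^sup>2
      \<le> ?a * ((1 + real p) * (norm (y - xh))\<^sup>2 + (1 + 1 / real p) * (norm (xh - xt))\<^sup>2)"
    using a by (rule mult_left_mono)
  also have "\<dots> = (?a * (1 + real p)) * (norm (y - xh))\<^sup>2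
      + drift_weight b p (Suc k) * (norm (xh - xt))\<^sup>2"
    unfolding drift_weight_Suc[OF p(1)] by algebra
  also have "(?a * (1 + real p)) * (norm (y - xh))\<^sup>2 \<le> \<sigma> * (norm (y - xh))\<^sup>2"
    using drift_weight_le[OF b(1) p(2)] b by (intro mult_right_mono) auto
  finally show ?thesis
    by (simp add: distrib_right)
qed

text \<open>Induction on the number of remaining sub-epochs, with the drift weight as the price of
  later distances to the snapshot. A centre is appended before its sub-epoch runs, so each recorded
  point is matched with the gap gained there.\<close>

lemma sub_epochs_descent:
  assumes \<alpha>: "0 < \<alpha>" "\<alpha> * (6 * L) \<le> 1" "4 \<le> \<alpha> * real m * \<sigma>" and m: "4 \<le> m"
    and p: "0 < p" "4 * (\<alpha> * L\<^sup>2) * (real p)\<^sup>2 \<le> \<sigma>"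
    and xt: "xt \<in> space_of F" and \<mu>: "\<mu> \<in> space_of F"
    and e: "e = \<mu> - full_grad xt"
    and xh: "xh \<in> effdom" and k: "k \<le> p"
  shows "cexp (sub_epochs F \<sigma> \<alpha> xt \<mu> m k xh X) (\<lambda>(y, Y). obj y + \<sigma> / 4 * (\<Sum>x\<leftarrow>Y. gap x))
    \<le> obj xh + \<sigma> / 4 * (\<Sum>x\<leftarrow>X. gap x)
      + drift_weight (\<alpha> * L\<^sup>2) p k * (norm (xh - xt))\<^sup>2 + real k * ((norm e)\<^sup>2 / \<sigma>)"
  using xh k
proof (induction k arbitrary: xh X)
  case (Suc k)
  let ?b = "\<alpha> * L\<^sup>2" and ?m = "real m"
  let ?S = "\<sigma> / 4 * (\<Sum>x\<leftarrow>X. gap x) + \<sigma> / 4 * gap xh + real k * ((norm e)\<^sup>2 / \<sigma>)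
      + drift_weight ?b p (Suc k) * (norm (xh - xt))\<^sup>2"
  have b: "0 \<le> ?b"
    using \<alpha> by simp
  have m0: "0 < m" "0 < ?m"
    using m by auto
  have "cexp (sub_epochs F \<sigma> \<alpha> xt \<mu> m (Suc k) xh X) (\<lambda>(y, Y). obj y + \<sigma> / 4 * (\<Sum>x\<leftarrow>Y. gap x))
    \<le> cexp (inner_loop F \<sigma> \<alpha> xt \<mu> xh m xh) (\<lambda>xs. (\<Sum>j<m. obj (xs ! j)
      + \<sigma> * (norm (xs ! j - xh))\<^sup>2 - \<alpha> * L\<^sup>2 * (norm (xs ! j - xt))\<^sup>2) / ?m + ?S)"
    unfolding cexp_sub_epochs_Suc[OF m0(1)]
  proof (rule cexp_mono[OF finite_inner_loop])
    fix xs c assume "(xs, c) \<in> set_pmf (inner_loop F \<sigma> \<alpha> xt \<mu> xh m xh)"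
    from inner_loop_outcome[OF \<alpha>(1) xt \<mu> effdom_space[OF Suc.prems(1)] Suc.prems(1) this]
    have xs: "xs ! j \<in> effdom" if "j < m" for j
      using that nth_mem by blast
    have "(\<Sum>j<m. cexp (sub_epochs F \<sigma> \<alpha> xt \<mu> m k (xs ! j) (X @ [xh]))
        (\<lambda>(y, Y). obj y + \<sigma> / 4 * (\<Sum>x\<leftarrow>Y. gap x)))
      \<le> (\<Sum>j<m. (obj (xs ! j) + \<sigma> * (norm (xs ! j - xh))\<^sup>2
        - \<alpha> * L\<^sup>2 * (norm (xs ! j - xt))\<^sup>2) + ?S)"
    proof (rule sum_mono)
      fix j assume "j \<in> {..<m}"
      then have "xs ! j \<in> effdom"
        using xs by simp
      from Suc.IH[OF this, of "X @ [xh]"] Suc.prems(2)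
        drift_step[of p k ?b "xs ! j" xt xh, OF p(1) _ b p(2)]
      show "cexp (sub_epochs F \<sigma> \<alpha> xt \<mu> m k (xs ! j) (X @ [xh]))
          (\<lambda>(y, Y). obj y + \<sigma> / 4 * (\<Sum>x\<leftarrow>Y. gap x))
        \<le> (obj (xs ! j) + \<sigma> * (norm (xs ! j - xh))\<^sup>2 - \<alpha> * L\<^sup>2 * (norm (xs ! j - xt))\<^sup>2) + ?S"
        by (simp add: distrib_left)
    qed
    also have "\<dots> = (\<Sum>j<m. obj (xs ! j) + \<sigma> * (norm (xs ! j - xh))\<^sup>2
        - \<alpha> * L\<^sup>2 * (norm (xs ! j - xt))\<^sup>2) + ?m * ?S"
        by (simp only: sum_add_const card_lessThan)
    finally have "(\<Sum>j<m. cexp (sub_epochs F \<sigma> \<alpha> xt \<mu> m k (xs ! j) (X @ [xh]))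
        (\<lambda>(y, Y). obj y + \<sigma> / 4 * (\<Sum>x\<leftarrow>Y. gap x))) / ?m
      \<le> ((\<Sum>j<m. obj (xs ! j) + \<sigma> * (norm (xs ! j - xh))\<^sup>2
        - \<alpha> * L\<^sup>2 * (norm (xs ! j - xt))\<^sup>2) + ?m * ?S) / ?m"
      using m0 by (intro divide_right_mono) auto
    then show "(\<Sum>j<m. cexp (sub_epochs F \<sigma> \<alpha> xt \<mu> m k (xs ! j) (X @ [xh]))
        (\<lambda>(y, Y). obj y + \<sigma> / 4 * (\<Sum>x\<leftarrow>Y. gap x))) / ?m
      \<le> (\<Sum>j<m. obj (xs ! j) + \<sigma> * (norm (xs ! j - xh))\<^sup>2
        - \<alpha> * L\<^sup>2 * (norm (xs ! j - xt))\<^sup>2) / ?m + ?S"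
      using m0 by (simp only: add_divide_distrib nonzero_mult_div_cancel_left less_imp_neq[symmetric] not_False_eq_True)
  qed
  also have "\<dots> = cexp (inner_loop F \<sigma> \<alpha> xt \<mu> xh m xh) (\<lambda>xs. (\<Sum>j<m. obj (xs ! j)
      + \<sigma> * (norm (xs ! j - xh))\<^sup>2 - \<alpha> * L\<^sup>2 * (norm (xs ! j - xt))\<^sup>2) / ?m) + ?S"
    by (simp only: cexp_add[OF finite_inner_loop] cexp_const)
  also have "\<dots> \<le> obj xh - \<sigma> / 4 * gap xh + (norm e)\<^sup>2 / \<sigma> + ?S"
    by (intro add_right_mono sub_epoch_progress[OF \<alpha> m xt \<mu> Suc.prems(1) e])
  also have "\<dots> = obj xh + \<sigma> / 4 * (\<Sum>x\<leftarrow>X. gap x)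
      + drift_weight ?b p (Suc k) * (norm (xh - xt))\<^sup>2 + real (Suc k) * ((norm e)\<^sup>2 / \<sigma>)"
    by (simp add: distrib_right add_divide_distrib)
  finally show ?case .
qed simp

section \<open>Minibatches and epochs\<close>

definition batch_grad :: "nat set \<Rightarrow> fvec \<Rightarrow> fvec" where
  "batch_grad S x = (1 / real (card S)) *\<^sub>R (\<Sum>i\<in>S. comp_grad F i x)"

lemma batch_grad_space:
  "S \<subseteq> {1..ncomp F} \<Longrightarrow> x \<in> space_of F \<Longrightarrow> batch_grad S x \<in> space_of F"
  unfolding batch_grad_def by (intro space_arith space_sum comp_grad_space) auto

lemma batch_variance:
  assumes V: "variance_le F V" and x: "x \<in> effdom" and B: "0 < B" "B \<le> ncomp F"
  shows "(\<Sum>S | S \<subseteq> {1..ncomp F} \<and> card S = B. (norm (batch_grad S x - full_grad x))\<^sup>2)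
    / real (ncomp F choose B) \<le> V / real B"
proof -
  let ?n = "real (ncomp F)" and ?a = "\<lambda>i. comp_grad F i x - full_grad x"
  let ?P = "{S. S \<subseteq> {1..ncomp F} \<and> card S = B}"
  have n: "0 < ?n"
    using ncomp_pos by simp
  have "measure_pmf.expectation (pmf_of_set {1..ncomp F})
      (\<lambda>i. (norm (full_grad x - comp_grad F i x))\<^sup>2) \<le> V"
    using V x unfolding variance_le_def full_grad_def effdom_def by simp
  then have var: "(\<Sum>i\<in>{1..ncomp F}. (norm (?a i))\<^sup>2) \<le> ?n * V"
    using ncomp_pos by (simp add: integral_pmf_of_set norm_minus_commute field_simps)
  have sum0: "(\<Sum>i\<in>{1..ncomp F}. ?a i) = 0"
    using n x by (simp add: sum_subtractf full_grad_eq sum_constant_scaleR)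
  have batch: "(norm (batch_grad S x - full_grad x))\<^sup>2 = (norm (\<Sum>i\<in>S. ?a i))\<^sup>2 / (real B)\<^sup>2"
    if "S \<in> ?P" for S
  proof -
    have "batch_grad S x - full_grad x = (1 / real B) *\<^sub>R (\<Sum>i\<in>S. ?a i)"
      using that B by (auto simp: batch_grad_def sum_subtractf sum_constant_scaleR scaleR_diff_right)
    then show ?thesis
      by (simp add: power_divide)
  qed
  have "(\<Sum>S\<in>?P. (norm (batch_grad S x - full_grad x))\<^sup>2) / real (ncomp F choose B)
      = (\<Sum>S\<in>?P. (norm (\<Sum>i\<in>S. ?a i))\<^sup>2) / real (card {1..ncomp F} choose B) / (real B)\<^sup>2"
    using batch by (simp add: sum_divide_distrib mult.commute)
  also have "\<dots> \<le> real B / real (card {1..ncomp F}) * (\<Sum>i\<in>{1..ncomp F}. (norm (?a i))\<^sup>2) / (real B)\<^sup>2"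
    using B sum0 by (intro divide_right_mono sample_variance) auto
  also have "\<dots> \<le> real B / real (card {1..ncomp F}) * (?n * V) / (real B)\<^sup>2"
    using var by (intro divide_right_mono mult_left_mono) auto
  also have "\<dots> = V / real B"
    using n B by (simp add: power2_eq_square)
  finally show ?thesis .
qed

lemma finite_batches: "finite {S. S \<subseteq> {1..ncomp F} \<and> card S = B}"
  by (rule finite_subset[of _ "Pow {1..ncomp F}"]) auto

lemma batches_nonempty:
  assumes "B \<le> ncomp F"
  shows "{S. S \<subseteq> {1..ncomp F} \<and> card S = B} \<noteq> {}"
  using assms by (auto intro!: exI[of _ "{1..B}"])

lemma epochs_Suc:
  assumes "0 < B" "B \<le> ncomp F"
  shows "epochs F \<sigma> B p \<alpha> (Suc T) xh X =
    draw (pmf_of_set {S. S \<subseteq> {1..ncomp F} \<and> card S = B}) \<bind>\<^sub>c (\<lambda>S.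
     return_pmf (\<Sum>i\<leftarrow>sorted_list_of_set S. comp_grad F i xh, length (sorted_list_of_set S)) \<bind>\<^sub>c (\<lambda>s.
     sub_epochs F \<sigma> \<alpha> xh ((1 / real B) *\<^sub>R s) (B div p) p xh X \<bind>\<^sub>c (\<lambda>r.
     epochs F \<sigma> B p \<alpha> T (fst r) (snd r))))"
  by (simp add: sum_grads_eq case_prod_beta')

lemma finite_epochs:
  assumes B: "0 < B" "B \<le> ncomp F" "0 < B div p"
  shows "finite (set_pmf (epochs F \<sigma> B p \<alpha> T xh X))"
proof (induction T arbitrary: xh X)
  case (Suc T)
  show ?case
    unfolding epochs_Suc[OF B(1,2)]
    using finite_batches batches_nonempty[OF B(2)] Suc.IH finite_sub_epochs[OF B(3)]
    by (intro finite_bind_counted) (auto simp: set_draw)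
qed simp

lemma cexp_epochs_Suc:
  assumes B: "0 < B" "B \<le> ncomp F" "0 < B div p"
  shows "cexp (epochs F \<sigma> B p \<alpha> (Suc T) xh X) g =
    (\<Sum>S | S \<subseteq> {1..ncomp F} \<and> card S = B.
      cexp (sub_epochs F \<sigma> \<alpha> xh (batch_grad S xh) (B div p) p xh X)
        (\<lambda>r. cexp (epochs F \<sigma> B p \<alpha> T (fst r) (snd r)) g)) / real (ncomp F choose B)"
proof -
  let ?P = "{S. S \<subseteq> {1..ncomp F} \<and> card S = B}"
  note fin = finite_bind_counted finite_sub_epochs[OF B(3)] finite_epochs[OF B]
  have d: "finite (set_pmf (draw (pmf_of_set ?P)))"
    by (intro finite_draw_of_set finite_batches batches_nonempty B(2))
  have "cexp (epochs F \<sigma> B p \<alpha> (Suc T) xh X) g =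
    (\<Sum>S\<in>?P. cexp (sub_epochs F \<sigma> \<alpha> xh ((1 / real B) *\<^sub>R (\<Sum>i\<leftarrow>sorted_list_of_set S. comp_grad F i xh)) (B div p) p xh X)
        (\<lambda>r. cexp (epochs F \<sigma> B p \<alpha> T (fst r) (snd r)) g)) / real (card ?P)"
    unfolding epochs_Suc[OF B(1,2)]
    by (simp add: cexp_bind cexp_return_pmf fin d cexp_draw_of_set[OF finite_batches batches_nonempty[OF B(2)]] del: One_nat_def)
  also have "real (card ?P) = real (ncomp F choose B)"
    by (simp add: n_subsets)
  also have "(\<Sum>S\<in>?P. cexp (sub_epochs F \<sigma> \<alpha> xh ((1 / real B) *\<^sub>R (\<Sum>i\<leftarrow>sorted_list_of_set S. comp_grad F i xh)) (B div p) p xh X)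
        (\<lambda>r. cexp (epochs F \<sigma> B p \<alpha> T (fst r) (snd r)) g))
    = (\<Sum>S\<in>?P. cexp (sub_epochs F \<sigma> \<alpha> xh (batch_grad S xh) (B div p) p xh X)
        (\<lambda>r. cexp (epochs F \<sigma> B p \<alpha> T (fst r) (snd r)) g))"
  proof (rule sum.cong[OF refl])
    fix S assume "S \<in> ?P"
    then have "finite S" "card S = B"
      using finite_subset by auto
    then have "(1 / real B) *\<^sub>R (\<Sum>i\<leftarrow>sorted_list_of_set S. comp_grad F i xh) = batch_grad S xh"
      by (simp add: batch_grad_def sum_list_distinct_conv_sum_set)
    then show "cexp (sub_epochs F \<sigma> \<alpha> xh ((1 / real B) *\<^sub>R (\<Sum>i\<leftarrow>sorted_list_of_set S. comp_grad F i xh)) (B div p) p xh X)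
        (\<lambda>r. cexp (epochs F \<sigma> B p \<alpha> T (fst r) (snd r)) g)
      = cexp (sub_epochs F \<sigma> \<alpha> xh (batch_grad S xh) (B div p) p xh X)
        (\<lambda>r. cexp (epochs F \<sigma> B p \<alpha> T (fst r) (snd r)) g)"
      by simp
  qed
  finally show ?thesis .
qed

lemma epochs_outcome:
  assumes B: "0 < B" "B \<le> ncomp F" "0 < B div p" and \<alpha>: "0 < \<alpha>"
    and "xh \<in> effdom" "set X \<subseteq> effdom"
    and "((xh', X'), c) \<in> set_pmf (epochs F \<sigma> B p \<alpha> T xh X)"
  shows "xh' \<in> effdom \<and> set X' \<subseteq> effdom \<and> length X' = length X + T * p
    \<and> c = T * (B + p * (2 * (B div p)))"
  using assms(5-7)
proof (induction T arbitrary: xh X c)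
  case (Suc T)
  from Suc.prems(3) obtain S xh1 X1 c1 c2 where S: "S \<subseteq> {1..ncomp F}" "card S = B"
    and r: "((xh1, X1), c1) \<in> set_pmf (sub_epochs F \<sigma> \<alpha> xh
      ((1 / real B) *\<^sub>R (\<Sum>i\<leftarrow>sorted_list_of_set S. comp_grad F i xh)) (B div p) p xh X)"
    and r': "((xh', X'), c2) \<in> set_pmf (epochs F \<sigma> B p \<alpha> T xh1 X1)"
    and c: "c = B + (c1 + c2)"
    unfolding epochs_Suc[OF B(1,2)] in_set_bind_counted set_draw
      set_pmf_of_set[OF batches_nonempty[OF B(2)] finite_batches]
    by auto
  have fin: "finite S"
    using S finite_subset by blast
  have "(1 / real B) *\<^sub>R (\<Sum>i\<leftarrow>sorted_list_of_set S. comp_grad F i xh) \<in> space_of F"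
    using batch_grad_space[OF S(1), of xh] S fin Suc.prems(1)
    by (simp add: batch_grad_def sum_list_distinct_conv_sum_set)
  from sub_epochs_outcome[OF B(3) \<alpha> _ this Suc.prems(1,2) r] Suc.prems(1)
  have *: "xh1 \<in> effdom \<and> set X1 \<subseteq> effdom \<and> length X1 = length X + p \<and> c1 = p * (2 * (B div p))"
    by simp
  with Suc.IH[OF _ _ r'] show ?case
    by (simp add: c)
qed simp

text \<open>An epoch starts at its own snapshot, so the drift term is zero there. One batch error is
  shared by all p sub-epochs, each of which charges its square over \<sigma>; averaging over the
  batch gives V / B.\<close>

lemma epochs_descent:
  assumes V: "variance_le F V" and B: "0 < B" "B \<le> ncomp F"
    and \<alpha>: "0 < \<alpha>" "\<alpha> * (6 * L) \<le> 1" "4 \<le> \<alpha> * real (B div p) * \<sigma>" and m: "4 \<le> B div p"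
    and p: "0 < p" "4 * (\<alpha> * L\<^sup>2) * (real p)\<^sup>2 \<le> \<sigma>"
    and xh: "xh \<in> effdom" "set X \<subseteq> effdom"
  shows "cexp (epochs F \<sigma> B p \<alpha> T xh X) (\<lambda>(y, Y). obj y + \<sigma> / 4 * (\<Sum>x\<leftarrow>Y. gap x))
    \<le> obj xh + \<sigma> / 4 * (\<Sum>x\<leftarrow>X. gap x) + real T * (real p * (V / real B / \<sigma>))"
  using xh
proof (induction T arbitrary: xh X)
  case (Suc T)
  let ?P = "{S. S \<subseteq> {1..ncomp F} \<and> card S = B}"
  let ?C = "real T * (real p * (V / real B / \<sigma>))" and ?N = "real (ncomp F choose B)"
  let ?R = "obj xh + \<sigma> / 4 * (\<Sum>x\<leftarrow>X. gap x) + ?C"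
  have m0: "0 < B div p"
    using m by simp
  have N: "0 < ?N" "real (card ?P) = ?N"
    using B by (auto simp: n_subsets)
  have "cexp (epochs F \<sigma> B p \<alpha> (Suc T) xh X) (\<lambda>(y, Y). obj y + \<sigma> / 4 * (\<Sum>x\<leftarrow>Y. gap x))
    \<le> (\<Sum>S\<in>?P. real p * ((norm (batch_grad S xh - full_grad xh))\<^sup>2 / \<sigma>) + ?R) / ?N"
    unfolding cexp_epochs_Suc[OF B m0]
  proof (intro divide_right_mono sum_mono)
    fix S assume S: "S \<in> ?P"
    let ?s = "sub_epochs F \<sigma> \<alpha> xh (batch_grad S xh) (B div p) p xh X"
    have bs: "batch_grad S xh \<in> space_of F"
      using S Suc.prems by (intro batch_grad_space) auto
    have "cexp ?s (\<lambda>r. cexp (epochs F \<sigma> B p \<alpha> T (fst r) (snd r))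
        (\<lambda>(y, Y). obj y + \<sigma> / 4 * (\<Sum>x\<leftarrow>Y. gap x)))
      \<le> cexp ?s (\<lambda>r. (case r of (y, Y) \<Rightarrow> obj y + \<sigma> / 4 * (\<Sum>x\<leftarrow>Y. gap x)) + ?C)"
    proof (rule cexp_mono[OF finite_sub_epochs[OF m0]])
      fix r c assume r: "(r, c) \<in> set_pmf ?s"
      obtain y Y where yY: "r = (y, Y)"
        by (cases r)
      have "y \<in> effdom" "set Y \<subseteq> effdom"
        using sub_epochs_outcome[OF m0 \<alpha>(1) _ bs Suc.prems] r Suc.prems(1) unfolding yY by blast+
      from Suc.IH[OF this] show "cexp (epochs F \<sigma> B p \<alpha> T (fst r) (snd r))
        (\<lambda>(y, Y). obj y + \<sigma> / 4 * (\<Sum>x\<leftarrow>Y. gap x))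
        \<le> (case r of (y, Y) \<Rightarrow> obj y + \<sigma> / 4 * (\<Sum>x\<leftarrow>Y. gap x)) + ?C"
        by (simp add: yY)
    qed
    also have "\<dots> = cexp ?s (\<lambda>(y, Y). obj y + \<sigma> / 4 * (\<Sum>x\<leftarrow>Y. gap x)) + ?C"
      by (simp only: cexp_add[OF finite_sub_epochs[OF m0]] cexp_const)
    also have "\<dots> \<le> real p * ((norm (batch_grad S xh - full_grad xh))\<^sup>2 / \<sigma>) + ?R"
      using sub_epochs_descent[OF \<alpha> m p effdom_space[OF Suc.prems(1)] bs refl Suc.prems(1) order_refl, of X]
      by simp
    finally show "cexp ?s (\<lambda>r. cexp (epochs F \<sigma> B p \<alpha> T (fst r) (snd r))
        (\<lambda>(y, Y). obj y + \<sigma> / 4 * (\<Sum>x\<leftarrow>Y. gap x)))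
      \<le> real p * ((norm (batch_grad S xh - full_grad xh))\<^sup>2 / \<sigma>) + ?R" .
  qed simp
  also have "\<dots> = real p / \<sigma> * ((\<Sum>S\<in>?P. (norm (batch_grad S xh - full_grad xh))\<^sup>2) / ?N) + ?R"
  proof -
    have "(\<Sum>S\<in>?P. real p * ((norm (batch_grad S xh - full_grad xh))\<^sup>2 / \<sigma>) + ?R)
        = real p / \<sigma> * (\<Sum>S\<in>?P. (norm (batch_grad S xh - full_grad xh))\<^sup>2) + ?N * ?R"
      unfolding sum_add_const N(2)
      by (simp add: sum_distrib_left)
    then show ?thesis
      using N(1) by (simp only: add_divide_distrib nonzero_mult_div_cancel_left less_imp_neq[symmetric] not_False_eq_True times_divide_eq_right)
  qed
  also have "\<dots> \<le> real p / \<sigma> * (V / real B) + ?R"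
    using batch_variance[OF V Suc.prems(1) B] sigma_pos by (intro add_right_mono mult_left_mono) auto
  also have "\<dots> = obj xh + \<sigma> / 4 * (\<Sum>x\<leftarrow>X. gap x) + real (Suc T) * (real p * (V / real B / \<sigma>))"
    by (simp add: distrib_right add_divide_distrib)
  finally show ?case .
qed simp

section \<open>The uniformly chosen recorded centre\<close>

lemma natasha15_full_outcome:
  assumes B: "0 < B" "B \<le> ncomp F" "0 < B div p" and p: "0 < p" and T: "0 < T" and \<alpha>: "0 < \<alpha>"
    and x0: "x0 \<in> effdom"
    and r: "((y, y'), c) \<in> set_pmf (natasha15_full F \<sigma> x0 B p T \<alpha>)"
  shows "y \<in> effdom \<and> c = T * (B + p * (2 * (B div p)))"
proof -
  obtain X j where X: "((y', X), c) \<in> set_pmf (epochs F \<sigma> B p \<alpha> T x0 [])"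
    and j: "j \<in> set_pmf (pmf_of_set {..<length X})" "y = X ! j"
    using r unfolding natasha15_full_def by (auto simp: in_set_bind_counted set_draw)
  have *: "set X \<subseteq> effdom \<and> length X = T * p \<and> c = T * (B + p * (2 * (B div p)))"
    using epochs_outcome[OF B \<alpha> x0 _ X] by simp
  then have "{..<length X} \<noteq> {}"
    using T p by (auto simp: lessThan_empty_iff)
  then have "j < length X"
    using j(1) by (simp add: set_pmf_of_set)
  then show ?thesis
    using * j(2) nth_mem by blast
qed

lemma finite_natasha15_full:
  assumes B: "0 < B" "B \<le> ncomp F" "0 < B div p" and p: "0 < p" and T: "0 < T" and \<alpha>: "0 < \<alpha>"
    and x0: "x0 \<in> effdom"
  shows "finite (set_pmf (natasha15_full F \<sigma> x0 B p T \<alpha>))"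
  unfolding natasha15_full_def case_prod_beta
proof (intro finite_bind_counted finite_epochs[OF B])
  fix r c assume "(r, c) \<in> set_pmf (epochs F \<sigma> B p \<alpha> T x0 [])"
  then have "length (snd r) = T * p"
    using epochs_outcome[OF B \<alpha> x0, of "[]" "fst r" "snd r"] by simp
  then have "{..<length (snd r)} \<noteq> {}"
    using T p by (auto simp: lessThan_empty_iff)
  then show "finite (set_pmf (draw (pmf_of_set {..<length (snd r)})))"
    by (simp add: set_draw)
qed simp

text \<open>Exactly T p centres are recorded on every run, so the expected gap of a uniform one is
  the expected sum of gaps divided by T p. The factor \<sigma>^2 gives it the units of a squared
  gradient.\<close>

lemma natasha15_full_gap:
  assumes V: "variance_le F V" and B: "0 < B" "B \<le> ncomp F"
    and \<alpha>: "0 < \<alpha>" "\<alpha> * (6 * L) \<le> 1" "4 \<le> \<alpha> * real (B div p) * \<sigma>" and m: "4 \<le> B div p"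
    and p: "0 < p" "4 * (\<alpha> * L\<^sup>2) * (real p)\<^sup>2 \<le> \<sigma>" and T: "0 < T"
    and x0: "x0 \<in> effdom" and \<Delta>: "\<And>x. x \<in> effdom \<Longrightarrow> obj x0 - \<Delta> \<le> obj x"
  shows "\<sigma>\<^sup>2 * cexp (natasha15_full F \<sigma> x0 B p T \<alpha>) (\<lambda>(y, y'). gap y)
    \<le> 4 * \<sigma> * \<Delta> / (real T * real p) + 4 * V / real B"
proof -
  let ?E = "epochs F \<sigma> B p \<alpha> T x0 []" and ?l = "real (T * p)"
  have m0: "0 < B div p"
    using m by simp
  note fin = finite_epochs[OF B m0, of \<alpha> T x0 "[]"]
  have l: "0 < ?l"
    using T p by simp
  have out: "fst r \<in> effdom \<and> length (snd r) = T * p" if "(r, c) \<in> set_pmf ?E" for r c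
    using epochs_outcome[OF B m0 \<alpha>(1) x0, of "[]" "fst r" "snd r"] that by simp
  have "cexp (natasha15_full F \<sigma> x0 B p T \<alpha>) (\<lambda>(y, y'). gap y)
      = cexp ?E (\<lambda>r. (\<Sum>x\<leftarrow>snd r. gap x) / ?l)"
    unfolding natasha15_full_def case_prod_beta
  proof (subst cexp_bind[OF fin])
    fix r c assume "(r, c) \<in> set_pmf ?E"
    with out have "{..<length (snd r)} \<noteq> {}"
      using T p by (auto simp: lessThan_empty_iff)
    then show "finite (set_pmf (draw (pmf_of_set {..<length (snd r)}) \<bind>\<^sub>c (\<lambda>j. ret (snd r ! j, fst r))))"
      by (intro finite_bind_counted) (auto simp: set_draw)
  next
    show "cexp ?E (\<lambda>r. cexp (draw (pmf_of_set {..<length (snd r)}) \<bind>\<^sub>c (\<lambda>j. ret (snd r ! j, fst r))) (\<lambda>q. gap (fst q)))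
      = cexp ?E (\<lambda>r. (\<Sum>x\<leftarrow>snd r. gap x) / ?l)"
    proof (rule cexp_cong[OF fin])
      fix r c assume "(r, c) \<in> set_pmf ?E"
      with out have len: "length (snd r) = T * p"
        by blast
      then have ne: "{..<length (snd r)} \<noteq> {}"
        using T p by (auto simp: lessThan_empty_iff)
      then have d: "finite (set_pmf (draw (pmf_of_set {..<length (snd r)})))"
        by (simp add: set_draw)
      show "cexp (draw (pmf_of_set {..<length (snd r)}) \<bind>\<^sub>c (\<lambda>j. ret (snd r ! j, fst r))) (\<lambda>q. gap (fst q))
        = (\<Sum>x\<leftarrow>snd r. gap x) / ?l"
        unfolding cexp_bind_ret[OF d] cexp_draw_of_set[OF finite_lessThan ne]
        by (simp add: sum_list_sum_nth len atLeast0LessThan)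
    qed
  qed
  also have "\<dots> = cexp ?E (\<lambda>r. \<Sum>x\<leftarrow>snd r. gap x) / ?l"
    using cexp_cmult[of ?E "1 / ?l"] by simp
  finally have E: "cexp (natasha15_full F \<sigma> x0 B p T \<alpha>) (\<lambda>(y, y'). gap y)
      = cexp ?E (\<lambda>r. \<Sum>x\<leftarrow>snd r. gap x) / ?l" .
  have "obj x0 - \<Delta> + \<sigma> / 4 * cexp ?E (\<lambda>r. \<Sum>x\<leftarrow>snd r. gap x)
      = cexp ?E (\<lambda>r. (obj x0 - \<Delta>) + \<sigma> / 4 * (\<Sum>x\<leftarrow>snd r. gap x))"
    by (simp only: cexp_add[OF fin] cexp_const cexp_cmult)
  \<comment> \<open>The objective value at the final centre is bounded below through
    \<Delta>.\<close>
  also have "\<dots> \<le> cexp ?E (\<lambda>(y, Y). obj y + \<sigma> / 4 * (\<Sum>x\<leftarrow>Y. gap x))"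
    using out \<Delta> by (intro cexp_mono[OF fin]) (auto simp: case_prod_beta)
  also have "\<dots> \<le> obj x0 + real T * (real p * (V / real B / \<sigma>))"
    using epochs_descent[OF V B \<alpha> m p x0, of "[]" T] by simp
  finally have "cexp ?E (\<lambda>r. \<Sum>x\<leftarrow>snd r. gap x) \<le> 4 / \<sigma> * (\<Delta> + real T * (real p * (V / real B / \<sigma>)))"
    using sigma_pos by (simp add: field_simps)
  then have "\<sigma>\<^sup>2 * (cexp ?E (\<lambda>r. \<Sum>x\<leftarrow>snd r. gap x) / ?l)
      \<le> \<sigma>\<^sup>2 * (4 / \<sigma> * (\<Delta> + real T * (real p * (V / real B / \<sigma>))) / ?l)"
    using l by (intro mult_left_mono divide_right_mono) auto
  also have "\<dots> = 4 * \<sigma> * \<Delta> / (real T * real p) + 4 * V / real B"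
    using sigma_pos T p B by (simp add: field_simps power2_eq_square)
  finally show ?thesis
    unfolding E .
qed

section \<open>Pruning\<close>

lemma regularised_simps [simp]:
  "dimen (regularised F \<sigma> y) = dimen F" "ncomp (regularised F \<sigma> y) = ncomp F"
  "psi (regularised F \<sigma> y) = psi F" "space_of (regularised F \<sigma> y) = space_of F"
  "component (regularised F \<sigma> y) i = (\<lambda>x. component F i x + \<sigma> * (norm (x - y))\<^sup>2)"
  by (simp_all add: regularised_def space_of_def)

lemma prox_step_regularised [simp]: "prox_step (regularised F \<sigma> y) = prox_step F"
  by (simp add: prox_step_def[abs_def] prox_objective_def[abs_def])

lemma prox_objective_regularised [simp]: "prox_objective (regularised F \<sigma> y) = prox_objective F"
  by (simp add: prox_objective_def[abs_def])

lemma smooth_part_regularised: "smooth_part (regularised F \<sigma> y) = reg y"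
  using ncomp_pos by (auto simp: smooth_part_def reg_def sum.distrib field_simps)

lemma grad_regularised:
  assumes "y \<in> space_of F" "x \<in> space_of F"
  shows "grad (dimen F) (reg y) x = reg_grad y x"
  using add_square_gradient(1)[OF smooth_part_diff, of y x \<sigma>] assms
  by (simp add: reg_def[abs_def] reg_grad_def full_grad_def space_of_def)

lemma comp_grad_regularised:
  assumes "y \<in> space_of F" "x \<in> space_of F" "i \<in> {1..ncomp F}"
  shows "comp_grad (regularised F \<sigma> y) i x = comp_grad F i x + (2 * \<sigma>) *\<^sub>R (x - y)"
  using add_square_gradient(1)[OF component_diff, of i y x \<sigma>] assms
  by (simp add: comp_grad_def space_of_def)

lemma differentiable_add_square:
  assumes "g differentiable_on Rd (dimen F)" "y \<in> space_of F"
  shows "(\<lambda>x. g x + \<sigma> * (norm (x - y))\<^sup>2) differentiable_on Rd (dimen F)"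
  using add_square_gradient(2)[OF assms(1)] assms(2)
  unfolding differentiable_on_def differentiable_def space_of_def by blast

lemma composite_regularised:
  assumes "y \<in> space_of F"
  shows "composite_problem (regularised F \<sigma> y)"
  using composite differentiable_add_square[OF component_diff assms]
  by (simp add: composite_problem_def space_of_def)

text \<open>Every component receives the same quadratic, so its gradient cancels in the deviation
  from the mean gradient.\<close>

lemma variance_regularised:
  assumes y: "y \<in> space_of F" and V: "variance_le F V"
  shows "variance_le (regularised F \<sigma> y) V"
  unfolding variance_le_def
proof (intro ballI impI)
  fix x assume x: "x \<in> space_of (regularised F \<sigma> y)" "psi (regularised F \<sigma> y) x < \<infinity>"
  then have xs: "x \<in> space_of F"
    by simp
  have "measure_pmf.expectation (pmf_of_set {1..ncomp (regularised F \<sigma> y)})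
      (\<lambda>i. (norm (grad (dimen (regularised F \<sigma> y)) (smooth_part (regularised F \<sigma> y)) x
        - comp_grad (regularised F \<sigma> y) i x))\<^sup>2)
    = measure_pmf.expectation (pmf_of_set {1..ncomp F})
      (\<lambda>i. (norm (grad (dimen F) (smooth_part F) x - comp_grad F i x))\<^sup>2)"
    using ncomp_pos y xs
    by (simp add: integral_pmf_of_set smooth_part_regularised grad_regularised comp_grad_regularised
        reg_grad_def full_grad_def)
  also have "\<dots> \<le> V"
    using V x by (simp add: variance_le_def)
  finally show "measure_pmf.expectation (pmf_of_set {1..ncomp (regularised F \<sigma> y)})
      (\<lambda>i. (norm (grad (dimen (regularised F \<sigma> y)) (smooth_part (regularised F \<sigma> y)) x
        - comp_grad (regularised F \<sigma> y) i x))\<^sup>2) \<le> V" .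
qed

lemma smooth_regularised:
  assumes "y \<in> space_of F"
  shows "smooth (dimen F) (3 * L) (reg y)"
proof -
  have "reg y = (\<lambda>x. smooth_part F x + \<sigma> * (norm (x - y))\<^sup>2)"
    by (simp add: reg_def fun_eq_iff)
  then have "reg y differentiable_on Rd (dimen F)"
    using differentiable_add_square[OF smooth_part_diff assms] by simp
  then show ?thesis
    using reg_grad_lipschitz grad_regularised[OF assms] by (simp add: smooth_def space_of_def)
qed

text \<open>The first-order bound is taken at the intermediate point towards both ends. With weights
  1 - t and t the gradient terms cancel and the quadratic terms add up to t (1 - t).\<close>

lemma reg_convexity:
  assumes x: "x \<in> space_of F" and y: "y \<in> space_of F" and t: "0 \<le> t" "t \<le> 1"
  shows "reg c ((1 - t) *\<^sub>R x + t *\<^sub>R y) + \<sigma> / 2 * t * (1 - t) * (norm (x - y))\<^sup>2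
    \<le> (1 - t) * reg c x + t * reg c y"
proof -
  let ?z = "(1 - t) *\<^sub>R x + t *\<^sub>R y" and ?N = "(norm (x - y))\<^sup>2"
  let ?i = "inner (reg_grad c ?z) (x - y)"
  have combine: "(1 - t) * (r + t * i + \<sigma> / 2 * (t\<^sup>2 * n)) + t * (r + (t - 1) * i + \<sigma> / 2 * ((t - 1)\<^sup>2 * n))
      = r + \<sigma> / 2 * t * (1 - t) * n" for r i n :: real
    by (simp add: field_simps power2_eq_square)
  have z: "?z \<in> space_of F"
    using x y by simp
  have dx: "x - ?z = t *\<^sub>R (x - y)" and dy: "y - ?z = (t - 1) *\<^sub>R (x - y)"
    by (simp_all add: algebra_simps)
  have "reg c ?z + t * ?i + \<sigma> / 2 * (t\<^sup>2 * ?N) \<le> reg c x"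
    using reg_lower[OF z x, of c] unfolding dx by (simp add: power_mult_distrib)
  then have X: "(1 - t) * (reg c ?z + t * ?i + \<sigma> / 2 * (t\<^sup>2 * ?N)) \<le> (1 - t) * reg c x"
    using t by (intro mult_left_mono) auto
  have "reg c ?z + (t - 1) * ?i + \<sigma> / 2 * ((t - 1)\<^sup>2 * ?N) \<le> reg c y"
    using reg_lower[OF z y, of c] unfolding dy by (simp add: power_mult_distrib)
  then have Y: "t * (reg c ?z + (t - 1) * ?i + \<sigma> / 2 * ((t - 1)\<^sup>2 * ?N)) \<le> t * reg c y"
    using t by (intro mult_left_mono) auto
  have "(1 - t) * (reg c ?z + t * ?i + \<sigma> / 2 * (t\<^sup>2 * ?N))
      + t * (reg c ?z + (t - 1) * ?i + \<sigma> / 2 * ((t - 1)\<^sup>2 * ?N))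
      = reg c ?z + \<sigma> / 2 * t * (1 - t) * ?N"
    by (rule combine)
  then show ?thesis
    using X Y by linarith
qed

lemma convex_on_reg: "convex_on (space_of F) (reg c)"
proof (rule convex_onI)
  show "convex (space_of F)"
    unfolding space_of_def by (rule subspace_imp_convex[OF subspace_Rd])
next
  fix t :: real and x y :: fvec
  assume t: "0 < t" "t < 1" and xy: "x \<in> space_of F" "y \<in> space_of F"
  have "0 \<le> \<sigma> / 2 * t * (1 - t) * (norm (x - y))\<^sup>2"
    using t sigma_pos by simp
  then show "reg c ((1 - t) *\<^sub>R x + t *\<^sub>R y) \<le> (1 - t) * reg c x + t * reg c y"
    using reg_convexity[OF xy, of t c] t by simp
qed

lemma psi_not_MInf: "x \<in> space_of F \<Longrightarrow> psi F x \<noteq> -\<infinity>"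
  using composite by (simp add: composite_problem_def proper_convex_def space_of_def)

lemma objective_regularised: "objective (regularised F \<sigma> y) x = psi F x + ereal (reg y x)"
  by (simp add: objective_def smooth_part_regularised)

lemma strongly_convex_regularised:
  assumes "y \<in> space_of F"
  shows "strongly_convex (dimen F) \<sigma> (objective (regularised F \<sigma> y))"
  unfolding strongly_convex_def
proof (intro ballI allI impI)
  fix u v :: fvec and t :: real
  assume "u \<in> Rd (dimen F)" "v \<in> Rd (dimen F)" and t: "0 < t \<and> t < 1"
  then have u: "u \<in> space_of F" and v: "v \<in> space_of F"
    by (simp_all add: space_of_def)
  let ?H = "objective (regularised F \<sigma> y)" and ?z = "(1 - t) *\<^sub>R u + t *\<^sub>R v"
  show "?H ?z + ereal (\<sigma> / 2 * t * (1 - t) * (norm (u - v))\<^sup>2) \<le> ereal (1 - t) * ?H u + ereal t * ?H v"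
  proof (cases "u \<in> effdom \<and> v \<in> effdom")
    case True
    have z: "?z \<in> effdom" and le: "psi_real ?z \<le> (1 - t) * psi_real u + t * psi_real v"
      using psi_convex[of u v t] True t by auto
    show ?thesis
      using reg_convexity[OF u v, of t y] le t True
      by (simp add: objective_regularised psi_eq z) (simp add: algebra_simps)
  next
    case False
    then have "psi F u = \<infinity> \<or> psi F v = \<infinity>"
      using u v unfolding effdom_def by auto
    \<comment> \<open>Both coefficients are positive and no summand is -\<infinity>, so a single
      infinite value decides.\<close>
    then have "ereal (1 - t) * ?H u + ereal t * ?H v = \<infinity>"
      using psi_not_MInf[OF u] psi_not_MInf[OF v] t
      by (cases "psi F u"; cases "psi F v") (auto simp: objective_regularised)
    then show ?thesis
      by (simp only: ereal_less_eq)
  qed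
qed

lemma is_arg_min_regularised:
  assumes c: "c \<in> space_of F"
  shows "is_arg_min (objective (regularised F \<sigma> c)) (\<lambda>x. x \<in> space_of F) (centre_min c)"
  unfolding is_arg_min_def
proof (intro conjI notI)
  show "centre_min c \<in> space_of F"
    using centre_min_effdom[OF c] by simp
  assume "\<exists>u. u \<in> space_of F \<and>
    objective (regularised F \<sigma> c) u < objective (regularised F \<sigma> c) (centre_min c)"
  then obtain u where u: "u \<in> space_of F"
    and less: "objective (regularised F \<sigma> c) u < objective (regularised F \<sigma> c) (centre_min c)"
    by blast
  then have "psi F u < \<infinity>"
    by (auto simp: objective_regularised)
  then have ue: "u \<in> effdom"
    using u unfolding effdom_def by simp
  have "0 \<le> \<sigma> / 2 * (norm (u - centre_min c))\<^sup>2"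
    using sigma_pos by simp
  then have "reg_obj c (centre_min c) \<le> reg_obj c u"
    using centre_min_optimal[OF c ue] by simp
  then show False
    using less centre_min_effdom[OF c] ue by (simp add: objective_regularised psi_eq reg_obj_def)
qed

section \<open>Gradient mappings of the objective and of its regularisation\<close>

lemma grad_mapping_eq:
  "grad_mapping F \<eta> x = (1 / \<eta>) *\<^sub>R (x - prox_step F \<eta> (full_grad x) x)"
  by (simp add: grad_mapping_def full_grad_def)

lemma grad_mapping_regularised:
  assumes "y \<in> space_of F" "x \<in> space_of F"
  shows "grad_mapping (regularised F \<sigma> y) \<eta> x = (1 / \<eta>) *\<^sub>R (x - prox_step F \<eta> (reg_grad y x) x)"
  using grad_regularised[OF assms] by (simp add: grad_mapping_def smooth_part_regularised)

text \<open>Bridges the step C / (3 L) of the subroutine and the step C / L of the claim. The sum of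
  the two optimality conditions, with Cauchy-Schwarz, factors into \<open>(norm g2 - norm g1) *
  (\<eta>2 * norm g2 - \<eta>1 * norm g1) \<le> 0\<close>; if g2 were longer, both factors would be
  positive.\<close>

lemma grad_mapping_antimono:
  assumes \<eta>: "0 < \<eta>1" "\<eta>1 \<le> \<eta>2" and x: "x \<in> space_of F"
  shows "norm (grad_mapping F \<eta>2 x) \<le> norm (grad_mapping F \<eta>1 x)"
proof -
  let ?v = "full_grad x"
  define z1 z2 where "z1 = prox_step F \<eta>1 ?v x" and "z2 = prox_step F \<eta>2 ?v x"
  define g1 g2 where "g1 = grad_mapping F \<eta>1 x" and "g2 = grad_mapping F \<eta>2 x"
  have \<eta>2: "0 < \<eta>2"
    using \<eta> by simp
  have v: "?v \<in> space_of F"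
    using x by simp
  have zd: "z1 \<in> effdom" "z2 \<in> effdom"
    unfolding z1_def z2_def using \<eta> \<eta>2 v x by (auto intro: prox_minimal(1))
  have z1: "z1 = x - \<eta>1 *\<^sub>R g1" and z2: "z2 = x - \<eta>2 *\<^sub>R g2"
    unfolding g1_def g2_def grad_mapping_eq z1_def z2_def using \<eta> \<eta>2 by simp_all
  have i1: "(1 / \<eta>1) * inner (z1 - x) (z2 - z1) = - inner g1 (z2 - z1)"
    using \<eta> by (subst z1) simp
  have i2: "(1 / \<eta>2) * inner (z2 - x) (z1 - z2) = - inner g2 (z1 - z2)"
    using \<eta>2 by (subst z2) simp
  have "0 \<le> inner (g1 - g2) (z1 - z2)"
    using prox_ineq[OF \<eta>(1) v x zd(2) z1_def] prox_ineq[OF \<eta>2 v x zd(1) z2_def]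
    unfolding i1 i2 by (simp add: inner_diff_left inner_diff_right)
  then have "\<eta>1 * (norm g1)\<^sup>2 + \<eta>2 * (norm g2)\<^sup>2 \<le> (\<eta>1 + \<eta>2) * inner g1 g2"
    unfolding z1 z2 power2_norm_eq_inner
    by (simp add: inner_diff_left inner_diff_right inner_commute algebra_simps)
  also have "\<dots> \<le> (\<eta>1 + \<eta>2) * (norm g1 * norm g2)"
    using \<eta> norm_cauchy_schwarz by (intro mult_left_mono) auto
  finally have le: "(norm g2 - norm g1) * (\<eta>2 * norm g2 - \<eta>1 * norm g1) \<le> 0"
    by (simp add: power2_eq_square algebra_simps)
  show ?thesis
  proof (rule ccontr)
    assume "\<not> ?thesis"
    then have less: "norm g1 < norm g2"
      by (simp add: g1_def g2_def)
    then have "\<eta>1 * norm g1 < \<eta>1 * norm g2" "\<eta>1 * norm g2 \<le> \<eta>2 * norm g2"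
      using \<eta> by (auto intro: mult_right_mono)
    then have "0 < (norm g2 - norm g1) * (\<eta>2 * norm g2 - \<eta>1 * norm g1)"
      using less by simp
    then show False
      using le by simp
  qed
qed

text \<open>The point x may have infinite \<open>psi\<close>, so the argument runs through its
  proximal point z. Strong monotonicity between z and the minimiser gives 2 times the norm of the
  gradient mapping, and the move from x to z, of length \<eta> times that norm, adds 1.\<close>

lemma reg_error_bound:
  assumes c: "c \<in> space_of F" and x: "x \<in> space_of F" and \<eta>: "0 < \<eta>" "3 * L * \<eta> \<le> 1"
  shows "\<sigma> * norm (x - centre_min c) \<le> 3 * norm (grad_mapping (regularised F \<sigma> c) \<eta> x)"
proof -
  let ?u = "centre_min c" and ?v = "reg_grad c x"
  define z where "z = prox_step F \<eta> ?v x"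
  define g where "g = grad_mapping (regularised F \<sigma> c) \<eta> x"
  have v: "?v \<in> space_of F"
    using x c by simp
  have zd: "z \<in> effdom"
    unfolding z_def using \<eta> v x by (intro prox_minimal(1))
  have ud: "?u \<in> effdom"
    by (rule centre_min_effdom[OF c])
  have z: "z - x = - (\<eta> *\<^sub>R g)"
    unfolding g_def grad_mapping_regularised[OF c x] z_def using \<eta> by simp
  have "inner ?v (z - ?u) + inner (reg_grad c ?u) (?u - z) \<le> (1 / \<eta>) * inner (z - x) (?u - z)"
    using prox_ineq[OF \<eta>(1) v x ud z_def] centre_min_stationary[OF c zd] by simp
  also have "\<dots> = - inner g (?u - z)"
    unfolding z using \<eta> by simp
  also have "\<dots> = inner g (z - ?u)"
    by (simp add: inner_diff_right)
  finally have "inner (reg_grad c z - reg_grad c ?u) (z - ?u) \<le> inner g (z - ?u) + inner (reg_grad c z - ?v) (z - ?u)"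
    by (simp add: inner_diff_left inner_diff_right)
  also have "\<dots> = inner (g + (reg_grad c z - ?v)) (z - ?u)"
    by (simp add: inner_add_left)
  also have "\<dots> \<le> norm (g + (reg_grad c z - ?v)) * norm (z - ?u)"
    by (rule norm_cauchy_schwarz)
  also have "\<dots> \<le> (2 * norm g) * norm (z - ?u)"
  proof (rule mult_right_mono)
    have "norm (reg_grad c z - ?v) \<le> 3 * L * norm (z - x)"
      using zd x by (intro reg_grad_lipschitz) auto
    also have "\<dots> = 3 * L * \<eta> * norm g"
      unfolding z using \<eta> by simp
    also have "\<dots> \<le> 1 * norm g"
      using \<eta> by (intro mult_right_mono) auto
    finally show "norm (g + (reg_grad c z - ?v)) \<le> 2 * norm g"
      using norm_triangle_ineq[of g "reg_grad c z - ?v"] by simp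
  qed simp
  finally have "(\<sigma> * norm (z - ?u)) * norm (z - ?u) \<le> (2 * norm g) * norm (z - ?u)"
    using reg_grad_monotone[OF effdom_space[OF zd] effdom_space[OF ud], of c]
    by (simp add: power2_eq_square)
  then have "\<sigma> * norm (z - ?u) \<le> 2 * norm g"
    by (cases "norm (z - ?u) = 0") (auto simp: mult_le_cancel_right)
  moreover have "\<sigma> * norm (x - z) \<le> norm g"
  proof -
    have "\<sigma> * \<eta> \<le> L * \<eta>" "0 < L * \<eta>"
      using sigma_le \<eta> L_pos by auto
    then have "\<sigma> * \<eta> \<le> 1"
      using \<eta>(2) by linarith
    then have "(\<sigma> * \<eta>) * norm g \<le> 1 * norm g"
      by (rule mult_right_mono) simp
    moreover have "norm (x - z) = \<eta> * norm g"
      using z \<eta> by (simp add: norm_minus_commute[of x z])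
    ultimately show ?thesis
      by simp
  qed
  moreover have "\<sigma> * norm (x - ?u) \<le> \<sigma> * (norm (x - z) + norm (z - ?u))"
    using norm_triangle_ineq[of "x - z" "z - ?u"] sigma_pos by (intro mult_left_mono) auto
  ultimately show ?thesis
    unfolding g_def[symmetric] by (simp add: distrib_left)
qed

text \<open>Nonexpansiveness bounds the change of the mapping by 2 \<sigma> times the distance from
  x to c. Passing through the minimiser, the error bound contributes 2 times 3, hence 7 in
  total.\<close>

lemma grad_mapping_prune:
  assumes c: "c \<in> space_of F" and x: "x \<in> space_of F"
    and \<eta>: "0 < \<eta>" "3 * L * \<eta> \<le> 1" "\<eta> \<le> \<eta>'"
  shows "norm (grad_mapping F \<eta>' x)
    \<le> 7 * norm (grad_mapping (regularised F \<sigma> c) \<eta> x) + 2 * (\<sigma> * sqrt (gap c))"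
proof -
  let ?G = "grad_mapping (regularised F \<sigma> c) \<eta> x"
  have "grad_mapping F \<eta> x - ?G =
      (1 / \<eta>) *\<^sub>R (prox_step F \<eta> (reg_grad c x) x - prox_step F \<eta> (full_grad x) x)"
    unfolding grad_mapping_eq grad_mapping_regularised[OF c x] by (simp add: algebra_simps)
  then have "norm (grad_mapping F \<eta> x - ?G)
      = (1 / \<eta>) * norm (prox_step F \<eta> (reg_grad c x) x - prox_step F \<eta> (full_grad x) x)"
    using \<eta> by simp
  also have "\<dots> \<le> (1 / \<eta>) * norm ((x - \<eta> *\<^sub>R reg_grad c x) - (x - \<eta> *\<^sub>R full_grad x))"
    using \<eta> c x by (intro mult_left_mono prox_nonexpansive) auto
  also have "(x - \<eta> *\<^sub>R reg_grad c x) - (x - \<eta> *\<^sub>R full_grad x) = - (\<eta> *\<^sub>R ((2 * \<sigma>) *\<^sub>R (x - c)))"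
    by (simp add: reg_grad_def algebra_simps)
  also have "(1 / \<eta>) * norm (- (\<eta> *\<^sub>R ((2 * \<sigma>) *\<^sub>R (x - c)))) = 2 * \<sigma> * norm (x - c)"
    using \<eta> sigma_pos by simp
  finally have "norm (grad_mapping F \<eta> x) \<le> norm ?G + 2 * \<sigma> * norm (x - c)"
    using norm_triangle_ineq[of "grad_mapping F \<eta> x - ?G" ?G] by simp
  also have "2 * \<sigma> * norm (x - c) \<le> 2 * \<sigma> * (norm (x - centre_min c) + norm (c - centre_min c))"
    using norm_triangle_ineq4[of "x - centre_min c" "c - centre_min c"] sigma_pos
    by (intro mult_left_mono) auto
  also have "2 * \<sigma> * (norm (x - centre_min c) + norm (c - centre_min c))
      = 2 * (\<sigma> * norm (x - centre_min c)) + 2 * (\<sigma> * sqrt (gap c))"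
    by (simp add: gap_def distrib_left)
  also have "\<dots> \<le> 2 * (3 * norm ?G) + 2 * (\<sigma> * sqrt (gap c))"
    using reg_error_bound[OF c x \<eta>(1,2)] by simp
  finally show ?thesis
    using grad_mapping_antimono[OF \<eta>(1,3) x] by simp
qed

text \<open>Finiteness of F at the start must be extracted from the extended-real bound: the infimum
  lies below some finite value, so an infinite F(x0) would make the difference infinite.\<close>

lemma objective_gap:
  assumes x0: "x0 \<in> space_of F"
    and \<Delta>: "objective F x0 - (INF x\<in>space_of F. objective F x) \<le> ereal \<Delta>"
  shows "x0 \<in> effdom" and "\<And>x. x \<in> effdom \<Longrightarrow> obj x0 - \<Delta> \<le> obj x"
proof -
  let ?I = "INF x\<in>space_of F. objective F x"
  have eq: "objective F x = ereal (obj x)" if "x \<in> effdom" for x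
    using that by (simp add: objective_def obj_def psi_eq)
  have I: "?I \<le> ereal (obj x)" if "x \<in> effdom" for x
    unfolding eq[OF that, symmetric] using that by (intro INF_lower) auto
  obtain u where u: "u \<in> effdom"
    using effdom_nonempty by blast
  have "psi F x0 \<noteq> \<infinity>"
  proof
    assume "psi F x0 = \<infinity>"
    then have "objective F x0 - ?I = \<infinity>"
      using I[OF u] by (cases ?I) (auto simp: objective_def)
    then show False
      using \<Delta> by simp
  qed
  then show x0e: "x0 \<in> effdom"
    using x0 unfolding effdom_def by simp
  fix x assume x: "x \<in> effdom"
  have "ereal (obj x0) - ereal (obj x) \<le> ereal (obj x0) - ?I"
    using I[OF x] by (intro ereal_minus_mono) auto
  then have "ereal (obj x0) - ereal (obj x) \<le> ereal \<Delta>"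
    using \<Delta> unfolding eq[OF x0e] by (rule order_trans)
  then show "obj x0 - \<Delta> \<le> obj x"
    by simp
qed

end

section \<open>Logarithmic factors and the rate of the subroutine\<close>

lemma log_plus_ge_1: "1 \<le> log_plus r"
  by (simp add: log_plus_def)

text \<open>The regularised problem has condition number 3 L / \<sigma>, the complexity bound speaks
  of L / \<sigma>. The shift ln 3 \<le> 2 is absorbed since \<open>log_plus\<close> is at least
  1.\<close>

lemma log_plus_times_3:
  assumes "0 < r"
  shows "log_plus (3 * r) \<le> 3 * log_plus r"
proof -
  have "ln (3 :: real) \<le> 3 - 1"
    by (rule ln_le_minus_one) simp
  then have "ln (3 * r) \<le> 2 + ln r"
    using assms by (simp add: ln_mult)
  then show ?thesis
    by (auto simp: log_plus_def max_def)
qed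

lemma powr_three_halves:
  fixes x :: real
  assumes "0 \<le> x"
  shows "x powr (3 / 2) = sqrt (x ^ 3)"
proof -
  have "x powr (3 / 2) = (x powr 3) powr (1 / 2)"
    by (simp add: powr_powr)
  also have "x powr 3 = x ^ 3"
    using assms by (cases "x = 0") (auto simp: powr_realpow[of x 3, simplified])
  finally show ?thesis
    using assms by (simp add: powr_half_sqrt)
qed

text \<open>The guarantee for one \<open>C'\<close> with its hidden constants named. They can then
  be fixed before any problem is given, as \<open>cS\<close> depends on A.\<close>

definition sgd_rate :: "subroutine \<Rightarrow> real \<Rightarrow> real \<Rightarrow> real \<Rightarrow> bool" where
  "sgd_rate sgd C' A a \<longleftrightarrow> (\<forall>H x0 \<sigma>' L' T V xmin.
      composite_problem H \<and>
      convex_on (space_of H) (smooth_part H) \<and>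
      smooth (dimen H) L' (smooth_part H) \<and>
      0 < \<sigma>' \<and> \<sigma>' \<le> L' \<and>
      strongly_convex (dimen H) \<sigma>' (objective H) \<and>
      is_arg_min (objective H) (\<lambda>x. x \<in> space_of H) xmin \<and>
      variance_le H V \<and>
      x0 \<in> space_of H \<and> psi H x0 < \<infinity> \<and>
      L' / \<sigma>' * log_plus (L' / \<sigma>') \<le> real T
      \<longrightarrow>
      (\<forall>(x, c) \<in> set_pmf (sgd H x0 \<sigma>' L' T). x \<in> space_of H \<and> c = T) \<and>
      integrable (sgd H x0 \<sigma>' L' T) (\<lambda>(x, c). norm (grad_mapping H (C' / L') x)) \<and>
      measure_pmf.expectation (sgd H x0 \<sigma>' L' T) (\<lambda>(x, c). norm (grad_mapping H (C' / L') x))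
        \<le> A * (sqrt V * log_plus (L' / \<sigma>') powr (3/2) / sqrt (real T))
          + (1 - \<sigma>' / L') powr (a * (real T / log_plus (L' / \<sigma>'))) * \<sigma>' * norm (x0 - xmin))"

lemma sgd3sc_guarantee_rate:
  assumes "sgd3sc_guarantee sgd" "0 < C" "C \<le> 1"
  obtains A a where "0 < A" "0 < a" "sgd_rate sgd C A a"
proof -
  have "0 < C \<and> C \<le> 1"
    using assms(2,3) by simp
  with assms(1)[unfolded sgd3sc_guarantee_def, THEN spec[of _ C]]
  have "\<exists>A>0. \<exists>a>0. sgd_rate sgd C A a"
    unfolding sgd_rate_def by (rule mp)
  then show thesis
    using that by blast
qed

context nonconvex_composite
begin

text \<open>The start y of the subroutine is also the regularisation centre, so its initial distance
  is the square root of \<open>gap y\<close>, already small in mean. The coefficient 9 is 7 from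
  this initial distance and 2 from \<open>grad_mapping_prune\<close>.\<close>

lemma sgd_pruning:
  assumes rate: "sgd_rate sgd C A a" and A: "0 < A" and a: "0 < a" and C: "0 < C" "C \<le> 1"
    and V: "variance_le F V" and y: "y \<in> effdom"
    and T: "3 * L / \<sigma> * log_plus (3 * L / \<sigma>) \<le> real T"
  defines "m \<equiv> sgd (regularised F \<sigma> y) y \<sigma> (3 * L) T"
  shows "\<And>x c. (x, c) \<in> set_pmf m \<Longrightarrow> x \<in> space_of F \<and> c = T"
    and "integrable m (\<lambda>(x, c). norm (grad_mapping F (C / L) x))"
    and "measure_pmf.expectation m (\<lambda>(x, c). norm (grad_mapping F (C / L) x))
      \<le> 7 * A * (sqrt V * log_plus (3 * L / \<sigma>) powr (3/2) / sqrt (real T)) + 9 * (\<sigma> * sqrt (gap y))"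
proof -
  let ?H = "regularised F \<sigma> y"
  let ?R = "A * (sqrt V * log_plus (3 * L / \<sigma>) powr (3/2) / sqrt (real T))"
  let ?g = "\<lambda>(x, c::nat). norm (grad_mapping ?H (C / (3 * L)) x)"
  let ?f = "\<lambda>(x, c::nat). norm (grad_mapping F (C / L) x)"
  have ys: "y \<in> space_of F"
    using y by simp
  have psi_y: "psi F y < \<infinity>"
    using y unfolding effdom_def by simp
  have hyp: "composite_problem ?H \<and>
      convex_on (space_of ?H) (smooth_part ?H) \<and>
      smooth (dimen ?H) (3 * L) (smooth_part ?H) \<and>
      0 < \<sigma> \<and> \<sigma> \<le> 3 * L \<and>
      strongly_convex (dimen ?H) \<sigma> (objective ?H) \<and>
      is_arg_min (objective ?H) (\<lambda>x. x \<in> space_of ?H) (centre_min y) \<and>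
      variance_le ?H V \<and>
      y \<in> space_of ?H \<and> psi ?H y < \<infinity> \<and>
      3 * L / \<sigma> * log_plus (3 * L / \<sigma>) \<le> real T"
    using composite_regularised[OF ys] convex_on_reg smooth_regularised[OF ys]
      strongly_convex_regularised[OF ys] is_arg_min_regularised[OF ys] variance_regularised[OF ys V]
      sigma_pos sigma_le ys psi_y T
    by (simp add: smooth_part_regularised)
  from rate[unfolded sgd_rate_def, rule_format, OF hyp]
  have out: "\<forall>(x, c) \<in> set_pmf m. x \<in> space_of F \<and> c = T" and int: "integrable m ?g"
    and E: "measure_pmf.expectation m ?g \<le> ?R
      + (1 - \<sigma> / (3 * L)) powr (a * (real T / log_plus (3 * L / \<sigma>))) * \<sigma> * norm (y - centre_min y)"
    unfolding m_def by simp_all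
  show mem: "x \<in> space_of F \<and> c = T" if "(x, c) \<in> set_pmf m" for x c
    using out that by blast
  have "0 \<le> a * (real T / log_plus (3 * L / \<sigma>))"
    using a log_plus_ge_1[of "3 * L / \<sigma>"] by simp
  moreover have "0 \<le> 1 - \<sigma> / (3 * L)" "1 - \<sigma> / (3 * L) \<le> 1"
    using sigma_pos sigma_le L_pos by (auto simp: field_simps)
  \<comment> \<open>The decaying factor multiplies \<sigma> times the initial distance, which the
    first phase controls.\<close>
  ultimately have "(1 - \<sigma> / (3 * L)) powr (a * (real T / log_plus (3 * L / \<sigma>))) \<le> 1"
    using powr_mono2 by fastforce
  then have "(1 - \<sigma> / (3 * L)) powr (a * (real T / log_plus (3 * L / \<sigma>))) * (\<sigma> * norm (y - centre_min y))
      \<le> 1 * (\<sigma> * norm (y - centre_min y))"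
    using sigma_pos by (intro mult_right_mono) auto
  then have E': "measure_pmf.expectation m ?g \<le> ?R + \<sigma> * sqrt (gap y)"
    using E by (simp add: gap_def mult.assoc)
  have "?f z \<le> 7 * ?g z + 2 * (\<sigma> * sqrt (gap y))" if "z \<in> set_pmf m" for z
  proof -
    have "fst z \<in> space_of F"
      using mem[of "fst z" "snd z"] that by simp
    moreover have "C / (3 * L) \<le> C / L"
      using C L_pos by (intro divide_left_mono) auto
    ultimately show ?thesis
      using grad_mapping_prune[OF ys, of "fst z" "C / (3 * L)" "C / L"] C L_pos
      by (simp add: case_prod_beta)
  qed
  then have AE: "AE z in m. ?f z \<le> 7 * ?g z + 2 * (\<sigma> * sqrt (gap y))"
    by (simp add: AE_measure_pmf_iff)
  have int': "integrable m (\<lambda>z. 7 * ?g z + 2 * (\<sigma> * sqrt (gap y)))"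
    using int by (intro Bochner_Integration.integrable_add integrable_mult_right) auto
  show intf: "integrable m ?f"
    by (rule Bochner_Integration.integrable_bound[OF int'])
      (use AE in \<open>auto elim!: eventually_mono intro: order_trans\<close>)
  have "measure_pmf.expectation m ?f \<le> measure_pmf.expectation m (\<lambda>z. 7 * ?g z + 2 * (\<sigma> * sqrt (gap y)))"
    using intf int' AE by (rule integral_mono_AE)
  also have "\<dots> = 7 * measure_pmf.expectation m ?g + 2 * (\<sigma> * sqrt (gap y))"
    using int by (subst Bochner_Integration.integral_add) auto
  finally show "measure_pmf.expectation m ?f \<le> 7 * A * (sqrt V * log_plus (3 * L / \<sigma>) powr (3/2) / sqrt (real T))
      + 9 * (\<sigma> * sqrt (gap y))"
    using E' unfolding mult.assoc[of 7 A] by linarith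
qed

end

section \<open>Choice of parameters\<close>

text \<open>The summand 8000 of \<open>cB\<close> makes the batch variance a small multiple of
  \<epsilon>^2; 48 / c0^2, with the lower bound on \<sigma>, makes the radicand of p at least 1. The
  factor 1/6 in \<alpha> leaves 4 \<alpha> L^2 p^2 = 2 \<sigma> / 3.\<close>

lemma parameter_bounds:
  fixes L \<sigma> V \<epsilon> c0 :: real
  assumes pos: "0 < V" "0 < \<epsilon>" "0 < \<sigma>" "\<sigma> \<le> L" "0 < c0"
    and cond: "c0 * (\<epsilon> * L / sqrt V) \<le> \<sigma>"
    and cB: "cB = 8000 + 48 / c0\<^sup>2"
    and B_def: "B = batch_size cB V \<epsilon>" and p_def: "p = sub_epoch_number L \<sigma> B"
    and \<alpha>_def: "\<alpha> = 1 / 6 * (\<sigma> / ((real p)\<^sup>2 * L\<^sup>2))"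
  shows "c0\<^sup>2 * L\<^sup>2 \<le> \<sigma>\<^sup>2 * (V / \<epsilon>\<^sup>2)"
    and "cB * (V / \<epsilon>\<^sup>2) \<le> real B" and "real B \<le> 2 * cB * (V / \<epsilon>\<^sup>2)"
    and "0 < p" and "root 3 (\<sigma>\<^sup>2 / (48 * L\<^sup>2) * real B) \<le> 2 * real p"
    and "0 < B" and "4 \<le> B div p" and "0 < \<alpha>" and "\<alpha> * (6 * L) \<le> 1"
    and "4 \<le> \<alpha> * real (B div p) * \<sigma>" and "4 * (\<alpha> * L\<^sup>2) * (real p)\<^sup>2 \<le> \<sigma>"
proof -
  let ?W = "V / \<epsilon>\<^sup>2"
  have L: "0 < L"
    using pos by simp
  have W: "0 < ?W"
    using pos by simp
  have cB_pos: "0 < cB" "48 \<le> cB * c0\<^sup>2"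
    using pos by (auto simp: cB field_simps add_pos_pos)
  have "c0 * \<epsilon> * L \<le> \<sigma> * sqrt V"
    using cond pos by (simp add: field_simps)
  then have "(c0 * \<epsilon> * L)\<^sup>2 \<le> (\<sigma> * sqrt V)\<^sup>2"
    using pos L by (intro power_mono) auto
  then show W_ge: "c0\<^sup>2 * L\<^sup>2 \<le> \<sigma>\<^sup>2 * ?W"
    using pos by (simp add: power_mult_distrib field_simps)
  have "48 * L\<^sup>2 \<le> (cB * c0\<^sup>2) * L\<^sup>2"
    using cB_pos by (intro mult_right_mono) auto
  also have "\<dots> = cB * (c0\<^sup>2 * L\<^sup>2)"
    by simp
  also have "\<dots> \<le> cB * (\<sigma>\<^sup>2 * ?W)"
    using W_ge cB_pos by (intro mult_left_mono) auto
  finally have cBW: "48 * L\<^sup>2 \<le> \<sigma>\<^sup>2 * (cB * ?W)"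
    by (simp add: mult_ac)
  show B_ge: "cB * ?W \<le> real B"
    unfolding B_def batch_size_def by (rule real_nat_ceiling_ge)
  have \<sigma>L: "\<sigma>\<^sup>2 \<le> L\<^sup>2"
    using pos by (intro power_mono) auto
  have "0 \<le> cB * ?W"
    using cB_pos W by (intro mult_nonneg_nonneg) auto
  then have "L\<^sup>2 * 48 \<le> L\<^sup>2 * (cB * ?W)"
    using cBW mult_right_mono[OF \<sigma>L, of "cB * ?W"] by linarith
  then have cBW48: "48 \<le> cB * ?W"
    by (rule mult_left_le_imp_le) (use L in simp)
  have "real B \<le> cB * ?W + 1"
    unfolding B_def batch_size_def using cBW48 by linarith
  then have "real B \<le> cB * ?W + cB * ?W"
    using cBW48 by linarith
  then show "real B \<le> 2 * cB * ?W"
    by (simp only: mult.assoc mult_2[of "cB * ?W"])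
  show B0: "0 < B"
    using B_ge cBW48 by linarith
  define r where "r = root 3 (\<sigma>\<^sup>2 / (48 * L\<^sup>2) * real B)"
  have "48 * L\<^sup>2 \<le> \<sigma>\<^sup>2 * real B"
    using cBW mult_left_mono[OF B_ge, of "\<sigma>\<^sup>2"] by simp
  then have "1 \<le> \<sigma>\<^sup>2 / (48 * L\<^sup>2) * real B"
    using L by (simp add: field_simps)
  \<comment> \<open>A root that is at least 1 loses at most a factor 2 when rounded down.\<close>
  then have r1: "1 \<le> r"
    unfolding r_def by simp
  have p: "real p \<le> r" "r < real p + 1"
    unfolding p_def sub_epoch_number_def r_def[symmetric] using r1 by linarith+
  show p0: "0 < p"
    using p r1 by linarith
  have "r \<le> 2 * real p"
    using p p0 by linarith
  then show "root 3 (\<sigma>\<^sup>2 / (48 * L\<^sup>2) * real B) \<le> 2 * real p"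
    unfolding r_def .
  have "real p ^ 3 \<le> r ^ 3"
    using p by (intro power_mono) auto
  also have "r ^ 3 = \<sigma>\<^sup>2 / (48 * L\<^sup>2) * real B"
    unfolding r_def by (intro real_root_pow_pos2) auto
  finally have p3: "48 * L\<^sup>2 * real p ^ 3 \<le> \<sigma>\<^sup>2 * real B"
    using L by (simp add: field_simps)
  have "L\<^sup>2 * (48 * real p ^ 3) \<le> L\<^sup>2 * real B"
    using p3 mult_right_mono[OF \<sigma>L, of "real B"] by simp
  then have "48 * real p ^ 3 \<le> real B"
    using L by simp
  moreover have "real p * 1 \<le> real p * (real p)\<^sup>2"
    using p0 by (intro mult_left_mono) auto
  then have "real p \<le> real p ^ 3"
    by (simp add: power2_eq_square power3_eq_cube)
  ultimately have "48 * real p \<le> real B"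
    by linarith
  then have Bp: "48 * p \<le> B"
    by linarith
  have "48 \<le> B div p"
    using div_le_mono[OF Bp, of p] p0 by simp
  then show m4: "4 \<le> B div p"
    by simp
  have "p * 1 \<le> p * (B div p)"
    using m4 by (intro mult_le_mono2) auto
  \<comment> \<open>The remainder is less than p and the quotient at least 1, so rounding m down
    also costs at most a factor 2.\<close>
  then have "B \<le> B div p * p + p * (B div p)"
    using div_mult_mod_eq[of B p] mod_less_divisor[OF p0, of B] by linarith
  then have "B \<le> 2 * (B div p) * p"
    by (simp only: mult_2 distrib_right mult.commute[of p "B div p"])
  then have B_le: "real B \<le> 2 * real (B div p) * real p"
    using of_nat_mono[of B "2 * (B div p) * p", where 'a = real] by simp
  show \<alpha>0: "0 < \<alpha>"
    unfolding \<alpha>_def using pos L p0 by simp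
  have "\<sigma> * 1 \<le> L * (real p)\<^sup>2"
    using pos p0 by (intro mult_mono) auto
  then show "\<alpha> * (6 * L) \<le> 1"
    unfolding \<alpha>_def using L p0 by (simp add: field_simps power2_eq_square)
  \<comment> \<open>Origin of 48: after the factor 2 from rounding, 24 remains, and 24 / 6 is the 4
    required of \<alpha> m \<sigma>.\<close>
  have "48 * L\<^sup>2 * real p ^ 3 \<le> \<sigma>\<^sup>2 * (2 * real (B div p) * real p)"
    using p3 mult_left_mono[OF B_le zero_le_power2] by (rule order_trans)
  then have "(24 * L\<^sup>2 * (real p)\<^sup>2) * (2 * real p) \<le> (\<sigma>\<^sup>2 * real (B div p)) * (2 * real p)"
    by (simp add: power2_eq_square power3_eq_cube mult_ac)
  then have "24 * L\<^sup>2 * (real p)\<^sup>2 \<le> \<sigma>\<^sup>2 * real (B div p)"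
    by (rule mult_right_le_imp_le) (use p0 in simp)
  then show "4 \<le> \<alpha> * real (B div p) * \<sigma>"
    unfolding \<alpha>_def using L p0 by (simp add: field_simps power2_eq_square)
  show "4 * (\<alpha> * L\<^sup>2) * (real p)\<^sup>2 \<le> \<sigma>"
    unfolding \<alpha>_def using L p0 pos by (simp add: field_simps)
qed

lemma powr_root3_quotient:
  fixes V \<epsilon> :: real
  assumes "0 < V" "0 < \<epsilon>"
  shows "\<epsilon>\<^sup>2 * (V powr (2 / 3) / \<epsilon> powr (10 / 3)) = (root 3 (V / \<epsilon>\<^sup>2))\<^sup>2"
proof -
  have "root 3 (V / \<epsilon>\<^sup>2) = (V / \<epsilon>\<^sup>2) powr (1 / 3)"
    using assms by (simp add: root_powr_inverse)
  also have "\<dots> = V powr (1 / 3) / \<epsilon> powr (2 / 3)"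
    using assms by (simp add: powr_divide powr_powr powr_numeral[symmetric] del: powr_numeral)
  finally have "(root 3 (V / \<epsilon>\<^sup>2))\<^sup>2 = V powr (2 / 3) / \<epsilon> powr (4 / 3)"
    using assms by (simp add: power_divide powr_power)
  moreover have "\<epsilon>\<^sup>2 / \<epsilon> powr (10 / 3) = \<epsilon> powr (2 - 10 / 3)"
    using assms by (subst powr_diff) simp
  then have "\<epsilon>\<^sup>2 / \<epsilon> powr (10 / 3) = 1 / \<epsilon> powr (4 / 3)"
    using powr_minus[of \<epsilon> "4 / 3"] by (simp add: field_simps)
  moreover have "\<epsilon>\<^sup>2 * (V powr (2 / 3) / \<epsilon> powr (10 / 3)) = V powr (2 / 3) * (\<epsilon>\<^sup>2 / \<epsilon> powr (10 / 3))"
    by simp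
  ultimately show ?thesis
    by (simp only: times_divide_eq_right mult_1_right)
qed

text \<open>As p is of order (\<sigma>^2 B / L^2)^(1/3), the quotient \<sigma> / p is of order (L^2
  \<sigma> / B)^(1/3). Since T B is at least a multiple of the iteration bound, a factor B^(2/3)
  remains, which the upper bound on B cancels against the powers of V and \<epsilon>.\<close>

lemma epoch_number_bound:
  fixes L \<sigma> V \<Delta> \<epsilon> cB B p T :: real
  assumes pos: "0 < V" "0 < \<epsilon>" "0 < \<sigma>" "0 < L" "0 \<le> \<Delta>" "1 \<le> 2 * cB" "0 < B" "0 < p"
    and B: "B \<le> 2 * cB * (V / \<epsilon>\<^sup>2)"
    and p: "root 3 (\<sigma>\<^sup>2 / (48 * L\<^sup>2) * B) \<le> 2 * p"
    and T: "128000 * cB * iteration_bound L \<sigma> \<Delta> V \<epsilon> / B \<le> T" "0 < T"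
  shows "4 * \<sigma> * \<Delta> / (T * p) \<le> \<epsilon>\<^sup>2 / 2000"
proof -
  let ?w = "root 3 (V / \<epsilon>\<^sup>2)" and ?b = "root 3 B"
  have b: "0 < ?b" "B = ?b * ?b\<^sup>2"
    using pos real_root_pow_pos2[of 3 B] by (simp_all add: power2_eq_square power3_eq_cube)
  have "?b \<le> root 3 (2 * cB * (V / \<epsilon>\<^sup>2))"
    using B by simp
  also have "\<dots> = root 3 (2 * cB) * ?w"
    by (simp only: real_root_mult)
  finally have "?b\<^sup>2 \<le> (root 3 (2 * cB) * ?w)\<^sup>2"
    using b by (intro power_mono) auto
  also have "\<dots> = (root 3 (2 * cB))\<^sup>2 * ?w\<^sup>2"
    by (simp add: power_mult_distrib)
  \<comment> \<open>A crude step, valid as the root is at least 1, that keeps the constants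
    rational.\<close>
  also have "(root 3 (2 * cB))\<^sup>2 \<le> (root 3 (2 * cB)) ^ 3"
    using pos by (intro power_increasing) auto
  also have "(root 3 (2 * cB)) ^ 3 = 2 * cB"
    using pos by (intro real_root_pow_pos2) auto
  finally have b2: "?b\<^sup>2 \<le> 2 * cB * ?w\<^sup>2"
    by (simp add: mult_right_mono)
  have "root 3 (\<sigma>\<^sup>2 / (48 * L\<^sup>2) * B) * root 3 (L\<^sup>2 * \<sigma>) = root 3 (\<sigma> ^ 3 * (B / 48))"
    using pos by (simp only: real_root_mult[symmetric]) (simp add: field_simps power2_eq_square power3_eq_cube)
  also have "\<dots> = \<sigma> * root 3 (B / 48)"
    using pos by (simp only: real_root_mult) (simp add: real_root_power_cancel)
  finally have eq: "root 3 (\<sigma>\<^sup>2 / (48 * L\<^sup>2) * B) * root 3 (L\<^sup>2 * \<sigma>) = \<sigma> * root 3 (B / 48)" .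
  \<comment> \<open>48 is enlarged to the cube 64 so that the root becomes explicit.\<close>
  have "root 3 (B / 64) = ?b / 4"
  proof -
    have "root 3 (64 :: real) = root 3 (4 ^ 3)"
      by simp
    also have "\<dots> = 4"
      by (rule real_root_power_cancel) auto
    finally show ?thesis
      by (simp add: real_root_divide)
  qed
  moreover have "root 3 (B / 64) \<le> root 3 (B / 48)"
    using pos by simp
  ultimately have b48: "?b / 4 \<le> root 3 (B / 48)"
    by linarith
  have "\<sigma> * (?b / 4) \<le> \<sigma> * root 3 (B / 48)"
    using pos b48 by (intro mult_left_mono) auto
  also have "\<dots> \<le> 2 * p * root 3 (L\<^sup>2 * \<sigma>)"
    unfolding eq[symmetric] using p pos by (intro mult_right_mono) auto
  finally have key: "\<sigma> * ?b \<le> 8 * p * root 3 (L\<^sup>2 * \<sigma>)"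
    by simp
  have "8000 * \<sigma> * \<Delta> * B = 8000 * \<Delta> * (\<sigma> * ?b) * ?b\<^sup>2"
    by (subst (1) b(2)) (simp add: mult_ac)
  \<comment> \<open>Origin of 128000 = 8000 * 8 * 2, where 8000 = 4 * 2000 is set by the target
    \<epsilon>^2 / 2000.\<close>
  also have "\<dots> \<le> 8000 * \<Delta> * (8 * p * root 3 (L\<^sup>2 * \<sigma>)) * (2 * cB * ?w\<^sup>2)"
    by (rule mult_mono[OF mult_left_mono[OF key] b2]) (use pos in auto)
  also have "\<dots> = p * (128000 * cB) * (root 3 (L\<^sup>2 * \<sigma>) * \<Delta> * ?w\<^sup>2)"
    by simp
  also have "root 3 (L\<^sup>2 * \<sigma>) * \<Delta> * ?w\<^sup>2 = \<epsilon>\<^sup>2 * iteration_bound L \<sigma> \<Delta> V \<epsilon>"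
    unfolding powr_root3_quotient[OF pos(1,2), symmetric] iteration_bound_def by simp
  also have "p * (128000 * cB) * (\<epsilon>\<^sup>2 * iteration_bound L \<sigma> \<Delta> V \<epsilon>)
      = \<epsilon>\<^sup>2 * p * (128000 * cB * iteration_bound L \<sigma> \<Delta> V \<epsilon>)"
    by simp
  also have "\<dots> \<le> \<epsilon>\<^sup>2 * p * (T * B)"
    using T pos by (intro mult_left_mono) (auto simp: field_simps)
  finally have "(8000 * \<sigma> * \<Delta>) * B \<le> (\<epsilon>\<^sup>2 * p * T) * B"
    by simp
  then have "8000 * \<sigma> * \<Delta> \<le> \<epsilon>\<^sup>2 * p * T"
    using pos by simp
  then show ?thesis
    using T pos by (simp add: field_simps)
qed

text \<open>5292 = 27 * 196: the cube of the factor 3 from \<open>log_plus_times_3\<close>, and the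
  square of 14, which turns the factor 7 A into the target \<epsilon> / 2.\<close>

lemma sgd_rate_term:
  fixes A :: real
  assumes pos: "0 < V" "0 < \<epsilon>" "0 < \<sigma>" "\<sigma> \<le> L" "0 < A"
    and T: "5292 * A\<^sup>2 * sgd_bound L \<sigma> V \<epsilon> \<le> T"
  shows "7 * A * (sqrt V * log_plus (3 * L / \<sigma>) powr (3/2) / sqrt T) \<le> \<epsilon> / 2"
proof -
  let ?l = "log_plus (L / \<sigma>)" and ?l3 = "log_plus (3 * L / \<sigma>)"
  have l: "1 \<le> ?l" "1 \<le> ?l3"
    by (rule log_plus_ge_1)+
  have "?l3 \<le> 3 * ?l"
    using log_plus_times_3[of "L / \<sigma>"] pos by simp
  then have l3: "?l3 ^ 3 \<le> (3 * ?l) ^ 3"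
    using l by (intro power_mono) auto
  have S: "0 < sgd_bound L \<sigma> V \<epsilon>"
    unfolding sgd_bound_def using pos l by simp
  then have T0: "0 < T"
    using T pos by (intro less_le_trans[OF _ T]) simp
  have "27 * 196 * A\<^sup>2 * (V * ?l ^ 3) = \<epsilon>\<^sup>2 * (5292 * A\<^sup>2 * sgd_bound L \<sigma> V \<epsilon>)"
    unfolding sgd_bound_def using pos by simp
  also have "\<dots> \<le> \<epsilon>\<^sup>2 * T"
    using T by (intro mult_left_mono) auto
  finally have "27 * V * ?l ^ 3 / T \<le> (\<epsilon> / (14 * A))\<^sup>2"
    using T0 pos by (simp add: power_divide power_mult_distrib field_simps)
  moreover have "V * ?l3 ^ 3 / T \<le> V * (3 * ?l) ^ 3 / T"
    using l3 pos T0 by (intro divide_right_mono mult_left_mono) auto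
  then have "V * ?l3 ^ 3 / T \<le> 27 * V * ?l ^ 3 / T"
    by (simp add: power_mult_distrib mult_ac)
  ultimately have "V * ?l3 ^ 3 / T \<le> (\<epsilon> / (14 * A))\<^sup>2"
    by (rule order_trans[rotated])
  then have "sqrt (V * ?l3 ^ 3 / T) \<le> \<epsilon> / (14 * A)"
    using pos by (intro real_le_lsqrt) auto
  moreover have "sqrt V * ?l3 powr (3/2) / sqrt T = sqrt (V * ?l3 ^ 3 / T)"
    using l by (simp add: powr_three_halves real_sqrt_mult real_sqrt_divide)
  ultimately have "7 * A * (sqrt V * ?l3 powr (3/2) / sqrt T) \<le> 7 * A * (\<epsilon> / (14 * A))"
    using pos by (intro mult_left_mono) auto
  then show ?thesis
    using pos by simp
qed

section \<open>Assembly of the two phases\<close>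

theorem theorem1:
  fixes sgd :: subroutine and C c\<^sub>0 :: real
  assumes "sgd3sc_guarantee sgd"
    and "0 < C" "C \<le> 1"
    and "0 < c\<^sub>0"
  shows "\<exists>cB>0. \<exists>c\<alpha>>0. \<exists>cT>0. \<exists>cL>0. \<exists>cS>0. \<exists>K>0.
    \<forall>(F :: problem) (L :: real) (\<sigma> :: real) (V :: real) (\<Delta> :: real) (x0 :: fvec) (\<epsilon> :: real).
      composite_problem F \<and>
      (\<forall>i\<in>{1..ncomp F}. smooth (dimen F) L (component F i)) \<and>
      nonconvex (dimen F) \<sigma> (smooth_part F) \<and>
      variance_le F V \<and> 0 < V \<and>
      x0 \<in> space_of F \<and>
      objective F x0 - (INF x\<in>space_of F. objective F x) \<le> ereal \<Delta> \<and>
      0 < \<epsilon> \<and> 0 < \<sigma> \<and> \<sigma> \<le> L \<and>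
      c\<^sub>0 * (\<epsilon> * L / sqrt V) \<le> \<sigma> \<and>
      batch_size cB V \<epsilon> \<le> ncomp F
      \<longrightarrow>
      (let out = natasha15_prune sgd cB c\<alpha> cT cL cS F L \<sigma> V \<Delta> x0 \<epsilon>;
           \<eta> = C / L
       in (\<forall>(x, c) \<in> set_pmf out.
             x \<in> space_of F \<and> real c \<le> K * (sgd_bound L \<sigma> V \<epsilon> + iteration_bound L \<sigma> \<Delta> V \<epsilon>)) \<and>
          integrable out (\<lambda>(x, c). norm (grad_mapping F \<eta> x)) \<and>
          measure_pmf.expectation out (\<lambda>(x, c). norm (grad_mapping F \<eta> x)) \<le> \<epsilon>)"
proof -
  obtain A a where A: "0 < A" and a: "0 < a" and rate: "sgd_rate sgd C A a"
    using sgd3sc_guarantee_rate[OF assms(1-3)] by blast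
  define cB where "cB = 8000 + 48 / c\<^sub>0\<^sup>2"
  \<comment> \<open>The first summand serves the rate of the subroutine, the second its minimal
    number of steps.\<close>
  define cS where "cS = 5292 * A\<^sup>2 + 9 / c\<^sub>0\<^sup>2"
  define cT where "cT = 128000 * cB"
  \<comment> \<open>An epoch costs at most 3 B. One epoch is charged to the rounding of T, with B
    \<le> 2 cB V / \<epsilon>^2, and the others to \<open>cT\<close>; 1 / c0^2 pays for rounding up
    the steps of the subroutine.\<close>
  define K where "K = 6 * cB + 3 * cT + cS + 1 / c\<^sub>0\<^sup>2"
  have c0: "0 < c\<^sub>0\<^sup>2"
    using assms(4) by simp
  have cB: "8000 \<le> cB"
    using c0 by (simp add: cB_def)
  have cS: "0 < cS"
    using c0 A by (simp add: cS_def add_pos_pos)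
  have cT: "0 < cT"
    using cB by (simp add: cT_def)
  have K: "0 < K"
    unfolding K_def using cB cT cS c0 by (intro add_pos_pos) auto
  have main: "(\<forall>(x, c) \<in> set_pmf (natasha15_prune sgd cB (1/6) cT 3 cS F L \<sigma> V \<Delta> x0 \<epsilon>).
        x \<in> space_of F \<and> real c \<le> K * (sgd_bound L \<sigma> V \<epsilon> + iteration_bound L \<sigma> \<Delta> V \<epsilon>)) \<and>
      integrable (natasha15_prune sgd cB (1/6) cT 3 cS F L \<sigma> V \<Delta> x0 \<epsilon>) (\<lambda>(x, c). norm (grad_mapping F (C / L) x)) \<and>
      measure_pmf.expectation (natasha15_prune sgd cB (1/6) cT 3 cS F L \<sigma> V \<Delta> x0 \<epsilon>)
        (\<lambda>(x, c). norm (grad_mapping F (C / L) x)) \<le> \<epsilon>"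
    if F: "composite_problem F" "\<forall>i\<in>{1..ncomp F}. smooth (dimen F) L (component F i)"
        "nonconvex (dimen F) \<sigma> (smooth_part F)"
      and V: "variance_le F V" "0 < V" and x0: "x0 \<in> space_of F"
      and \<Delta>: "objective F x0 - (INF x\<in>space_of F. objective F x) \<le> ereal \<Delta>"
      and pos: "0 < \<epsilon>" "0 < \<sigma>" "\<sigma> \<le> L"
      and cond: "c\<^sub>0 * (\<epsilon> * L / sqrt V) \<le> \<sigma>" and Bn: "batch_size cB V \<epsilon> \<le> ncomp F"
    for F :: problem and L \<sigma> V \<Delta> :: real and x0 :: fvec and \<epsilon> :: real
  proof -
    interpret nonconvex_composite F L \<sigma>
      by (rule nonconvex_composite.intro) (use F pos in blast)+
    define B where "B = batch_size cB V \<epsilon>"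
    define p where "p = sub_epoch_number L \<sigma> B"
    define \<alpha> where "\<alpha> = 1 / 6 * (\<sigma> / ((real p)\<^sup>2 * L\<^sup>2))"
    let ?I = "iteration_bound L \<sigma> \<Delta> V \<epsilon>" and ?S = "sgd_bound L \<sigma> V \<epsilon>" and ?W = "V / \<epsilon>\<^sup>2"
    define T where "T = max 1 (nat \<lceil>cT * ?I / real B\<rceil>)"
    define Ts where "Ts = nat \<lceil>cS * ?S\<rceil>"
    define N where "N = natasha15_full F \<sigma> x0 B p T \<alpha>"
    let ?k = "\<lambda>(yh, yp). sgd (regularised F \<sigma> yh) yh \<sigma> (3 * L) Ts"
    have out: "natasha15_prune sgd cB (1/6) cT 3 cS F L \<sigma> V \<Delta> x0 \<epsilon> = N \<bind>\<^sub>c ?k"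
      by (simp add: natasha15_prune_def Let_def N_def B_def p_def \<alpha>_def T_def Ts_def)
    note par = parameter_bounds[OF V(2) pos assms(4) cond cB_def B_def p_def \<alpha>_def]
    have B: "0 < B" "B \<le> ncomp F" "0 < B div p"
      using par(6,7) Bn by (simp_all add: B_def)
    note x0e = objective_gap(1)[OF x0 \<Delta>] and gap_obj = objective_gap(2)[OF x0 \<Delta>]
    have \<Delta>0: "0 \<le> \<Delta>"
      using gap_obj[OF x0e] by simp
    have I0: "0 \<le> ?I"
      unfolding iteration_bound_def using \<Delta>0 pos L_pos by simp
    have T0: "0 < T"
      by (simp add: T_def)
    have T_ge: "cT * ?I / real B \<le> real T"
      unfolding T_def by linarith
    have T_le: "real T \<le> 1 + cT * ?I / real B"
    proof -
      have "0 \<le> cT * ?I / real B"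
        using cT I0 by simp
      then show ?thesis
        unfolding T_def by linarith
    qed
    note p0 = par(4) and \<alpha>0 = par(8)
    have finN: "finite (set_pmf N)"
      unfolding N_def by (rule finite_natasha15_full[OF B p0 T0 \<alpha>0 x0e])
    have outN: "y \<in> effdom \<and> c = T * (B + p * (2 * (B div p)))" if "((y, y'), c) \<in> set_pmf N" for y y' c
      using natasha15_full_outcome[OF B p0 T0 \<alpha>0 x0e] that unfolding N_def by blast
    let ?l = "log_plus (L / \<sigma>)"
    have l: "1 \<le> ?l"
      by (rule log_plus_ge_1)
    have W: "0 < ?W"
      using V pos by simp
    have WS: "?W \<le> ?S"
      unfolding sgd_bound_def using W mult_left_mono[of 1 "?l ^ 3" ?W] l by simp
    \<comment> \<open>The lower bound on \<sigma>, squared. It makes V / \<epsilon>^2 dominate the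
      condition number, for the steps of the subroutine, and a constant, for the rounding.\<close>
    have W_ge: "c\<^sub>0\<^sup>2 * (L / \<sigma>)\<^sup>2 \<le> ?W"
      using par(1) pos by (simp add: power_divide field_simps)
    have L\<sigma>: "1 \<le> L / \<sigma>"
      using pos by simp
    then have "1 * (L / \<sigma>) \<le> (L / \<sigma>)\<^sup>2"
      unfolding power2_eq_square by (intro mult_right_mono) auto
    then have W_ge1: "c\<^sub>0\<^sup>2 * (L / \<sigma>) \<le> ?W"
      using W_ge mult_left_mono[of "L / \<sigma>" "(L / \<sigma>)\<^sup>2" "c\<^sub>0\<^sup>2"] c0 by simp
    have W_ge0: "c\<^sub>0\<^sup>2 \<le> ?W"
      using W_ge1 mult_left_mono[OF L\<sigma>, of "c\<^sub>0\<^sup>2"] c0 by simp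
    have Ts_ge: "cS * ?S \<le> real Ts"
      unfolding Ts_def by (rule real_nat_ceiling_ge)
    have Ts_cond: "3 * L / \<sigma> * log_plus (3 * L / \<sigma>) \<le> real Ts"
    proof -
      have "3 * L / \<sigma> * log_plus (3 * L / \<sigma>) \<le> 3 * L / \<sigma> * (3 * ?l)"
        using log_plus_times_3[of "L / \<sigma>"] pos L_pos by (intro mult_left_mono) auto
      also have "\<dots> = 9 * ((L / \<sigma>) * ?l)"
        by simp
      also have "(L / \<sigma>) * ?l \<le> (?W / c\<^sub>0\<^sup>2) * ?l ^ 3"
      proof (rule mult_mono)
        show "L / \<sigma> \<le> ?W / c\<^sub>0\<^sup>2"
          unfolding pos_le_divide_eq[OF c0] using W_ge1 by (simp only: mult.commute)
        show "?l \<le> ?l ^ 3"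
          using power_increasing[of 1 3 ?l] l by simp
        show "0 \<le> ?W / c\<^sub>0\<^sup>2"
          using W c0 by (intro divide_nonneg_nonneg less_imp_le)
      qed (use l in simp)
      also have "9 * ((?W / c\<^sub>0\<^sup>2) * ?l ^ 3) = 9 / c\<^sub>0\<^sup>2 * ?S"
        by (simp add: sgd_bound_def)
      also have "\<dots> \<le> cS * ?S"
        using WS W unfolding cS_def by (intro mult_right_mono) auto
      also have "\<dots> \<le> real Ts"
        by (rule Ts_ge)
      finally show ?thesis
        by simp
    qed
    have rate_term: "7 * A * (sqrt V * log_plus (3 * L / \<sigma>) powr (3/2) / sqrt (real Ts)) \<le> \<epsilon> / 2"
    proof (rule sgd_rate_term[OF V(2) pos A])
      have "5292 * A\<^sup>2 * ?S \<le> cS * ?S"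
        using WS W c0 unfolding cS_def by (intro mult_right_mono) auto
      then show "5292 * A\<^sup>2 * ?S \<le> real Ts"
        using Ts_ge by linarith
    qed
    note prune = sgd_pruning[OF rate A a assms(2,3) V(1) _ Ts_cond]
    have cost: "x \<in> space_of F \<and> real c \<le> K * (?S + ?I)" if xc: "(x, c) \<in> set_pmf (N \<bind>\<^sub>c ?k)" for x c
    proof -
      from xc obtain r c1 c2 where r: "(r, c1) \<in> set_pmf N" "(x, c2) \<in> set_pmf (?k r)" "c = c1 + c2"
        by (auto simp: in_set_bind_counted)
      obtain y y' where y: "r = (y, y')"
        by (cases r)
      have *: "y \<in> effdom" "c1 = T * (B + p * (2 * (B div p)))"
        using outN r(1) unfolding y by blast+
      have x: "x \<in> space_of F \<and> c2 = Ts"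
        using prune(1)[OF *(1), of x c2] r(2) by (simp add: y)
      have "p * (B div p) \<le> B"
        by simp
      \<comment> \<open>B gradients at the snapshot and two for each of the at most B inner
        steps.\<close>
      then have "c1 \<le> T * (3 * B)"
        unfolding * by (intro mult_le_mono2) linarith
      then have "real c1 \<le> real T * (3 * real B)"
        using of_nat_mono[of c1 "T * (3 * B)", where 'a = real] by simp
      also have "\<dots> \<le> (1 + cT * ?I / real B) * (3 * real B)"
        using T_le by (intro mult_right_mono) auto
      also have "\<dots> = 3 * real B + 3 * cT * ?I"
        using B by (simp add: field_simps)
      also have "\<dots> \<le> 6 * cB * ?S + 3 * cT * ?I"
        using par(3) mult_left_mono[OF WS, of "6 * cB"] cB by simp
      finally have c1: "real c1 \<le> 6 * cB * ?S + 3 * cT * ?I" .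
      have "0 \<le> cS * ?S"
        using cS WS W by (intro mult_nonneg_nonneg) auto
      then have "real Ts \<le> cS * ?S + 1"
        unfolding Ts_def by linarith
      also have "1 \<le> 1 / c\<^sub>0\<^sup>2 * ?S"
        using W_ge0 WS c0 by (simp add: field_simps)
      finally have c2: "real c2 \<le> cS * ?S + 1 / c\<^sub>0\<^sup>2 * ?S"
        using x by simp
      have "real c \<le> 6 * cB * ?S + 3 * cT * ?I + (cS * ?S + 1 / c\<^sub>0\<^sup>2 * ?S)"
        using c1 c2 r(3) by simp
      also have "\<dots> \<le> K * ?S + K * ?I"
      proof -
        have "(6 * cB + cS + 1 / c\<^sub>0\<^sup>2) * ?S \<le> K * ?S"
          using WS W cT unfolding K_def by (intro mult_right_mono) auto
        moreover have "3 * cT * ?I \<le> K * ?I"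
          using I0 cB cS c0 unfolding K_def by (intro mult_right_mono) auto
        ultimately show ?thesis
          by (simp add: distrib_right)
      qed
      finally show ?thesis
        using x by (simp add: distrib_left)
    qed
    \<comment> \<open>The square root of the gap is linearised by
      \<open>0 \<le> (36 * s - \<epsilon>)\<^sup>2\<close>, in place of Jensen's inequality, since
      only the expected gap is bounded. The 5/8 collects 1/2 from the rate term and 1/8 from this
      step.\<close>
    define h where "h r = 5 / 8 * \<epsilon> + 162 / \<epsilon> * (\<sigma>\<^sup>2 * gap (fst r))" for r :: "fvec \<times> fvec"
    have h0: "0 \<le> h r" for r
      unfolding h_def gap_def using pos by simp
    have int: "integrable (?k r) (\<lambda>(x, c). norm (grad_mapping F (C / L) x))"
      and le: "measure_pmf.expectation (?k r) (\<lambda>(x, c). norm (grad_mapping F (C / L) x)) \<le> h r"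
      if r: "(r, c) \<in> set_pmf N" for r c
    proof -
      obtain y y' where y: "r = (y, y')"
        by (cases r)
      have ye: "y \<in> effdom"
        using outN r unfolding y by blast
      show "integrable (?k r) (\<lambda>(x, c). norm (grad_mapping F (C / L) x))"
        using prune(2)[OF ye] by (simp add: y)
      let ?s = "\<sigma> * sqrt (gap y)"
      have "0 \<le> (36 * ?s - \<epsilon>)\<^sup>2"
        by simp
      also have "\<dots> = 8 * \<epsilon> * (162 / \<epsilon> * ?s\<^sup>2 - 9 * ?s + \<epsilon> / 8)"
        using pos by (simp add: power2_eq_square field_simps)
      finally have "9 * ?s \<le> 162 / \<epsilon> * ?s\<^sup>2 + \<epsilon> / 8"
        using pos by (simp add: zero_le_mult_iff)
      moreover have "?s\<^sup>2 = \<sigma>\<^sup>2 * gap y"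
        by (simp add: power_mult_distrib gap_def)
      ultimately show "measure_pmf.expectation (?k r) (\<lambda>(x, c). norm (grad_mapping F (C / L) x)) \<le> h r"
        using prune(3)[OF ye] rate_term by (simp add: y h_def)
    qed
    have gapN: "\<sigma>\<^sup>2 * cexp N (\<lambda>(y, y'). gap y) \<le> \<epsilon>\<^sup>2 / 1000"
    proof -
      have "\<sigma>\<^sup>2 * cexp N (\<lambda>(y, y'). gap y) \<le> 4 * \<sigma> * \<Delta> / (real T * real p) + 4 * V / real B"
        unfolding N_def
        by (rule natasha15_full_gap[OF V(1) B(1,2) par(8,9,10,7,4,11) T0 x0e gap_obj])
      also have "4 * \<sigma> * \<Delta> / (real T * real p) \<le> \<epsilon>\<^sup>2 / 2000"
        using T_ge T0 B(1) p0 cB \<Delta>0 unfolding cT_def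
        by (intro epoch_number_bound[OF V(2) pos(1,2) L_pos _ _ _ _ par(3,5)]) auto
      also have "4 * V / real B \<le> \<epsilon>\<^sup>2 / 2000"
      proof -
        have "8000 * ?W \<le> cB * ?W"
          using cB W by (intro mult_right_mono) auto
        then have "8000 * ?W \<le> real B"
          using par(2) by linarith
        then show ?thesis
          using B(1) pos by (simp add: field_simps)
      qed
      finally show ?thesis
        by simp
    qed
    have "cexp N h = 5 / 8 * \<epsilon> + 162 / \<epsilon> * (\<sigma>\<^sup>2 * cexp N (\<lambda>(y, y'). gap y))"
      unfolding h_def case_prod_beta by (simp only: cexp_add[OF finN] cexp_const cexp_cmult)
    \<comment> \<open>Total budget: 0.625 + 0.162 < 1. The 1000 comes from two shares of
      \<epsilon>^2 / 2000, one for the number of epochs and one for the batch.\<close>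
    also have "\<dots> \<le> 5 / 8 * \<epsilon> + 162 / \<epsilon> * (\<epsilon>\<^sup>2 / 1000)"
      using gapN pos by (intro add_left_mono mult_left_mono) auto
    also have "\<dots> \<le> \<epsilon>"
      using pos by (simp add: power2_eq_square)
    finally have hN: "cexp N h \<le> \<epsilon>" .
    note bind = expectation_bind_counted_le[where g = "\<lambda>x. norm (grad_mapping F (C / L) x)"
        and h = h and m = N and k = ?k, OF finN norm_ge_zero h0]
    have I: "integrable (N \<bind>\<^sub>c ?k) (\<lambda>(x, c). norm (grad_mapping F (C / L) x))"
      by (rule bind(1)[OF int le])
    have "measure_pmf.expectation (N \<bind>\<^sub>c ?k) (\<lambda>(x, c). norm (grad_mapping F (C / L) x)) \<le> cexp N h"
      by (rule bind(2)[OF int le])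
    then have "measure_pmf.expectation (N \<bind>\<^sub>c ?k) (\<lambda>(x, c). norm (grad_mapping F (C / L) x)) \<le> \<epsilon>"
      using hN by linarith
    moreover have "\<forall>(x, c)\<in>set_pmf (N \<bind>\<^sub>c ?k). x \<in> space_of F \<and> real c \<le> K * (?S + ?I)"
      using cost by blast
    ultimately show ?thesis
      unfolding out using I by (intro conjI)
  qed
  have pos: "0 < cB" "0 < (1 / 6 :: real)" "0 < cT" "0 < (3 :: real)" "0 < cS" "0 < K"
    using cB cT cS K by simp_all
  show ?thesis
    unfolding Let_def
    by (rule exI[of _ cB], rule conjI[OF pos(1)], rule exI[of _ "1 / 6"], rule conjI[OF pos(2)],
        rule exI[of _ cT], rule conjI[OF pos(3)], rule exI[of _ 3], rule conjI[OF pos(4)],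
        rule exI[of _ cS], rule conjI[OF pos(5)], rule exI[of _ K], rule conjI[OF pos(6)],
        intro allI impI, elim conjE, rule main; assumption)
qed

end
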